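(* Let $\alpha,\beta>-1$. For every $f\in L^2(\mathbb{R}^2_+)$ we have Plancherel's identity $$\|\mathcal{G}_{\alpha,\beta}^\circ f\|_{L^2(\Gamma^\circ)}=\|f\|_{L^2(\mathbb{R}^2_+)}$$ and the inverse formula $$f=\mathcal{G}_{\alpha,\beta}^{\circ;-1}\big(\mathcal{G}_{\alpha,\beta}^\circ f\big).$$ Moreover, for every $F\in L^2(\Gamma^\circ)$ we have $$\|\mathcal{G}_{\alpha,\beta}^{\circ;-1} F\|_{L^2(\mathbb{R}^2_+)}=\|F\|_{L^2(\Gamma^\circ)}$$ and $$F=\mathcal{G}_{\alpha,\beta}^{\circ}\big(\mathcal{G}_{\alpha,\beta}^{\circ;-1}F\big).$$
   Context: Notation: $\mathbb{N}=\{0,1,2,\ldots\}$, $\mathbb{R}^2_+=(0,\infty)\times(0,\infty)$; $L^2(0,\infty)$ and $L^2(\mathbb{R}^2_+)$ are taken with respect to Lebesgue measure (complex-valued functions). For $\beta>-1$, $J_\beta$ is the Bessel function of the first kind of order $\beta$. The Hankel transform $\mathcal{H}_\beta^\circ$ is the unitary automorphism of $L^2(0,\infty)$ determined by $\mathcal{H}_\beta^\circ g(\tau)=\int_0^\infty g(u)(\tau u)^{1/2}J_\beta(\tau u)\,du$, $\tau>0$, for $g\in C^\infty_c(0,\infty)$; it satisfies $(\mathcal{H}_\beta^\circ)^{-1}=\mathcal{H}_\beta^\circ$. For $\alpha>-1$, $n\in\mathbb{N}$, $\tau>0$, let $$\ell_n^{\alpha,\circ}(r)=\Big(\frac{2\Gamma(n+1)}{\Gamma(n+\alpha+1)}\Big)^{1/2}L_n^\alpha(r^2)e^{-r^2/2}r^{\alpha+1/2},\qquad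 \ell_{n,\tau}^{\alpha,\circ}(r)=\tau^{1/4}\ell_n^{\alpha,\circ}(\sqrt{\tau}\,r),\quad r>0,$$ where $L_n^\alpha$ is the $n$th Laguerre polynomial of order $\alpha$. For each $\tau>0$, $\{\ell_{n,\tau}^{\alpha,\circ}\}_{n\in\mathbb{N}}$ is an orthonormal basis of $L^2(0,\infty)$. The Laguerre scaled transform is the unitary map $\mathcal{L}^\circ_{\alpha,\tau}\colon L^2(0,\infty)\to\ell^2(\mathbb{N})$, $\mathcal{L}^\circ_{\alpha,\tau}g(n)=\int_0^\infty g(r)\ell_{n,\tau}^{\alpha,\circ}(r)\,dr$, with inverse $\mathcal{L}^{\circ;-1}_{\alpha,\tau}\{c_n\}=\sum_{n=0}^\infty c_n\ell_{n,\tau}^{\alpha,\circ}$. For $f\in L^2(\mathbb{R}^2_+)$ write $f_r=f(r,\cdot)$. For a.e. $\tau>0$ the function $r\mapsto \mathcal{H}_\beta^\circ f_r(\tau)$ is in $L^2(0,\infty)$, and one sets $$\mathcal{G}_{\alpha,\beta}^\circ f(n,\tau)=\mathcal{L}^\circ_{\alpha,\tau}\big[r\mapsto\mathcal{H}_\beta^\circ f_r(\tau)\big](n),\qquad n\in\mathbb{N},\ \text{a.e. }\tau>0.$$ $L^2(\Gamma^\circ)=L^2(\mathbb{N}\times(0,\infty),dn\times d\tau)$ with $dn$ the counting measure and $d\tau$ Lebesgue measure, so that $\|F\|_{L^2(\Gamma^\circ)}^2=\sum_{n=0}^\infty\int_0^\infty|F(n,\tau)|^2\,d\tau$. For $F\in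 L^2(\Gamma^\circ)$ write $F_\tau=F(\cdot,\tau)$, which is in $\ell^2(\mathbb{N})$ for a.e. $\tau$; for a.e. $r>0$ the function $\tau\mapsto \mathcal{L}^{\circ;-1}_{\alpha,\tau}F_\tau(r)$ is in $L^2(0,\infty)$, and one sets $$\mathcal{G}_{\alpha,\beta}^{\circ;-1}F(r,s)=\mathcal{H}_\beta^\circ\big[\tau\mapsto\mathcal{L}^{\circ;-1}_{\alpha,\tau}F_\tau(r)\big](s),\qquad r,s>0.$$ *)

theory Defs
  imports "HOL-Analysis.Analysis"
begin

section \<open>The spaces \<open>L\<^sup>2\<close>\<close>

text \<open>
  Elements of \<open>L\<^sup>2\<close> are represented by functions; identities between them are stated
  almost everywhere.
\<close>

definition L2 :: "'a measure \<Rightarrow> ('a \<Rightarrow> complex) set"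
  where "L2 M = {f. f \<in> borel_measurable M \<and> integrable M (\<lambda>x. (cmod (f x))\<^sup>2)}"

definition L2_norm :: "'a measure \<Rightarrow> ('a \<Rightarrow> complex) \<Rightarrow> real"
  where "L2_norm M f = sqrt (LINT x|M. (cmod (f x))\<^sup>2)"

definition L2_tendsto :: "'a measure \<Rightarrow> (nat \<Rightarrow> 'a \<Rightarrow> complex) \<Rightarrow> ('a \<Rightarrow> complex) \<Rightarrow> bool"
  where "L2_tendsto M u h \<longleftrightarrow>
    (\<forall>N. u N \<in> L2 M) \<and> h \<in> L2 M \<and> (\<lambda>N. L2_norm M (\<lambda>x. u N x - h x)) \<longlonglongrightarrow> 0"

text \<open>
  A unitary automorphism of \<open>L\<^sup>2\<close>, acting on representatives.  That it respects almost
  everywhere equality follows from linearity and isometry.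
\<close>

definition L2_unitary :: "'a measure \<Rightarrow> (('a \<Rightarrow> complex) \<Rightarrow> ('a \<Rightarrow> complex)) \<Rightarrow> bool"
  where "L2_unitary M U \<longleftrightarrow>
    (\<forall>g\<in>L2 M. U g \<in> L2 M \<and> L2_norm M (U g) = L2_norm M g) \<and>
    (\<forall>g\<in>L2 M. \<forall>h\<in>L2 M. \<forall>a b.
       AE x in M. U (\<lambda>y. a * g y + b * h y) x = a * U g x + b * U h x) \<and>
    (\<forall>h\<in>L2 M. \<exists>g\<in>L2 M. AE x in M. U g x = h x)"

abbreviation half_line :: "real measure"
  where "half_line \<equiv> lebesgue_on {0<..}"

abbreviation quadrant :: "(real \<times> real) measure"
  where "quadrant \<equiv> lebesgue_on ({0<..} \<times> {0<..})"

abbreviation Gamma_space :: "(nat \<times> real) measure"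
  where "Gamma_space \<equiv> count_space UNIV \<Otimes>\<^sub>M half_line"

text \<open>
  The mixed transforms evaluate, for each value of one variable, an \<open>L\<^sup>2\<close> class of the other
  variable at a point, and then regard the result as a function of the first variable.  An
  arbitrary choice of representatives, made separately for each value of the first variable,
  need not give a measurable function.  The point values of a class are therefore taken to be
  its limiting averages.  They depend only on the class, not on the representative, and agree
  with any representative at almost every point, by Lebesgue's differentiation theorem.
\<close>

definition point_value :: "(real \<Rightarrow> complex) \<Rightarrow> real \<Rightarrow> complex"
  where "point_value h x =
    lim (\<lambda>k. real (Suc k) *\<^sub>R (LINT y:{x..x + 1 / real (Suc k)}|lebesgue. h y))"


section \<open>The Hankel transform\<close>

text \<open>\<open>C\<^sub>c\<^sup>\<infinity>(0,\<infinity>)\<close>, with functions extended by zero to the real line.\<close>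

definition test_function :: "(real \<Rightarrow> complex) \<Rightarrow> bool"
  where "test_function \<phi> \<longleftrightarrow>
    (\<exists>D :: nat \<Rightarrow> real \<Rightarrow> complex.
       D 0 = \<phi> \<and> (\<forall>k x. (D k has_vector_derivative D (Suc k) x) (at x))) \<and>
    (\<exists>K. compact K \<and> K \<subseteq> {0<..} \<and> (\<forall>x. x \<notin> K \<longrightarrow> \<phi> x = 0))"

text \<open>The Bessel function of the first kind, for \<open>x > 0\<close> and \<open>\<beta> > -1\<close>.\<close>

definition bessel_J :: "real \<Rightarrow> real \<Rightarrow> real"
  where "bessel_J \<beta> x =
    (\<Sum>k. (-1) ^ k / (fact k * Gamma (real k + \<beta> + 1)) * (x / 2) powr (2 * real k + \<beta>))"

definition hankel_integral :: "real \<Rightarrow> (real \<Rightarrow> complex) \<Rightarrow> real \<Rightarrow> complex"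
  where "hankel_integral \<beta> g \<tau> =
    (LINT u|half_line. g u * complex_of_real ((\<tau> * u) powr (1/2) * bessel_J \<beta> (\<tau> * u)))"

text \<open>
  By density of the test functions, any two operators \<open>U\<close> as below agree on
  \<open>L\<^sup>2(0,\<infinity>)\<close> up to null sets, so that \<open>point_value\<close> makes the transform of
  a square integrable function independent of the choice.
\<close>

definition hankel :: "real \<Rightarrow> (real \<Rightarrow> complex) \<Rightarrow> real \<Rightarrow> complex"
  where "hankel \<beta> g = point_value
    ((SOME U. L2_unitary half_line U \<and>
        (\<forall>\<phi>. test_function \<phi> \<longrightarrow> (AE \<tau> in half_line. U \<phi> \<tau> = hankel_integral \<beta> \<phi> \<tau>))) g)"


section \<open>The Laguerre scaled transform\<close>

definition laguerre :: "nat \<Rightarrow> real \<Rightarrow> real \<Rightarrow> real"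
  where "laguerre n \<alpha> x =
    (\<Sum>k\<le>n. (-1) ^ k * ((real n + \<alpha>) gchoose (n - k)) * x ^ k / fact k)"

definition laguerre_fun :: "real \<Rightarrow> nat \<Rightarrow> real \<Rightarrow> real"
  where "laguerre_fun \<alpha> n r =
    (2 * Gamma (real n + 1) / Gamma (real n + \<alpha> + 1)) powr (1/2)
      * laguerre n \<alpha> (r\<^sup>2) * exp (- r\<^sup>2 / 2) * r powr (\<alpha> + 1/2)"

definition laguerre_fun_scaled :: "real \<Rightarrow> real \<Rightarrow> nat \<Rightarrow> real \<Rightarrow> real"
  where "laguerre_fun_scaled \<alpha> \<tau> n r = \<tau> powr (1/4) * laguerre_fun \<alpha> n (sqrt \<tau> * r)"

definition laguerre_transform :: "real \<Rightarrow> real \<Rightarrow> (real \<Rightarrow> complex) \<Rightarrow> nat \<Rightarrow> complex"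
  where "laguerre_transform \<alpha> \<tau> g n =
    (LINT r|half_line. g r * complex_of_real (laguerre_fun_scaled \<alpha> \<tau> n r))"

text \<open>The series converges in \<open>L\<^sup>2(0,\<infinity>)\<close>.\<close>

definition laguerre_inverse :: "real \<Rightarrow> real \<Rightarrow> (nat \<Rightarrow> complex) \<Rightarrow> real \<Rightarrow> complex"
  where "laguerre_inverse \<alpha> \<tau> c = point_value
    (SOME h. L2_tendsto half_line
       (\<lambda>N r. \<Sum>n<N. c n * complex_of_real (laguerre_fun_scaled \<alpha> \<tau> n r)) h)"


section \<open>The mixed transform and its inverse\<close>

definition G_transform :: "real \<Rightarrow> real \<Rightarrow> (real \<times> real \<Rightarrow> complex) \<Rightarrow> nat \<times> real \<Rightarrow> complex"
  where "G_transform \<alpha> \<beta> f =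
    (\<lambda>(n, \<tau>). laguerre_transform \<alpha> \<tau> (\<lambda>r. hankel \<beta> (\<lambda>s. f (r, s)) \<tau>) n)"

definition G_inverse :: "real \<Rightarrow> real \<Rightarrow> (nat \<times> real \<Rightarrow> complex) \<Rightarrow> real \<times> real \<Rightarrow> complex"
  where "G_inverse \<alpha> \<beta> F =
    (\<lambda>(r, s). hankel \<beta> (\<lambda>\<tau>. laguerre_inverse \<alpha> \<tau> (\<lambda>n. F (n, \<tau>)) r) s)"

end

theory Submission
  imports Defs
begin

text \<open>
  Both halves of the mixed transform are unitary in one variable with the other one as a
  parameter, so Plancherel's identity and the inversion formula follow by Tonelli's theorem,
  once two things are known: that the one-variable transforms are unitary (and, for Hankel, an
  involution), and that fibrewise application yields jointly measurable functions.

  The one-variable transforms are treated through the Gaussians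
  \<open>gauss \<alpha> s r = r powr (\<alpha> + 1/2) * exp (- s r\<^sup>2 / 2)\<close>, \<open>s > 0\<close>.  They determine a function almost
  everywhere: by the Weierstrass approximation theorem, a function whose integrals against
  all of them vanish is zero (\<open>zero_AE_if_gauss_integrals_zero\<close>).
  Their Laguerre coefficients come from the binomial theorem, and the squares of these
  coefficients form a binomial series with sum the squared norm (\<open>gauss_coeff_Parseval\<close>).
  Hence the Gaussians lie in the closed span of the Laguerre functions, and the latter, which
  are orthonormal, form a basis (\<open>laguerre_basis\<close>).

  For the Hankel transform one starts from its spectral decomposition: \<open>hankel_op \<beta>\<close> is the
  operator with eigenvalue \<open>(-1)^n\<close> on the \<open>n\<close>-th Laguerre function of order \<open>\<beta>\<close>.  It is a
  unitary involution by definition.  Replacing \<open>s\<close> by \<open>1/s\<close> changes the sign of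
  \<open>(s - 1) / (s + 1)\<close>, whose \<open>n\<close>-th power is the essential factor of the \<open>n\<close>-th coefficient of a
  Gaussian; so \<open>hankel_op\<close> maps a Gaussian with parameter \<open>s\<close> to a multiple of the one with
  parameter \<open>1/s\<close>.  Integrating the Bessel series term by term shows that the Hankel kernel does
  the same (\<open>gauss_hankel_kernel\<close>).  By Fubini's theorem, \<open>hankel_op \<phi>\<close> and the Hankel integral
  of a test function \<open>\<phi>\<close> have the same integrals against all Gaussians, and therefore agree
  (\<open>hankel_op_test_function\<close>).  Test functions approximate indicator functions of intervals, which
  shows that no other unitary operator extends the Hankel integral (\<open>hankel_op_unique\<close>).

  Measurability rests on the use of limiting averages as point values.  The average of an
  orthonormal series over an interval is the sum of the products of its coefficients with those
  of the indicator function of the interval, an expression jointly measurable in the point and in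
  the parameter of the fibre (\<open>series_value_measurable\<close>).  The fibrewise transforms can then
  be expressed by relations between Borel functions, \<open>hankel_pair\<close> and \<open>laguerre_pair\<close>, which
  are composed in the final proof.
\<close>

section \<open>Square integrable functions\<close>

lemma L2_measurable [measurable_dest]: "f \<in> L2 M \<Longrightarrow> f \<in> borel_measurable M"
  by (simp add: L2_def)

lemma L2_integrable_square: "f \<in> L2 M \<Longrightarrow> integrable M (\<lambda>x. (cmod (f x))\<^sup>2)"
  by (simp add: L2_def)

lemma L2I:
  "f \<in> borel_measurable M \<Longrightarrow> integrable M (\<lambda>x. (cmod (f x))\<^sup>2) \<Longrightarrow> f \<in> L2 M"
  by (simp add: L2_def)

lemma L2_norm_nonneg [simp]: "0 \<le> L2_norm M f"
  by (simp add: L2_norm_def)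

lemma L2_norm_square: "(L2_norm M f)\<^sup>2 = (LINT x|M. (cmod (f x))\<^sup>2)"
  by (simp add: L2_norm_def)

lemma L2_cong_AE:
  assumes "f \<in> L2 M" "g \<in> borel_measurable M" "AE x in M. f x = g x"
  shows "g \<in> L2 M"
proof (rule L2I[OF assms(2)])
  show "integrable M (\<lambda>x. (cmod (g x))\<^sup>2)"
    by (rule integrable_cong_AE_imp[OF L2_integrable_square[OF assms(1)]])
      (use assms in auto)
qed

lemma L2_norm_cong_AE:
  assumes "f \<in> borel_measurable M" "g \<in> borel_measurable M" "AE x in M. f x = g x"
  shows "L2_norm M f = L2_norm M g"
  unfolding L2_norm_def
  by (intro arg_cong[of _ _ sqrt] integral_cong_AE) (use assms in auto)

lemma L2_mult_integrable:
  assumes "f \<in> L2 M" "g \<in> L2 M"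
  shows "integrable M (\<lambda>x. f x * g x)"
proof (rule Bochner_Integration.integrable_bound)
  show "integrable M (\<lambda>x. (cmod (f x))\<^sup>2 + (cmod (g x))\<^sup>2)"
    using assms by (intro Bochner_Integration.integrable_add L2_integrable_square)
  show "(\<lambda>x. f x * g x) \<in> borel_measurable M"
    using assms by measurable
  show "AE x in M. norm (f x * g x) \<le> norm ((cmod (f x))\<^sup>2 + (cmod (g x))\<^sup>2)"
  proof (intro AE_I2)
    fix x
    have "0 \<le> (cmod (f x) - cmod (g x))\<^sup>2" by simp
    then have "2 * (cmod (f x) * cmod (g x)) \<le> (cmod (f x))\<^sup>2 + (cmod (g x))\<^sup>2"
      by (simp add: power2_diff)
    moreover have "0 \<le> cmod (f x) * cmod (g x)" by simp
    ultimately have "cmod (f x) * cmod (g x) \<le> (cmod (f x))\<^sup>2 + (cmod (g x))\<^sup>2"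
      by linarith
    then show "norm (f x * g x) \<le> norm ((cmod (f x))\<^sup>2 + (cmod (g x))\<^sup>2)"
      by (simp add: norm_mult)
  qed
qed

lemma L2_scale:
  assumes "f \<in> L2 M" shows "(\<lambda>x. a * f x) \<in> L2 M"
proof (rule L2I)
  show "(\<lambda>x. a * f x) \<in> borel_measurable M"
    using assms by measurable
  show "integrable M (\<lambda>x. (cmod (a * f x))\<^sup>2)"
    using L2_integrable_square[OF assms] by (simp add: norm_mult power_mult_distrib)
qed

lemma L2_cnj:
  assumes "f \<in> L2 M" shows "(\<lambda>x. cnj (f x)) \<in> L2 M"
proof (rule L2I)
  show "(\<lambda>x. cnj (f x)) \<in> borel_measurable M"
    using borel_measurable_continuous_onI[of cnj] L2_measurable[OF assms]
    by (auto intro!: continuous_intros)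
qed (use L2_integrable_square[OF assms] in simp)

lemma L2_add:
  assumes "f \<in> L2 M" "g \<in> L2 M" shows "(\<lambda>x. f x + g x) \<in> L2 M"
proof (rule L2I)
  show "(\<lambda>x. f x + g x) \<in> borel_measurable M"
    using assms by measurable
  have "integrable M (\<lambda>x. (cmod (f x))\<^sup>2 + (cmod (g x))\<^sup>2 + 2 * Re (f x * cnj (g x)))"
    by (intro Bochner_Integration.integrable_add L2_integrable_square assms integrable_mult_right
        integrable_Re L2_mult_integrable L2_cnj)
  moreover have "(cmod (f x))\<^sup>2 + (cmod (g x))\<^sup>2 + 2 * Re (f x * cnj (g x)) = (cmod (f x + g x))\<^sup>2" for x
    unfolding cmod_power2 by (simp add: algebra_simps power2_eq_square)
  ultimately show "integrable M (\<lambda>x. (cmod (f x + g x))\<^sup>2)" by simp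
qed

lemma L2_diff: "f \<in> L2 M \<Longrightarrow> g \<in> L2 M \<Longrightarrow> (\<lambda>x. f x - g x) \<in> L2 M"
  using L2_add[of f M "\<lambda>x. (-1) * g x"] L2_scale[of g M "-1"] by simp

lemma L2_zero: "(\<lambda>x. 0) \<in> L2 M"
  by (rule L2I) auto

lemma L2_sum: "(\<And>i. i \<in> A \<Longrightarrow> f i \<in> L2 M) \<Longrightarrow> (\<lambda>x. \<Sum>i\<in>A. f i x) \<in> L2 M"
  by (induction A rule: infinite_finite_induct) (auto intro: L2_zero L2_add)

lemma L2_norm_eq_0:
  assumes "f \<in> L2 M"
  shows "L2_norm M f = 0 \<longleftrightarrow> (AE x in M. f x = 0)"
  unfolding L2_norm_def
  using integral_nonneg_eq_0_iff_AE[OF L2_integrable_square[OF assms]] by simp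

definition L2_inner :: "'a measure \<Rightarrow> ('a \<Rightarrow> complex) \<Rightarrow> ('a \<Rightarrow> complex) \<Rightarrow> complex"
  where "L2_inner M f g = (LINT x|M. f x * cnj (g x))"

lemma L2_norm_add_scale:
  assumes "f \<in> L2 M" "g \<in> L2 M"
  shows "(L2_norm M (\<lambda>x. f x + a * g x))\<^sup>2 =
     (L2_norm M f)\<^sup>2 + (cmod a)\<^sup>2 * (L2_norm M g)\<^sup>2 + 2 * Re (cnj a * L2_inner M f g)"
proof -
  have i: "integrable M (\<lambda>x. f x * cnj (g x))"
    by (intro L2_mult_integrable L2_cnj assms)
  have f2: "integrable M (\<lambda>x. (cmod (f x))\<^sup>2)" and g2: "integrable M (\<lambda>x. (cmod a)\<^sup>2 * (cmod (g x))\<^sup>2)"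
    and i2: "integrable M (\<lambda>x. 2 * Re (cnj a * (f x * cnj (g x))))"
    by (intro L2_integrable_square integrable_mult_right integrable_Re assms i)+
  have "(L2_norm M (\<lambda>x. f x + a * g x))\<^sup>2 =
     (LINT x|M. (cmod (f x))\<^sup>2 + (cmod a)\<^sup>2 * (cmod (g x))\<^sup>2 + 2 * Re (cnj a * (f x * cnj (g x))))"
    unfolding L2_norm_square
  proof (rule Bochner_Integration.integral_cong[OF refl])
    fix x
    show "(cmod (f x + a * g x))\<^sup>2 = (cmod (f x))\<^sup>2 + (cmod a)\<^sup>2 * (cmod (g x))\<^sup>2 + 2 * Re (cnj a * (f x * cnj (g x)))"
      unfolding cmod_power2 by (simp add: algebra_simps power2_eq_square)
  qed
  also have "\<dots> = (L2_norm M f)\<^sup>2 + (cmod a)\<^sup>2 * (L2_norm M g)\<^sup>2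
      + (LINT x|M. 2 * Re (cnj a * (f x * cnj (g x))))"
    unfolding L2_norm_square Bochner_Integration.integral_add[OF Bochner_Integration.integrable_add[OF f2 g2] i2]
      Bochner_Integration.integral_add[OF f2 g2] by simp
  also have "(LINT x|M. 2 * Re (cnj a * (f x * cnj (g x)))) = 2 * Re (cnj a * L2_inner M f g)"
  proof -
    have "(LINT x|M. Re (cnj a * (f x * cnj (g x)))) = Re (LINT x|M. cnj a * (f x * cnj (g x)))"
      by (intro integral_Re integrable_mult_right i)
    then show ?thesis
      unfolding L2_inner_def integral_mult_right_zero by simp
  qed
  finally show ?thesis .
qed

lemma L2_inner_cong_AE:
  assumes "f \<in> L2 M" "f' \<in> L2 M" "g \<in> L2 M" "g' \<in> L2 M"
    "AE x in M. f x = f' x" "AE x in M. g x = g' x"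
  shows "L2_inner M f g = L2_inner M f' g'"
  unfolding L2_inner_def
proof (rule integral_cong_AE)
  show "(\<lambda>x. f x * cnj (g x)) \<in> borel_measurable M" "(\<lambda>x. f' x * cnj (g' x)) \<in> borel_measurable M"
    by (rule borel_measurable_integrable[OF L2_mult_integrable[OF assms(1) L2_cnj[OF assms(3)]]],
        rule borel_measurable_integrable[OF L2_mult_integrable[OF assms(2) L2_cnj[OF assms(4)]]])
qed (use assms(5,6) in auto)

lemma L2_Cauchy_Schwarz:
  assumes "f \<in> L2 M" "g \<in> L2 M"
  shows "cmod (L2_inner M f g) \<le> L2_norm M f * L2_norm M g"
proof (cases "L2_norm M g = 0")
  case True
  then have "AE x in M. g x = 0" using L2_norm_eq_0 assms by blast
  then have "L2_inner M f g = L2_inner M f (\<lambda>x. 0)"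
    by (intro L2_inner_cong_AE assms L2_zero) auto
  then show ?thesis by (simp add: L2_inner_def)
next
  case False
  let ?G = "(L2_norm M g)\<^sup>2" and ?i = "L2_inner M f g"
  have G: "?G > 0" using False by simp
  \<comment> \<open>the multiple of \<open>g\<close> nearest to \<open>-f\<close>\<close>
  define a where "a = - ?i / complex_of_real ?G"
  have "0 \<le> (L2_norm M (\<lambda>x. f x + a * g x))\<^sup>2" by simp
  also have "\<dots> = (L2_norm M f)\<^sup>2 + (cmod a)\<^sup>2 * ?G + 2 * Re (cnj a * ?i)"
    by (rule L2_norm_add_scale[OF assms])
  also have "cnj a * ?i = - complex_of_real ((cmod ?i)\<^sup>2 / ?G)"
    by (simp add: a_def complex_norm_square[symmetric] mult.commute[of "cnj _"] del: of_real_power)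
  also have "(cmod a)\<^sup>2 = (cmod ?i)\<^sup>2 / ?G\<^sup>2"
    by (simp add: a_def norm_divide power_divide norm_power)
  also have "(cmod ?i)\<^sup>2 / ?G\<^sup>2 * ?G = (cmod ?i)\<^sup>2 / ?G"
    using False by (simp add: power2_eq_square)
  finally have "(cmod ?i)\<^sup>2 / ?G \<le> (L2_norm M f)\<^sup>2"
    by simp
  then have "(cmod ?i)\<^sup>2 \<le> (L2_norm M f * L2_norm M g)\<^sup>2"
    using G by (simp add: field_simps power_mult_distrib)
  then show ?thesis by (rule power2_le_imp_le) simp
qed

lemma L2_norm_triangle:
  assumes "f \<in> L2 M" "g \<in> L2 M"
  shows "L2_norm M (\<lambda>x. f x + g x) \<le> L2_norm M f + L2_norm M g"
proof (rule power2_le_imp_le)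
  have "(L2_norm M (\<lambda>x. f x + 1 * g x))\<^sup>2 = (L2_norm M f)\<^sup>2 + (L2_norm M g)\<^sup>2 + 2 * Re (L2_inner M f g)"
    using L2_norm_add_scale[OF assms, of 1] by simp
  also have "Re (L2_inner M f g) \<le> L2_norm M f * L2_norm M g"
    using L2_Cauchy_Schwarz[OF assms] complex_Re_le_cmod order_trans by blast
  finally show "(L2_norm M (\<lambda>x. f x + g x))\<^sup>2 \<le> (L2_norm M f + L2_norm M g)\<^sup>2"
    by (simp add: power2_sum)
qed simp

lemma L2_norm_minus_commute: "L2_norm M (\<lambda>x. f x - g x) = L2_norm M (\<lambda>x. g x - f x)"
  by (simp add: L2_norm_def norm_minus_commute)

lemma L2_norm_triangle_diff:
  assumes "f \<in> L2 M" "g \<in> L2 M" "h \<in> L2 M"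
  shows "L2_norm M (\<lambda>x. f x - h x) \<le> L2_norm M (\<lambda>x. f x - g x) + L2_norm M (\<lambda>x. g x - h x)"
  using L2_norm_triangle[OF L2_diff[OF assms(1,2)] L2_diff[OF assms(2,3)]] by simp

lemma L2_tendsto_unique:
  assumes "L2_tendsto M u f" "L2_tendsto M u g"
  shows "AE x in M. f x = g x"
proof -
  have f: "f \<in> L2 M" "\<And>n. u n \<in> L2 M" "g \<in> L2 M" using assms by (auto simp: L2_tendsto_def)
  have "(\<lambda>n. L2_norm M (\<lambda>x. u n x - f x) + L2_norm M (\<lambda>x. u n x - g x)) \<longlonglongrightarrow> 0 + 0"
    using assms by (intro tendsto_add) (auto simp: L2_tendsto_def)
  moreover have "L2_norm M (\<lambda>x. f x - g x) \<le> L2_norm M (\<lambda>x. u n x - f x) + L2_norm M (\<lambda>x. u n x - g x)" for n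
    using L2_norm_triangle_diff[of f M "u n" g] f by (simp add: L2_norm_minus_commute)
  ultimately have "L2_norm M (\<lambda>x. f x - g x) \<le> 0 + 0"
    by (intro LIMSEQ_le_const[of _ _ "L2_norm M (\<lambda>x. f x - g x)"]) auto
  then have "L2_norm M (\<lambda>x. f x - g x) = 0"
    by (metis L2_norm_nonneg add.right_neutral order_antisym)
  then show ?thesis using L2_norm_eq_0[OF L2_diff[OF f(1,3)]] by simp
qed

lemma L2_inner_tendsto:
  assumes "L2_tendsto M u f" "g \<in> L2 M"
  shows "(\<lambda>n. L2_inner M (u n) g) \<longlonglongrightarrow> L2_inner M f g"
proof -
  have f: "f \<in> L2 M" "\<And>n. u n \<in> L2 M" using assms by (auto simp: L2_tendsto_def)
  have eq: "L2_inner M (u n) g - L2_inner M f g = L2_inner M (\<lambda>x. u n x - f x) g" for n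
    unfolding L2_inner_def
    by (subst Bochner_Integration.integral_diff[symmetric])
      (auto intro!: L2_mult_integrable L2_cnj assms f simp: algebra_simps)
  have "(\<lambda>n. L2_norm M (\<lambda>x. u n x - f x) * L2_norm M g) \<longlonglongrightarrow> 0 * L2_norm M g"
    using assms by (intro tendsto_mult) (auto simp: L2_tendsto_def)
  then have "(\<lambda>n. L2_norm M (\<lambda>x. u n x - f x) * L2_norm M g) \<longlonglongrightarrow> 0" by simp
  moreover have "\<forall>n. norm (L2_inner M (u n) g - L2_inner M f g) \<le> L2_norm M (\<lambda>x. u n x - f x) * L2_norm M g"
    unfolding eq by (intro allI L2_Cauchy_Schwarz L2_diff f assms)
  ultimately have "(\<lambda>n. L2_inner M (u n) g - L2_inner M f g) \<longlonglongrightarrow> 0"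
    by (rule Lim_null_comparison[OF always_eventually, rotated])
  then show ?thesis by (simp add: LIM_zero_iff)
qed

lemma L2_norm_tendsto:
  assumes "L2_tendsto M u f"
  shows "(\<lambda>n. L2_norm M (u n)) \<longlonglongrightarrow> L2_norm M f"
proof -
  have f: "f \<in> L2 M" "\<And>n. u n \<in> L2 M" using assms by (auto simp: L2_tendsto_def)
  have "norm (L2_norm M (u n) - L2_norm M f) \<le> L2_norm M (\<lambda>x. u n x - f x)" for n
  proof -
    have "L2_norm M (u n) \<le> L2_norm M (\<lambda>x. u n x - f x) + L2_norm M f"
      using L2_norm_triangle[OF L2_diff[OF f(2)[of n] f(1)] f(1)] by simp
    moreover have "L2_norm M f \<le> L2_norm M (\<lambda>x. f x - u n x) + L2_norm M (u n)"
      using L2_norm_triangle[OF L2_diff[OF f(1) f(2)[of n]] f(2)[of n]] by simp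
    ultimately show ?thesis
      using L2_norm_minus_commute[of M f "u n"] by auto
  qed
  then have "(\<lambda>n. L2_norm M (u n) - L2_norm M f) \<longlonglongrightarrow> 0"
    using assms unfolding L2_tendsto_def
    by (blast intro: Lim_null_comparison[OF always_eventually, of _ "\<lambda>n. L2_norm M (\<lambda>x. u n x - f x)"])
  then show ?thesis by (simp add: LIM_zero_iff)
qed

lemma nn_integral_L2_norm:
  assumes "f \<in> L2 M"
  shows "(\<integral>\<^sup>+x. ennreal ((cmod (f x))\<^sup>2) \<partial>M) = ennreal ((L2_norm M f)\<^sup>2)"
  unfolding L2_norm_square
  by (rule nn_integral_eq_integral[OF L2_integrable_square[OF assms]]) simp

lemma L2I_nn_integral:
  assumes "f \<in> borel_measurable M" "(\<integral>\<^sup>+x. ennreal ((cmod (f x))\<^sup>2) \<partial>M) < \<infinity>"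
  shows "f \<in> L2 M"
  by (rule L2I) (use assms in \<open>auto intro!: integrableI_nonneg\<close>)

text \<open>
  Along a subsequence with steps of norm at most \<open>4^-k\<close> the weighted series
  \<open>\<Sum>k. 2^k |d k|\<^sup>2\<close> of the steps is integrable, hence finite almost everywhere, and the
  arithmetic-geometric mean inequality then makes the steps themselves summable.  So the
  subsequence converges pointwise, and Fatou's lemma turns this into convergence in norm of
  the whole sequence.
\<close>

lemma Riesz_Fischer:
  assumes u: "\<And>n. u n \<in> L2 M"
    and Cauchy: "\<And>\<epsilon>. \<epsilon> > 0 \<Longrightarrow> \<exists>N. \<forall>n\<ge>N. \<forall>m\<ge>N. L2_norm M (\<lambda>x. u n x - u m x) < \<epsilon>"
  shows "\<exists>h. L2_tendsto M u h"
proof -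
  have [measurable]: "u n \<in> borel_measurable M" for n
    using u by (rule L2_measurable)
  obtain N where N: "\<And>k n m. n \<ge> N k \<Longrightarrow> m \<ge> N k \<Longrightarrow> L2_norm M (\<lambda>x. u n x - u m x) < (1/4)^k"
    using Cauchy[of "(1/4)^k" for k] by (metis zero_less_power zero_less_divide_1_iff zero_less_numeral)
  define r where "r k = (\<Sum>j\<le>k. N j)" for k
  have rN: "r k \<ge> N k" for k
    unfolding r_def by (rule member_le_sum) auto
  have r_mono: "r k \<le> r (Suc k)" for k
    by (simp add: r_def)
  have r_le: "N k \<le> r j" if "k \<le> j" for k j
    unfolding r_def by (rule member_le_sum) (use that in auto)
  define d where "d k x = u (r (Suc k)) x - u (r k) x" for k x
  have [measurable]: "d k \<in> borel_measurable M" for k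
    unfolding d_def by measurable
  have d: "d k \<in> L2 M" "L2_norm M (d k) \<le> (1/4)^k" for k
  proof -
    show "d k \<in> L2 M" unfolding d_def by (intro L2_diff u)
    show "L2_norm M (d k) \<le> (1/4)^k"
      unfolding d_def using N[of k "r (Suc k)" "r k"] rN[of k] r_mono[of k] by simp
  qed
  have "(\<integral>\<^sup>+x. (\<Sum>k. ennreal (2^k * (cmod (d k x))\<^sup>2)) \<partial>M)
      = (\<Sum>k. \<integral>\<^sup>+x. ennreal (2^k * (cmod (d k x))\<^sup>2) \<partial>M)"
    by (rule nn_integral_suminf) measurable
  also have "\<dots> \<le> (\<Sum>k. ennreal ((1/2)^k))"
  proof (intro suminf_le)
    fix k
    have "(\<integral>\<^sup>+x. ennreal (2^k * (cmod (d k x))\<^sup>2) \<partial>M) = ennreal (2^k) * ennreal ((L2_norm M (d k))\<^sup>2)"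
      by (simp add: ennreal_mult nn_integral_cmult nn_integral_L2_norm[OF d(1)])
    also have "\<dots> \<le> ennreal (2^k) * ennreal (((1/4)^k)\<^sup>2)"
      using d(2)[of k] by (intro mult_left_mono ennreal_leI power_mono) auto
    also have "\<dots> = ennreal ((2 * (1/16))^k)"
      by (simp add: ennreal_mult[symmetric] power_mult[symmetric] power_mult_distrib[symmetric]
        mult.commute[of k 2] power_mult[of _ 2] power2_eq_square)
    also have "\<dots> \<le> ennreal ((1/2)^k)"
      by (intro ennreal_leI power_mono) auto
    finally show "(\<integral>\<^sup>+x. ennreal (2^k * (cmod (d k x))\<^sup>2) \<partial>M) \<le> ennreal ((1/2)^k)" .
  qed auto
  also have "\<dots> = ennreal (\<Sum>k. (1/2)^k)"
    by (intro suminf_ennreal2 summable_geometric) auto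
  finally have "(\<integral>\<^sup>+x. (\<Sum>k. ennreal (2^k * (cmod (d k x))\<^sup>2)) \<partial>M) \<noteq> \<infinity>"
    by (metis ennreal_neq_top infinity_ennreal_def neq_top_trans)
  then have "AE x in M. (\<Sum>k. ennreal (2^k * (cmod (d k x))\<^sup>2)) \<noteq> \<infinity>"
    by (intro nn_integral_PInf_AE) measurable
  then have conv: "AE x in M. convergent (\<lambda>k. u (r k) x)"
  proof eventually_elim
    case (elim x)
    then have "summable (\<lambda>k. 2^k * (cmod (d k x))\<^sup>2)"
      by (intro summable_suminf_not_top) (simp_all add: infinity_ennreal_def)
    then have "summable (\<lambda>k. 2^k * (cmod (d k x))\<^sup>2 + (1/2)^k)"
      by (intro summable_add summable_geometric) auto
    then have "summable (\<lambda>k. d k x)"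
    proof (rule summable_comparison_test'[where N=0])
      fix k :: nat
      have "0 \<le> (2^k * cmod (d k x) - 1)\<^sup>2 / 2^k" by simp
      also have "\<dots> = 2^k * (cmod (d k x))\<^sup>2 + (1/2)^k - 2 * cmod (d k x)"
        by (simp add: power2_eq_square field_simps)
      finally show "norm (d k x) \<le> 2^k * (cmod (d k x))\<^sup>2 + (1/2)^k"
        using norm_ge_zero[of "d k x"] by linarith
    qed
    then have "convergent (\<lambda>n. (\<Sum>k<n. d k x) + u (r 0) x)"
      by (intro convergent_add) (auto simp: summable_iff_convergent convergent_const)
    moreover have "(\<Sum>k<n. d k x) + u (r 0) x = u (r n) x" for n
      by (induction n) (auto simp: d_def algebra_simps)
    ultimately show ?case by (simp only:)
  qed
  define h where "h x = lim (\<lambda>k. u (r k) x)" for x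
  have [measurable]: "h \<in> borel_measurable M"
    unfolding h_def by measurable
  have lim: "AE x in M. (\<lambda>k. u (r k) x) \<longlonglongrightarrow> h x"
    using conv by eventually_elim (simp add: h_def convergent_LIMSEQ_iff)
  have bound: "(\<integral>\<^sup>+x. ennreal ((cmod (u n x - h x))\<^sup>2) \<partial>M) \<le> ennreal (((1/4)^k)\<^sup>2)" if "n \<ge> N k" for n k
  proof -
    have "(\<integral>\<^sup>+x. ennreal ((cmod (u n x - h x))\<^sup>2) \<partial>M)
        = (\<integral>\<^sup>+x. liminf (\<lambda>j. ennreal ((cmod (u n x - u (r j) x))\<^sup>2)) \<partial>M)"
    proof (rule nn_integral_cong_AE, use lim in eventually_elim)
      case (elim x)
      have "(\<lambda>j. ennreal ((cmod (u n x - u (r j) x))\<^sup>2)) \<longlonglongrightarrow> ennreal ((cmod (u n x - h x))\<^sup>2)"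
        by (intro tendsto_intros elim)
      then show ?case by (rule lim_imp_Liminf[OF sequentially_bot, symmetric])
    qed
    also have "\<dots> \<le> liminf (\<lambda>j. \<integral>\<^sup>+x. ennreal ((cmod (u n x - u (r j) x))\<^sup>2) \<partial>M)"
      by (rule nn_integral_liminf) measurable
    also have "\<dots> \<le> ennreal (((1/4)^k)\<^sup>2)"
    proof (rule Liminf_le)
      show "\<forall>\<^sub>F j in sequentially. (\<integral>\<^sup>+x. ennreal ((cmod (u n x - u (r j) x))\<^sup>2) \<partial>M) \<le> ennreal (((1/4)^k)\<^sup>2)"
        using eventually_ge_at_top[of k]
      proof eventually_elim
        case (elim j)
        have "L2_norm M (\<lambda>x. u n x - u (r j) x) < (1/4)^k"
          using N that r_le[OF elim] by blast
        then show ?case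
          by (subst nn_integral_L2_norm) (auto intro!: L2_diff u ennreal_leI power_mono)
      qed
    qed simp
    finally show ?thesis .
  qed
  have diff: "(\<lambda>x. u n x - h x) \<in> L2 M" if "n \<ge> N k" for n k
    by (rule L2I_nn_integral) (use bound[OF that] in \<open>auto intro: le_less_trans\<close>)
  have h: "h \<in> L2 M"
    using L2_diff[OF u[of "N 0"] diff[of 0 "N 0"]] by simp
  have "(\<lambda>n. L2_norm M (\<lambda>x. u n x - h x)) \<longlonglongrightarrow> 0"
  proof (rule LIMSEQ_I)
    fix e :: real assume "e > 0"
    then obtain k where k: "(1/4)^k < e"
      using real_arch_pow_inv[of e "1/4"] by auto
    show "\<exists>no. \<forall>n\<ge>no. norm (L2_norm M (\<lambda>x. u n x - h x) - 0) < e"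
    proof (intro exI allI impI)
      fix n assume n: "N k \<le> n"
      have "ennreal ((L2_norm M (\<lambda>x. u n x - h x))\<^sup>2) \<le> ennreal (((1/4)^k)\<^sup>2)"
        using bound[OF n] nn_integral_L2_norm[OF diff[OF n]] by simp
      then have "(L2_norm M (\<lambda>x. u n x - h x))\<^sup>2 \<le> ((1/4)^k)\<^sup>2" by simp
      then have "L2_norm M (\<lambda>x. u n x - h x) \<le> (1/4)^k" by (rule power2_le_imp_le) simp
      then show "norm (L2_norm M (\<lambda>x. u n x - h x) - 0) < e" using k by simp
    qed
  qed
  then show ?thesis using u h by (auto simp: L2_tendsto_def)
qed

section \<open>Orthonormal bases\<close>

text \<open>
  The functions \<open>e n\<close> are real valued, so that coefficients and the series of products of
  coefficients need no complex conjugation.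
\<close>

locale orthonormal_system =
  fixes M :: "'a measure" and e :: "nat \<Rightarrow> 'a \<Rightarrow> real"
  assumes e_L2: "\<And>n. (\<lambda>x. complex_of_real (e n x)) \<in> L2 M"
    and orthonormal: "\<And>m n. (LINT x|M. e m x * e n x) = (if m = n then 1 else 0)"
begin

definition coeff :: "('a \<Rightarrow> complex) \<Rightarrow> nat \<Rightarrow> complex"
  where "coeff h n = (LINT x|M. h x * complex_of_real (e n x))"

definition partial :: "(nat \<Rightarrow> complex) \<Rightarrow> nat \<Rightarrow> 'a \<Rightarrow> complex"
  where "partial c N x = (\<Sum>n<N. c n * complex_of_real (e n x))"

lemma coeff_eq_inner: "coeff h n = L2_inner M h (\<lambda>x. complex_of_real (e n x))"
  by (simp add: coeff_def L2_inner_def)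

lemma inner_basis:
  "L2_inner M (\<lambda>x. complex_of_real (e m x)) (\<lambda>x. complex_of_real (e n x)) = (if m = n then 1 else 0)"
proof -
  have "L2_inner M (\<lambda>x. complex_of_real (e m x)) (\<lambda>x. complex_of_real (e n x))
      = (LINT x|M. complex_of_real (e m x * e n x))"
    by (simp add: L2_inner_def)
  also have "\<dots> = complex_of_real (LINT x|M. e m x * e n x)"
    by (rule integral_complex_of_real)
  finally show ?thesis by (simp add: orthonormal)
qed

lemma norm_basis: "L2_norm M (\<lambda>x. complex_of_real (e n x)) = 1"
  using orthonormal[of n n] by (simp add: L2_norm_def power2_eq_square)

lemma partial_L2: "partial c N \<in> L2 M"
  unfolding partial_def[abs_def] by (intro L2_sum L2_scale e_L2)

lemma partial_Suc: "partial c (Suc N) x = partial c N x + c N * complex_of_real (e N x)"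
  by (simp add: partial_def)

lemma coeff_add_scale:
  assumes "f \<in> L2 M" "g \<in> L2 M"
  shows "coeff (\<lambda>x. f x + a * g x) n = coeff f n + a * coeff g n"
proof -
  have "integrable M (\<lambda>x. f x * complex_of_real (e n x))" "integrable M (\<lambda>x. g x * complex_of_real (e n x))"
    by (intro L2_mult_integrable assms e_L2)+
  then have "(LINT x|M. f x * complex_of_real (e n x) + a * (g x * complex_of_real (e n x)))
      = coeff f n + a * coeff g n"
    unfolding coeff_def by (subst Bochner_Integration.integral_add) auto
  then show ?thesis unfolding coeff_def by (simp add: algebra_simps)
qed

lemma coeff_basis: "coeff (\<lambda>x. complex_of_real (e m x)) n = (if m = n then 1 else 0)"
  by (simp add: coeff_eq_inner inner_basis)

lemma coeff_partial: "coeff (partial c N) n = (if n < N then c n else 0)"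
proof (induction N)
  case 0
  then show ?case by (simp add: coeff_def partial_def)
next
  case (Suc N)
  have "coeff (partial c (Suc N)) n = coeff (partial c N) n + c N * (if N = n then 1 else 0)"
    unfolding partial_Suc[abs_def] by (subst coeff_add_scale) (auto intro!: partial_L2 e_L2 simp: coeff_basis)
  then show ?case using Suc by (auto simp: less_Suc_eq)
qed

lemma coeff_cong_AE:
  assumes "f \<in> L2 M" "g \<in> L2 M" "AE x in M. f x = g x"
  shows "coeff f n = coeff g n"
  unfolding coeff_eq_inner by (intro L2_inner_cong_AE assms e_L2) auto

lemma coeff_tendsto:
  assumes "L2_tendsto M u f"
  shows "(\<lambda>N. coeff (u N) n) \<longlonglongrightarrow> coeff f n"
  unfolding coeff_eq_inner by (intro L2_inner_tendsto assms e_L2)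

lemma norm_add_basis:
  assumes "f \<in> L2 M"
  shows "(L2_norm M (\<lambda>x. f x + a * complex_of_real (e n x)))\<^sup>2
     = (L2_norm M f)\<^sup>2 + (cmod a)\<^sup>2 + 2 * Re (cnj a * coeff f n)"
  using L2_norm_add_scale[OF assms e_L2, of a n] by (simp add: norm_basis coeff_eq_inner)

lemma norm_residual:
  assumes "f \<in> L2 M"
  shows "(L2_norm M (\<lambda>x. f x - partial (coeff f) N x))\<^sup>2 = (L2_norm M f)\<^sup>2 - (\<Sum>n<N. (cmod (coeff f n))\<^sup>2)"
proof (induction N)
  case 0
  then show ?case by (simp add: partial_def)
next
  case (Suc N)
  let ?c = "coeff f N" and ?g = "\<lambda>x. f x - partial (coeff f) N x"
  have "coeff ?g N = coeff f N + (-1) * coeff (partial (coeff f) N) N"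
    using coeff_add_scale[OF assms partial_L2, of "-1" "coeff f" N N] by simp
  then have c: "coeff ?g N = ?c" by (simp add: coeff_partial)
  have "(\<lambda>x. f x - partial (coeff f) (Suc N) x) = (\<lambda>x. ?g x + (- ?c) * complex_of_real (e N x))"
    by (simp add: partial_Suc fun_eq_iff)
  then have "(L2_norm M (\<lambda>x. f x - partial (coeff f) (Suc N) x))\<^sup>2
      = (L2_norm M ?g)\<^sup>2 + (cmod ?c)\<^sup>2 + 2 * Re (cnj (- ?c) * ?c)"
    using norm_add_basis[of ?g "- ?c" N] c by (simp add: L2_diff assms partial_L2)
  also have "cnj (- ?c) * ?c = - complex_of_real ((cmod ?c)\<^sup>2)"
    by (simp add: complex_norm_square[symmetric] mult.commute[of "cnj _"] del: of_real_power)
  finally show ?case using Suc by simp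
qed

lemma norm_partial_diff:
  assumes "K \<le> N"
  shows "(L2_norm M (\<lambda>x. partial c N x - partial c K x))\<^sup>2 = (\<Sum>n=K..<N. (cmod (c n))\<^sup>2)"
  using assms
proof (induction N rule: dec_induct)
  case base
  show ?case by (simp add: L2_norm_def)
next
  case (step N)
  let ?g = "\<lambda>x. partial c N x - partial c K x"
  have "coeff ?g N = coeff (partial c N) N + (-1) * coeff (partial c K) N"
    using coeff_add_scale[OF partial_L2 partial_L2, of c N "-1" c K N] by simp
  then have 0: "coeff ?g N = 0" using step by (simp add: coeff_partial)
  have "(\<lambda>x. partial c (Suc N) x - partial c K x) = (\<lambda>x. ?g x + c N * complex_of_real (e N x))"
    by (simp add: partial_Suc fun_eq_iff)
  then show ?case
    using norm_add_basis[of ?g "c N" N] 0 step by (simp add: L2_diff partial_L2)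
qed

lemma norm_partial: "(L2_norm M (partial c N))\<^sup>2 = (\<Sum>n<N. (cmod (c n))\<^sup>2)"
  using norm_partial_diff[of 0 N c] by (simp add: partial_def[of _ 0] atLeast0LessThan)

lemma summable_coeff:
  assumes "f \<in> L2 M"
  shows "summable (\<lambda>n. (cmod (coeff f n))\<^sup>2)"
proof (rule bounded_imp_summable)
  fix N
  have "0 \<le> (L2_norm M (\<lambda>x. f x - partial (coeff f) (Suc N) x))\<^sup>2" by simp
  then show "(\<Sum>k\<le>N. (cmod (coeff f k))\<^sup>2) \<le> (L2_norm M f)\<^sup>2"
    unfolding norm_residual[OF assms] by (simp add: lessThan_Suc_atMost)
qed simp

text \<open>
  Equality in Bessel's inequality for a single function makes its own expansion converge,
  which puts the function into the closed span of the system.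
\<close>

lemma L2_tendsto_partial_coeff:
  assumes "f \<in> L2 M" "(\<lambda>n. (cmod (coeff f n))\<^sup>2) sums (L2_norm M f)\<^sup>2"
  shows "L2_tendsto M (partial (coeff f)) f"
proof -
  have "(\<lambda>N. (L2_norm M f)\<^sup>2 - (\<Sum>n<N. (cmod (coeff f n))\<^sup>2)) \<longlonglongrightarrow> (L2_norm M f)\<^sup>2 - (L2_norm M f)\<^sup>2"
    using assms(2) by (intro tendsto_intros) (simp add: sums_def)
  then have "(\<lambda>N. (L2_norm M (\<lambda>x. f x - partial (coeff f) N x))\<^sup>2) \<longlonglongrightarrow> 0"
    by (simp add: norm_residual[OF assms(1)])
  then have "(\<lambda>N. sqrt ((L2_norm M (\<lambda>x. f x - partial (coeff f) N x))\<^sup>2)) \<longlonglongrightarrow> sqrt 0"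
    by (rule tendsto_real_sqrt)
  then show ?thesis
    using assms(1) by (simp add: L2_tendsto_def partial_L2 L2_norm_minus_commute[of _ f])
qed

text \<open>
  The blocks of the series have square norm \<open>\<Sum>n=K..<N. |c n|\<^sup>2\<close>, so the partial sums form a
  Cauchy sequence.
\<close>

lemma ex_L2_series:
  assumes "summable (\<lambda>n. (cmod (c n))\<^sup>2)"
  shows "\<exists>h. L2_tendsto M (partial c) h"
proof (rule Riesz_Fischer[OF partial_L2])
  fix \<epsilon> :: real assume "\<epsilon> > 0"
  then have "\<epsilon>\<^sup>2 > 0" by simp
  then obtain N where N: "\<And>m n. m \<ge> N \<Longrightarrow> norm (\<Sum>k=m..<n. (cmod (c k))\<^sup>2) < \<epsilon>\<^sup>2"
    using assms unfolding summable_Cauchy by meson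
  have le: "L2_norm M (\<lambda>x. partial c n x - partial c m x) < \<epsilon>" if "m \<ge> N" "m \<le> n" for m n
  proof -
    have "(L2_norm M (\<lambda>x. partial c n x - partial c m x))\<^sup>2 < \<epsilon>\<^sup>2"
      using N[OF that(1), of n] norm_partial_diff[OF that(2), of c] by simp
    then show ?thesis using \<open>\<epsilon> > 0\<close> by (simp add: power_less_imp_less_base)
  qed
  show "\<exists>N. \<forall>n\<ge>N. \<forall>m\<ge>N. L2_norm M (\<lambda>x. partial c n x - partial c m x) < \<epsilon>"
  proof (intro exI allI impI)
    fix n m assume "N \<le> n" "N \<le> m"
    then show "L2_norm M (\<lambda>x. partial c n x - partial c m x) < \<epsilon>"
      using le[of m n] le[of n m] L2_norm_minus_commute[of M "partial c n"] by (metis nle_le)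
  qed
qed

lemma coeff_L2_series:
  assumes "L2_tendsto M (partial c) h"
  shows "coeff h n = c n"
proof -
  have "(\<lambda>N. coeff (partial c N) n) \<longlonglongrightarrow> coeff h n"
    by (rule coeff_tendsto[OF assms])
  moreover have "(\<lambda>N. coeff (partial c N) n) \<longlonglongrightarrow> c n"
    by (rule tendsto_eventually) (use eventually_gt_at_top[of n] in eventually_elim, simp add: coeff_partial)
  ultimately show ?thesis using LIMSEQ_unique by blast
qed

lemma norm_L2_series:
  assumes "L2_tendsto M (partial c) h"
  shows "(\<lambda>n. (cmod (c n))\<^sup>2) sums (L2_norm M h)\<^sup>2"
proof -
  have "(\<lambda>N. (L2_norm M (partial c N))\<^sup>2) \<longlonglongrightarrow> (L2_norm M h)\<^sup>2"
    by (intro tendsto_power L2_norm_tendsto assms)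
  then show ?thesis by (simp add: sums_def norm_partial)
qed

text \<open>
  Continuity of the inner product, applied to the partial sums.
\<close>

lemma inner_L2_series:
  assumes "L2_tendsto M (partial c) h" "g \<in> L2 M"
  shows "(\<lambda>n. c n * coeff g n) sums (LINT x|M. h x * g x)"
proof -
  have g: "(\<lambda>x. cnj (g x)) \<in> L2 M" by (rule L2_cnj[OF assms(2)])
  have "L2_inner M (partial c N) (\<lambda>x. cnj (g x)) = (\<Sum>n<N. c n * coeff g n)" for N
  proof -
    have "L2_inner M (partial c N) (\<lambda>x. cnj (g x)) = (LINT x|M. (\<Sum>n<N. c n * (g x * complex_of_real (e n x))))"
      by (simp add: L2_inner_def partial_def sum_distrib_left sum_distrib_right mult_ac)
    also have "\<dots> = (\<Sum>n<N. LINT x|M. c n * (g x * complex_of_real (e n x)))"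
      by (intro Bochner_Integration.integral_sum integrable_mult_right L2_mult_integrable assms e_L2)
    finally show ?thesis by (simp add: coeff_def)
  qed
  moreover have "(\<lambda>N. L2_inner M (partial c N) (\<lambda>x. cnj (g x))) \<longlonglongrightarrow> L2_inner M h (\<lambda>x. cnj (g x))"
    by (rule L2_inner_tendsto[OF assms(1) g])
  ultimately show ?thesis by (simp add: sums_def L2_inner_def)
qed

end

locale orthonormal_basis = orthonormal_system +
  assumes complete: "\<And>h. h \<in> L2 M \<Longrightarrow> (\<And>n. coeff h n = 0) \<Longrightarrow> AE x in M. h x = 0"
begin

lemma eq_AE_if_coeff_eq:
  assumes "f \<in> L2 M" "g \<in> L2 M" "\<And>n. coeff f n = coeff g n"
  shows "AE x in M. f x = g x"
proof -
  have "AE x in M. f x + (-1) * g x = 0"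
    by (intro complete) (auto simp: coeff_add_scale[OF assms(1,2), of "-1", simplified] assms intro!: L2_diff)
  then show ?thesis by simp
qed

text \<open>
  The series with the coefficients of \<open>f\<close> has some limit by the Riesz-Fischer theorem;
  completeness identifies it with \<open>f\<close>.
\<close>

lemma expansion:
  assumes "f \<in> L2 M"
  shows "L2_tendsto M (partial (coeff f)) f"
proof -
  obtain h where h: "L2_tendsto M (partial (coeff f)) h"
    using ex_L2_series summable_coeff[OF assms] by blast
  then have "h \<in> L2 M" by (simp add: L2_tendsto_def)
  then have "AE x in M. h x = f x"
    by (intro eq_AE_if_coeff_eq assms coeff_L2_series[OF h])
  then have "L2_norm M (\<lambda>x. partial (coeff f) N x - h x) = L2_norm M (\<lambda>x. partial (coeff f) N x - f x)" for N
    using \<open>h \<in> L2 M\<close> assms partial_L2[of "coeff f" N]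
    by (intro L2_norm_cong_AE) (auto intro!: L2_measurable L2_diff)
  then show ?thesis using h assms by (simp add: L2_tendsto_def)
qed

lemma Parseval:
  assumes "f \<in> L2 M"
  shows "(\<lambda>n. (cmod (coeff f n))\<^sup>2) sums (L2_norm M f)\<^sup>2"
  by (rule norm_L2_series[OF expansion[OF assms]])

end

section \<open>Integration on the half-line\<close>

lemma half_line_set_integrable:
  fixes f :: "real \<Rightarrow> 'b::{banach, second_countable_topology}"
  shows "integrable half_line f \<longleftrightarrow> set_integrable lebesgue {0<..} f"
  unfolding set_integrable_def by (rule integrable_restrict_space) simp

lemma half_line_set_integral:
  fixes f :: "real \<Rightarrow> 'b::{banach, second_countable_topology}"
  shows "(LINT x|half_line. f x) = (LINT x:{0<..}|lebesgue. f x)"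
  unfolding set_lebesgue_integral_def by (rule integral_restrict_space) simp

lemma AE_half_line_iff: "(AE x in half_line. P x) \<longleftrightarrow> (AE x in lebesgue. 0 < x \<longrightarrow> P x)"
  by (subst AE_restrict_space_iff) auto

lemma borel_measurable_half_line: "f \<in> borel_measurable borel \<Longrightarrow> f \<in> borel_measurable half_line"
  by (intro measurable_restrict_space1 measurable_completion) simp

lemma Gamma_integral_half_line:
  assumes "a > 0"
  shows "(\<lambda>t::real. t powr (a - 1) / exp t) absolutely_integrable_on {0<..}"
    "integral {0<..} (\<lambda>t::real. t powr (a - 1) / exp t) = Gamma a"
proof -
  have "{t \<in> {0..} - {0<..}. t powr (a - 1) / exp t \<noteq> 0} = {}"
    "{t \<in> {0<..} - {0..}. t powr (a - 1) / exp t \<noteq> 0} = {}"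
    by auto
  then have *: "((\<lambda>t. t powr (a - 1) / exp t) has_integral Gamma a) {0<..}"
    using Gamma_integral_real[OF assms]
    by (subst has_integral_spike_set_eq[where T = "{0..}"]) (simp_all only: negligible_empty)
  then show "integral {0<..} (\<lambda>t::real. t powr (a - 1) / exp t) = Gamma a"
    by (rule integral_unique)
  show "(\<lambda>t::real. t powr (a - 1) / exp t) absolutely_integrable_on {0<..}"
    using * by (subst absolutely_integrable_on_iff_nonneg) (auto simp: integrable_on_def)
qed

text \<open>
  The substitution \<open>t = p r\<^sup>2\<close> in Euler's integral for the Gamma function.
\<close>

lemma gaussian_moment:
  assumes a: "a > 0" and p: "p > 0"
  shows "has_bochner_integral half_line (\<lambda>r. r powr (2 * a - 1) * exp (- p * r\<^sup>2)) (Gamma a / (2 * p powr a))"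
proof -
  define f :: "real \<Rightarrow> real" where "f t = t powr (a - 1) / exp t" for t
  define g where "g r = p * r\<^sup>2" for r
  have deriv: "(g has_field_derivative 2 * p * r) (at r within {0<..})" for r
    unfolding g_def by (auto intro!: derivative_eq_intros)
  have inj: "inj_on g {0<..}"
    using p by (auto simp: inj_on_def g_def power2_eq_iff)
  have img: "g ` {0<..} = {0<..}"
  proof (intro equalityI subsetI)
    fix y :: real assume "y \<in> {0<..}"
    then have "y = g (sqrt (y / p))" "sqrt (y / p) \<in> {0<..}" using p by (auto simp: g_def)
    then show "y \<in> g ` {0<..}" by blast
  qed (use p in \<open>auto simp: g_def\<close>)
  have sub: "\<bar>2 * p * r\<bar> *\<^sub>R f (g r) = (2 * p powr a) * (r powr (2 * a - 1) * exp (- p * r\<^sup>2))"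
    if "r > 0" for r
  proof -
    have "r powr (2 * a - 1) = r * (r powr 2) powr (a - 1)"
    proof -
      have "r powr (2 * a - 1) = r powr (1 + 2 * (a - 1))" by simp
      also have "\<dots> = r powr 1 * r powr (2 * (a - 1))" by (rule powr_add)
      finally show ?thesis using that by (simp only: powr_powr powr_one)
    qed
    moreover have "p powr a = p * p powr (a - 1)"
      using p by (simp add: powr_mult_base)
    ultimately show ?thesis
      using p that unfolding f_def g_def
      by (simp add: powr_mult powr_numeral exp_minus field_simps)
  qed
  have "f absolutely_integrable_on g ` {0<..} \<and> integral (g ` {0<..}) f = Gamma a"
    unfolding img using Gamma_integral_half_line[OF a] by (simp add: f_def[abs_def])
  then have "(\<lambda>r. \<bar>2 * p * r\<bar> *\<^sub>R f (g r)) absolutely_integrable_on {0<..} \<and>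
      integral {0<..} (\<lambda>r. \<bar>2 * p * r\<bar> *\<^sub>R f (g r)) = Gamma a"
    by (subst has_absolute_integral_change_of_variables_real) (auto intro: inj deriv)
  then have I: "integrable half_line (\<lambda>r. \<bar>2 * p * r\<bar> *\<^sub>R f (g r))"
    and "(LINT r|half_line. \<bar>2 * p * r\<bar> *\<^sub>R f (g r)) = Gamma a"
    by (auto simp: half_line_set_integrable half_line_set_integral set_lebesgue_integral_eq_integral)
  then have "has_bochner_integral half_line (\<lambda>r. \<bar>2 * p * r\<bar> *\<^sub>R f (g r)) (Gamma a)"
    by (simp add: has_bochner_integral_iff)
  then have "has_bochner_integral half_line (\<lambda>r. (2 * p powr a) * (r powr (2 * a - 1) * exp (- p * r\<^sup>2))) (Gamma a)"
    by (rule has_bochner_integral_cong[THEN iffD1, rotated -1]) (use sub in auto)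
  then have "has_bochner_integral half_line (\<lambda>r. inverse (2 * p powr a) * ((2 * p powr a) * (r powr (2 * a - 1) * exp (- p * r\<^sup>2))))
      (inverse (2 * p powr a) * Gamma a)"
    by (rule has_bochner_integral_mult_right)
  then show ?thesis
    using p by (simp add: field_simps)
qed

text \<open>The averages whose limit is \<open>point_value\<close>.\<close>

definition average :: "(real \<Rightarrow> complex) \<Rightarrow> real \<Rightarrow> nat \<Rightarrow> complex"
  where "average h x k = real (Suc k) *\<^sub>R (LINT y:{x..x + 1 / real (Suc k)}|lebesgue. h y)"

lemma point_value_eq: "point_value h x = lim (average h x)"
  by (simp add: point_value_def average_def[abs_def])

lemma set_integral_cong_half_line:
  fixes h h' :: "real \<Rightarrow> 'b::{banach, second_countable_topology}"
  assumes "h \<in> borel_measurable half_line" "h' \<in> borel_measurable half_line" "AE x in half_line. h x = h' x" "x > 0"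
  shows "(LINT y:{x..z}|lebesgue. h y) = (LINT y:{x..z}|lebesgue. h' y)"
proof -
  have *: "(\<lambda>y. indicator {x..z} y *\<^sub>R g y) \<in> borel_measurable lebesgue"
    if "g \<in> borel_measurable half_line" for g :: "real \<Rightarrow> 'b"
  proof -
    have "(\<lambda>y. indicator {x..z} y *\<^sub>R (indicator {0<..} y *\<^sub>R g y)) \<in> borel_measurable lebesgue"
      using that
      by (intro borel_measurable_scaleR[where g = "\<lambda>y. indicator {0<..} y *\<^sub>R g y"] borel_measurable_indicator)
        (auto simp: borel_measurable_restrict_space_iff)
    also have "(\<lambda>y. indicator {x..z} y *\<^sub>R (indicator {0<..} y *\<^sub>R g y)) = (\<lambda>y. indicator {x..z} y *\<^sub>R g y)"
      using assms(4) by (auto simp: indicator_def fun_eq_iff)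
    finally show ?thesis .
  qed
  show ?thesis
    unfolding set_lebesgue_integral_def
    by (rule integral_cong_AE[OF *[OF assms(1)] *[OF assms(2)]])
      (use assms(3,4) in \<open>auto simp: AE_half_line_iff indicator_def elim!: eventually_mono\<close>)
qed

lemma average_cong_AE:
  assumes "h \<in> borel_measurable half_line" "h' \<in> borel_measurable half_line" "AE x in half_line. h x = h' x" "x > 0"
  shows "average h x = average h' x"
  unfolding average_def[abs_def] using set_integral_cong_half_line[OF assms] by simp

lemma point_value_cong_AE:
  assumes "h \<in> borel_measurable half_line" "h' \<in> borel_measurable half_line" "AE x in half_line. h x = h' x" "x > 0"
  shows "point_value h x = point_value h' x"
  unfolding point_value_eq average_cong_AE[OF assms] ..

text \<open>
  Extended by zero to the negative half-line, \<open>h\<close> is integrable on all compact intervals, and the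
  differentiation theorem for the one-sided intervals \<open>[x, x + d]\<close> applies.
\<close>

lemma Lebesgue_differentiation:
  fixes h :: "real \<Rightarrow> complex"
  assumes loc: "\<And>b. set_integrable lebesgue {0<..b} h"
  shows "AE x in half_line. average h x \<longlonglongrightarrow> h x"
proof -
  define f where "f x = indicator {0<..} x *\<^sub>R h x" for x
  have int: "set_integrable lebesgue {a..b} f" for a b
  proof -
    have "set_integrable lebesgue ({0<..b} \<inter> {a..b}) h"
      by (rule set_integrable_subset[OF loc]) auto
    moreover have "(\<lambda>x. indicator ({0<..b} \<inter> {a..b}) x *\<^sub>R h x) = (\<lambda>x. indicator {a..b} x *\<^sub>R f x)"
      by (auto simp: f_def indicator_def fun_eq_iff)
    ultimately show ?thesis by (simp add: set_integrable_def)
  qed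
  have "f integrable_on cbox a b" for a b
    using set_lebesgue_integral_eq_integral(1)[OF int] by simp
  then obtain N where N: "negligible N"
    "\<And>x e. \<lbrakk>x \<notin> N; 0 < e\<rbrakk> \<Longrightarrow> \<exists>d>0. \<forall>h. 0 < h \<and> h < d \<longrightarrow>
       norm(integral (cbox x (x + h *\<^sub>R One)) f /\<^sub>R h ^ DIM(real) - f x) < e"
    using integrable_ccontinuous_explicit by blast
  have "average h x \<longlonglongrightarrow> h x" if x: "x \<notin> N" "x > 0" for x
  proof (rule LIMSEQ_I)
    fix e :: real assume "e > 0"
    obtain d where d: "d > 0"
      "\<And>h. 0 < h \<Longrightarrow> h < d \<Longrightarrow> norm (integral (cbox x (x + h *\<^sub>R One)) f /\<^sub>R h ^ DIM(real) - f x) < e"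
      using N(2)[OF x(1) \<open>e > 0\<close>] by metis
    obtain K where K: "inverse (real (Suc K)) < d"
      using reals_Archimedean[OF d(1)] by blast
    show "\<exists>K. \<forall>k\<ge>K. norm (average h x k - h x) < e"
    proof (intro exI allI impI)
      fix k assume "K \<le> k"
      define s where "s = 1 / real (Suc k)"
      have s: "0 < s" "s < d"
      proof -
        have "inverse (real (Suc k)) \<le> inverse (real (Suc K))"
          using \<open>K \<le> k\<close> by (intro le_imp_inverse_le) auto
        then show "s < d" using K by (simp add: s_def inverse_eq_divide)
      qed (simp add: s_def)
      have "integral (cbox x (x + s *\<^sub>R One)) f = (LINT y:{x..x+s}|lebesgue. f y)"
        using set_lebesgue_integral_eq_integral(2)[OF int] by simp
      also have "\<dots> = (LINT y:{x..x+s}|lebesgue. h y)"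
        using x(2) by (intro set_lebesgue_integral_cong) (auto simp: f_def)
      finally have "average h x k = integral (cbox x (x + s *\<^sub>R One)) f /\<^sub>R s ^ DIM(real)"
        by (simp add: average_def s_def)
      then show "norm (average h x k - h x) < e"
        using d(2)[OF s] x(2) by (simp add: f_def)
    qed
  qed
  moreover have "AE x in lebesgue. x \<notin> N"
    using N(1) by (intro AE_not_in) (simp add: negligible_iff_null_sets)
  ultimately show ?thesis
    unfolding AE_half_line_iff by (auto elim!: eventually_mono)
qed

lemma integrable_half_line_imp_local:
  fixes h :: "real \<Rightarrow> complex"
  assumes "integrable half_line h"
  shows "set_integrable lebesgue {0<..b} h"
  using assms unfolding half_line_set_integrable by (rule set_integrable_subset) auto

lemma indicator_L2_half_line:
  "(\<lambda>x. complex_of_real (indicator {a..b} x)) \<in> L2 half_line"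
proof (rule L2I)
  show "(\<lambda>x. complex_of_real (indicator {a..b} x)) \<in> borel_measurable half_line"
    by (rule borel_measurable_half_line) measurable
  have "integrable lebesgue (indicat_real {a..b})"
    by (simp add: integrable_indicator_iff emeasure_lborel_Icc_eq)
  then have "integrable half_line (indicat_real {a..b})"
    unfolding half_line_set_integrable set_integrable_def
    by (intro integrable_mult_indicator) (auto simp: emeasure_lborel_Icc_eq)
  moreover have "(cmod (complex_of_real (indicator {a..b} x)))\<^sup>2 = indicat_real {a..b} x" for x
    by (auto simp: indicator_def)
  ultimately show "integrable half_line (\<lambda>x. (cmod (complex_of_real (indicator {a..b} x)))\<^sup>2)"
    by simp
qed

lemma set_integral_eq_half_line:
  fixes h :: "real \<Rightarrow> complex"
  assumes "x > 0"
  shows "(LINT y:{x..z}|lebesgue. h y) = (LINT y|half_line. h y * complex_of_real (indicator {x..z} y))"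
  unfolding half_line_set_integral set_lebesgue_integral_def
  using assms by (intro Bochner_Integration.integral_cong) (auto simp: indicator_def)

lemma L2_half_line_imp_local:
  assumes "h \<in> L2 half_line"
  shows "set_integrable lebesgue {0<..b} h"
proof -
  have "set_integrable lebesgue {0<..} (\<lambda>x. h x * complex_of_real (indicator {0..b} x))"
    unfolding half_line_set_integrable[symmetric]
    by (intro L2_mult_integrable assms indicator_L2_half_line)
  moreover have "(\<lambda>x. indicator {0<..} x *\<^sub>R (h x * complex_of_real (indicator {0..b} x))) = (\<lambda>x. indicator {0<..b} x *\<^sub>R h x)"
    by (auto simp: indicator_def fun_eq_iff)
  ultimately show ?thesis by (simp add: set_integrable_def)
qed

lemma point_value_AE:
  assumes "\<And>b. set_integrable lebesgue {0<..b} h"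
  shows "AE x in half_line. point_value h x = h x"
  using Lebesgue_differentiation[OF assms]
  by eventually_elim (simp add: point_value_eq limI)

lemma zero_AE_if_interval_integrals_zero:
  fixes h :: "real \<Rightarrow> complex"
  assumes "\<And>b. set_integrable lebesgue {0<..b} h"
    and "\<And>a b. 0 < a \<Longrightarrow> a < b \<Longrightarrow> (LINT y:{a..b}|lebesgue. h y) = 0"
  shows "AE x in half_line. h x = 0"
proof -
  have "AE x in half_line. 0 < x" by (rule AE_I2) simp
  with Lebesgue_differentiation[OF assms(1)] show ?thesis
  proof eventually_elim
    case (elim x)
    have "average h x k = 0" for k
      using assms(2)[of x "x + 1 / real (Suc k)"] elim by (simp add: average_def)
    then have "average h x = (\<lambda>k. 0)" by (simp add: fun_eq_iff)
    then show ?case using elim by (simp add: LIMSEQ_const_iff)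
  qed
qed

text \<open>
  By dominated convergence the integrals of \<open>h\<close> over all intervals vanish.  The approximants of
  the indicator functions are arbitrary because two kinds are used: continuous functions of
  \<open>exp (- t r\<^sup>2)\<close> to show that Gaussians determine a function, and smooth functions of compact
  support to show that test functions do.
\<close>

lemma zero_AE_if_bump_integrals_zero:
  fixes h :: "real \<Rightarrow> complex" and \<phi> :: "real \<Rightarrow> real \<Rightarrow> nat \<Rightarrow> real \<Rightarrow> real"
  assumes loc: "\<And>b. set_integrable lebesgue {0<..b} h"
    and meas: "\<And>a b j. \<phi> a b j \<in> borel_measurable borel"
    and bound: "\<And>a b j x. \<bar>\<phi> a b j x\<bar> \<le> 1"
    and outside: "\<And>a b j x. 0 < a \<Longrightarrow> a < b \<Longrightarrow> x \<notin> {a<..<b} \<Longrightarrow> \<phi> a b j x = 0"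
    and inside: "\<And>a b x. 0 < a \<Longrightarrow> x \<in> {a<..<b} \<Longrightarrow> (\<lambda>j. \<phi> a b j x) \<longlonglongrightarrow> 1"
    and zero: "\<And>a b j. 0 < a \<Longrightarrow> a < b \<Longrightarrow> (LINT x|half_line. h x * complex_of_real (\<phi> a b j x)) = 0"
  shows "AE x in half_line. h x = 0"
proof (rule zero_AE_if_interval_integrals_zero[OF loc])
  fix a b :: real assume ab: "0 < a" "a < b"
  have hm: "integrable half_line (\<lambda>x. indicator {0<..b} x *\<^sub>R h x)"
  proof -
    have "(\<lambda>x. indicator {0<..} x *\<^sub>R (indicator {0<..b} x *\<^sub>R h x)) = (\<lambda>x. indicator {0<..b} x *\<^sub>R h x)"
      by (auto simp: indicator_def fun_eq_iff)
    then show ?thesis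
      using loc[of b] unfolding half_line_set_integrable set_integrable_def by simp
  qed
  note meas' = borel_measurable_half_line[OF meas]
  have eq: "h x * complex_of_real (\<phi> a b j x) = (indicator {0<..b} x *\<^sub>R h x) * complex_of_real (\<phi> a b j x)" for x j
    using outside[OF ab, of x j] ab by (auto simp: indicator_def)
  have "(\<lambda>j. LINT x|half_line. (indicator {0<..b} x *\<^sub>R h x) * complex_of_real (\<phi> a b j x))
      \<longlonglongrightarrow> (LINT x|half_line. (indicator {0<..b} x *\<^sub>R h x) * complex_of_real (indicator {a<..<b} x))"
  proof (rule integral_dominated_convergence[OF _ _ integrable_norm[OF hm]])
    show "(\<lambda>x. (indicator {0<..b} x *\<^sub>R h x) * complex_of_real (indicator {a<..<b} x)) \<in> borel_measurable half_line"
      using hm by (intro borel_measurable_times borel_measurable_half_line[of "\<lambda>x. complex_of_real (indicator {a<..<b} x)"]) auto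
    show "(\<lambda>x. (indicator {0<..b} x *\<^sub>R h x) * complex_of_real (\<phi> a b j x)) \<in> borel_measurable half_line" for j
      using hm meas' by (intro borel_measurable_times) auto
    show "AE x in half_line. norm ((indicator {0<..b} x *\<^sub>R h x) * complex_of_real (\<phi> a b j x)) \<le> norm (indicator {0<..b} x *\<^sub>R h x)" for j
      using mult_left_le[OF bound[of a b j] norm_ge_zero] by (intro AE_I2) (auto simp: norm_mult indicator_def)
    show "AE x in half_line. (\<lambda>j. (indicator {0<..b} x *\<^sub>R h x) * complex_of_real (\<phi> a b j x))
       \<longlonglongrightarrow> (indicator {0<..b} x *\<^sub>R h x) * complex_of_real (indicator {a<..<b} x)"
    proof (intro AE_I2 tendsto_intros)
      fix x
      show "(\<lambda>j. \<phi> a b j x) \<longlonglongrightarrow> indicator {a<..<b} x"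
        using inside[OF ab(1), of x b] outside[OF ab, of x] by (cases "x \<in> {a<..<b}") auto
    qed
  qed
  then have "(LINT x|half_line. (indicator {0<..b} x *\<^sub>R h x) * complex_of_real (indicator {a<..<b} x)) = 0"
    unfolding eq[symmetric] zero[OF ab] by (simp add: LIMSEQ_const_iff)
  moreover have "(LINT y:{a..b}|lebesgue. h y) = (LINT y:{a<..<b}|lebesgue. h y)"
    unfolding set_lebesgue_integral_def
  proof (rule integral_cong_AE)
    have *: "set_integrable lebesgue A h" if "A \<subseteq> {0<..b}" "A \<in> sets lebesgue" for A
      using set_integrable_subset[OF loc] that by blast
    show "(\<lambda>x. indicat_real {a..b} x *\<^sub>R h x) \<in> borel_measurable lebesgue"
      "(\<lambda>x. indicat_real {a<..<b} x *\<^sub>R h x) \<in> borel_measurable lebesgue"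
      using *[of "{a..b}"] *[of "{a<..<b}"] ab unfolding set_integrable_def
      by (auto simp: subset_eq intro!: borel_measurable_integrable)
    have "AE x in lebesgue. x \<notin> {a, b}"
      by (intro AE_not_in) (auto simp: negligible_iff_null_sets[symmetric])
    then show "AE x in lebesgue. indicat_real {a..b} x *\<^sub>R h x = indicat_real {a<..<b} x *\<^sub>R h x"
      by eventually_elim (auto simp: indicator_def)
  qed
  moreover have "(LINT y:{a<..<b}|lebesgue. h y) = (LINT x|half_line. (indicator {0<..b} x *\<^sub>R h x) * complex_of_real (indicator {a<..<b} x))"
    unfolding half_line_set_integral set_lebesgue_integral_def
    using ab by (intro Bochner_Integration.integral_cong) (auto simp: indicator_def)
  ultimately show "(LINT y:{a..b}|lebesgue. h y) = 0" by simp
qed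

text \<open>
  By the Weierstrass theorem the hypothesis extends from powers of \<open>y = exp (-t r\<^sup>2)\<close>, which
  lies in \<open>(0,1)\<close>, to all continuous functions of \<open>y\<close>; as \<open>y\<close> is strictly monotone in \<open>r\<close>,
  these include approximations of the indicator functions of all intervals.
\<close>

lemma zero_AE_if_gaussian_integrals_zero:
  fixes v :: "real \<Rightarrow> complex"
  assumes v: "integrable half_line v" and t: "t > 0"
    and zero: "\<And>k. (LINT r|half_line. v r * complex_of_real (exp (- t * r\<^sup>2) ^ k)) = 0"
  shows "AE r in half_line. v r = 0"
proof -
  define y where "y r = exp (- t * r\<^sup>2)" for r :: real
  have y01: "y r \<in> {0..1}" for r
    using t by (simp add: y_def)
  have ym: "y \<in> borel_measurable borel" unfolding y_def by measurable
  have int: "integrable half_line (\<lambda>r. v r * complex_of_real (w r))"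
    if "w \<in> borel_measurable half_line" "\<And>r. \<bar>w r\<bar> \<le> B" for w B
  proof (rule Bochner_Integration.integrable_bound[OF integrable_mult_right[OF integrable_norm[OF v], of B]])
    show "(\<lambda>r. v r * complex_of_real (w r)) \<in> borel_measurable half_line"
      using v that(1) by measurable
    show "AE r in half_line. norm (v r * complex_of_real (w r)) \<le> norm (B * norm (v r))"
    proof (rule AE_I2)
      fix r
      have "\<bar>w r\<bar> \<le> \<bar>B\<bar>" using that(2)[of r] by linarith
      then have "\<bar>w r\<bar> * norm (v r) \<le> \<bar>B\<bar> * norm (v r)"
        by (rule mult_right_mono) simp
      then show "norm (v r * complex_of_real (w r)) \<le> norm (B * norm (v r))"
        by (simp add: norm_mult abs_mult mult.commute)
    qed
  qed
  have poly: "(LINT r|half_line. v r * complex_of_real (\<Sum>i\<le>n. a i * y r ^ i)) = 0" for n :: nat and a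
  proof -
    have "(LINT r|half_line. v r * complex_of_real (\<Sum>i\<le>n. a i * y r ^ i))
       = (LINT r|half_line. (\<Sum>i\<le>n. complex_of_real (a i) * (v r * complex_of_real (y r ^ i))))"
      by (simp add: sum_distrib_left mult_ac)
    also have "\<dots> = (\<Sum>i\<le>n. LINT r|half_line. complex_of_real (a i) * (v r * complex_of_real (y r ^ i)))"
    proof (intro Bochner_Integration.integral_sum integrable_mult_right)
      fix i
      show "integrable half_line (\<lambda>r. v r * complex_of_real (y r ^ i))"
        using y01 by (intro int[of _ 1] borel_measurable_half_line borel_measurable_power ym)
          (auto simp: power_abs intro!: power_le_one)
    qed
    also have "\<dots> = 0" using zero by (simp add: y_def)
    finally show ?thesis .
  qed
  have cont: "(LINT r|half_line. v r * complex_of_real (q (y r))) = 0"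
    if q: "continuous_on UNIV q" "\<And>s. \<bar>q s\<bar> \<le> 1" for q :: "real \<Rightarrow> real"
  proof -
    have qm: "(\<lambda>r. q (y r)) \<in> borel_measurable half_line"
      by (intro borel_measurable_half_line measurable_compose[OF ym] borel_measurable_continuous_onI q)
    have le: "cmod (LINT r|half_line. v r * complex_of_real (q (y r))) \<le> e * (LINT r|half_line. norm (v r))" if "e > 0" for e
    proof -
      have "continuous_on {0..1} q" using q(1) continuous_on_subset by blast
      then obtain g where g: "real_polynomial_function g" "\<And>s. s \<in> {0..1} \<Longrightarrow> \<bar>q s - g s\<bar> < e"
        using Stone_Weierstrass_real_polynomial_function[of "{0..1::real}" q e] \<open>e > 0\<close> by auto
      then obtain a n where an: "g = (\<lambda>x. \<Sum>i\<le>n. a i * x ^ i)"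
        using real_polynomial_function_iff_sum by auto
      have gm: "(\<lambda>r. g (y r)) \<in> borel_measurable half_line"
        by (intro borel_measurable_half_line) (simp add: an, use ym in measurable)
      have i1: "integrable half_line (\<lambda>r. v r * complex_of_real (q (y r)))"
        by (rule int[OF qm q(2)])
      have i2: "integrable half_line (\<lambda>r. v r * complex_of_real (q (y r) - g (y r)))"
        by (rule int[of _ e]) (use qm gm g(2) y01 in \<open>auto intro: less_imp_le\<close>)
      have "(LINT r|half_line. v r * complex_of_real (q (y r)))
          = (LINT r|half_line. v r * complex_of_real (q (y r)) - v r * complex_of_real (q (y r) - g (y r)))
            + (LINT r|half_line. v r * complex_of_real (q (y r) - g (y r)))"
        using i1 i2 by simp
      also have "(\<lambda>r. v r * complex_of_real (q (y r)) - v r * complex_of_real (q (y r) - g (y r))) =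
          (\<lambda>r. v r * complex_of_real (\<Sum>i\<le>n. a i * y r ^ i))"
        by (simp add: an algebra_simps fun_eq_iff)
      finally have "(LINT r|half_line. v r * complex_of_real (q (y r))) = (LINT r|half_line. v r * complex_of_real (q (y r) - g (y r)))"
        by (simp only: poly) simp
      also have "cmod \<dots> \<le> (LINT r|half_line. e * norm (v r))"
      proof (rule Bochner_Integration.integral_norm_bound_integral[OF i2 integrable_mult_right[OF integrable_norm[OF v]]])
        fix r
        have "\<bar>q (y r) - g (y r)\<bar> \<le> e" using g(2)[OF y01] by (rule less_imp_le)
        then show "norm (v r * complex_of_real (q (y r) - g (y r))) \<le> e * norm (v r)"
          by (simp only: norm_mult norm_of_real mult.commute[of "norm (v r)"] mult_right_mono norm_ge_zero)
      qed
      finally show ?thesis by simp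
    qed
    have "cmod (LINT r|half_line. v r * complex_of_real (q (y r))) \<le> 0 + e" if "e > 0" for e
    proof -
      define V where "V = (LINT r|half_line. norm (v r))"
      have V: "V \<ge> 0" unfolding V_def by simp
      have "cmod (LINT r|half_line. v r * complex_of_real (q (y r))) \<le> e / (V + 1) * V"
        using le[of "e / (V + 1)", folded V_def] that V by simp
      also have "\<dots> \<le> e" using that V by (simp add: pos_divide_le_eq distrib_left)
      finally show ?thesis by simp
    qed
    then have "cmod (LINT r|half_line. v r * complex_of_real (q (y r))) \<le> 0"
      by (rule field_le_epsilon)
    then show ?thesis by simp
  qed
  \<comment> \<open>trapezoids in the variable \<open>y\<close>, supported between the values of \<open>y\<close> at \<open>b\<close> and \<open>a\<close>\<close>
  define q where "q a b j s = min 1 (max 0 (real j * min (s - y b) (y a - s)))" for a b s :: real and j :: nat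
  have y_less: "y r < y s \<longleftrightarrow> s < r" if "r > 0" "s > 0" for r s
    using that t by (simp add: y_def power_mono_iff flip: not_le)
  let ?\<phi> = "\<lambda>a b j r. if r > 0 \<and> a > 0 then q a b j (y r) else 0"
  show ?thesis
  proof (rule zero_AE_if_bump_integrals_zero[where \<phi> = "?\<phi>"])
    show "set_integrable lebesgue {0<..b} v" for b
      by (rule integrable_half_line_imp_local[OF v])
    show "?\<phi> a b j \<in> borel_measurable borel" for a b j
      unfolding q_def using ym by measurable
    show "\<bar>?\<phi> a b j x\<bar> \<le> 1" for a b j x
      by (auto simp: q_def)
    show "?\<phi> a b j x = 0" if "0 < a" "a < b" "x \<notin> {a<..<b}" for a b j x
    proof (cases "x > 0")
      case True
      then have "min (y x - y b) (y a - y x) \<le> 0"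
        using y_less[of a x] y_less[of x b] that by (cases "x \<le> a") auto
      then have "real j * min (y x - y b) (y a - y x) \<le> 0"
        by (simp add: mult_nonneg_nonpos)
      then show ?thesis by (simp add: q_def)
    qed auto
    show "(\<lambda>j. ?\<phi> a b j x) \<longlonglongrightarrow> 1" if "0 < a" "x \<in> {a<..<b}" for a b x
    proof -
      define m where "m = min (y x - y b) (y a - y x)"
      have "m > 0" using that y_less[of b x] y_less[of x a] by (simp add: m_def)
      obtain J where J: "1 < real J * m" using reals_Archimedean3[OF \<open>m > 0\<close>] by blast
      have "?\<phi> a b j x = 1" if "j \<ge> J" for j
      proof -
        have "real J * m \<le> real j * m" using that \<open>m > 0\<close> by simp
        then show ?thesis using J \<open>0 < a\<close> \<open>x \<in> {a<..<b}\<close> by (auto simp: q_def m_def[symmetric])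
      qed
      then show ?thesis by (rule tendsto_eventually[OF eventually_sequentiallyI])
    qed
    show "(LINT x|half_line. v x * complex_of_real (?\<phi> a b j x)) = 0" if "0 < a" "a < b" for a b j
    proof -
      have "(LINT x|half_line. v x * complex_of_real (?\<phi> a b j x)) = (LINT x|half_line. v x * complex_of_real (q a b j (y x)))"
        using that by (intro Bochner_Integration.integral_cong) auto
      also have "\<dots> = 0"
        by (rule cont) (auto simp: q_def intro!: continuous_intros)
      finally show ?thesis .
    qed
  qed
qed

section \<open>Laguerre functions\<close>

text \<open>
  Pascal's rule turns an alternating sum into one for the differences of \<open>p\<close>.
\<close>

lemma alternating_binomial_sum_Suc:
  fixes p :: "nat \<Rightarrow> real"
  shows "(\<Sum>k\<le>Suc n. (-1)^k * real (Suc n choose k) * p k) = (\<Sum>k\<le>n. (-1)^k * real (n choose k) * (p k - p (Suc k)))"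
proof -
  have "(\<Sum>k\<le>Suc n. (-1)^k * real (Suc n choose k) * p k)
     = p 0 + (\<Sum>k\<le>n. (-1)^Suc k * real (n choose Suc k) * p (Suc k)) + (\<Sum>k\<le>n. (-1)^Suc k * real (n choose k) * p (Suc k))"
    by (subst sum.atMost_Suc_shift) (simp add: sum.distrib[symmetric] algebra_simps sum_subtractf sum_negf)
  also have "p 0 + (\<Sum>k\<le>n. (-1)^Suc k * real (n choose Suc k) * p (Suc k)) = (\<Sum>k\<le>Suc n. (-1)^k * real (n choose k) * p k)"
    by (subst sum.atMost_Suc_shift) simp
  also have "\<dots> = (\<Sum>k\<le>n. (-1)^k * real (n choose k) * p k)" by simp
  finally show ?thesis
    by (simp add: sum_subtractf sum_negf algebra_simps)
qed

text \<open>
  The sum is an \<open>n\<close>-th finite difference of a polynomial of degree \<open>m\<close>: one difference turns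
  the rising factorial of degree \<open>m\<close> at \<open>x\<close> into \<open>-m\<close> times the one of degree \<open>m - 1\<close> at \<open>x + 1\<close>.
\<close>

lemma alternating_binomial_pochhammer:
  fixes a :: real
  assumes "m \<le> n"
  shows "(\<Sum>k\<le>n. (-1)^k * real (n choose k) * pochhammer (a + real k) m) = (if m = n then (-1)^n * fact n else 0)"
  using assms
proof (induction n arbitrary: m a)
  case (Suc n)
  have step: "(\<Sum>k\<le>Suc n. (-1)^k * real (Suc n choose k) * pochhammer (a + real k) m) =
      (\<Sum>k\<le>n. (-1)^k * real (n choose k) * (pochhammer (a + real k) m - pochhammer (a + real (Suc k)) m))"
    by (rule alternating_binomial_sum_Suc)
  show ?case
  proof (cases m)
    case 0
    then show ?thesis unfolding step by simp
  next
    case (Suc m')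
    have "pochhammer (a + real k) m - pochhammer (a + real (Suc k)) m = - real m * pochhammer (a + 1 + real k) m'" for k
    proof -
      have "pochhammer (a + real k) m = (a + real k) * pochhammer (a + 1 + real k) m'"
        unfolding Suc by (subst pochhammer_rec) (simp add: algebra_simps)
      moreover have "pochhammer (a + real (Suc k)) m = pochhammer (a + 1 + real k) m' * (a + 1 + real k + real m')"
        unfolding Suc by (subst pochhammer_Suc) (simp add: algebra_simps)
      ultimately show ?thesis by (simp add: Suc algebra_simps)
    qed
    then have *: "(\<Sum>k\<le>Suc n. (-1)^k * real (Suc n choose k) * pochhammer (a + real k) m)
        = - real m * (\<Sum>k\<le>n. (-1)^k * real (n choose k) * pochhammer (a + 1 + real k) m')"
      unfolding step by (simp add: sum_distrib_left mult_ac)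
    have "m' \<le> n" using Suc.prems Suc by simp
    from Suc.IH[OF this, of "a + 1"] show ?thesis
      unfolding * using Suc by (auto simp: algebra_simps)
  qed
qed simp

definition laguerre_coeff :: "real \<Rightarrow> nat \<Rightarrow> nat \<Rightarrow> real"
  where "laguerre_coeff \<alpha> n k = (-1) ^ k * ((real n + \<alpha>) gchoose (n - k)) / fact k"

lemma laguerre_eq_sum: "laguerre n \<alpha> x = (\<Sum>k\<le>n. laguerre_coeff \<alpha> n k * x ^ k)"
  by (simp add: laguerre_def laguerre_coeff_def)

text \<open>
  The Gamma factor of the \<open>k\<close>-th moment of the weight cancels the generalised binomial
  coefficient, which reduces integrals of Laguerre polynomials to alternating sums with ordinary
  binomial coefficients.
\<close>

lemma laguerre_coeff_Gamma:
  assumes "\<alpha> > -1" "k \<le> n"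
  shows "laguerre_coeff \<alpha> n k * Gamma (\<alpha> + 1 + real k) = (-1)^k * real (n choose k) * Gamma (real n + \<alpha> + 1) / fact n"
proof -
  have "(real n + \<alpha>) gchoose (n - k) = Gamma (real n + \<alpha> + 1) / (fact (n - k) * Gamma (real n + \<alpha> - real (n - k) + 1))"
    using assms by (intro gbinomial_Gamma) (auto elim!: nonpos_Ints_cases)
  also have "real n + \<alpha> - real (n - k) + 1 = \<alpha> + 1 + real k"
    using assms(2) by (simp add: of_nat_diff)
  finally have "(real n + \<alpha>) gchoose (n - k) = Gamma (real n + \<alpha> + 1) / (fact (n - k) * Gamma (\<alpha> + 1 + real k))" .
  moreover have "Gamma (\<alpha> + 1 + real k) > 0" using assms by (intro Gamma_real_pos) auto
  moreover have "real (n choose k) = fact n / (fact k * fact (n - k))"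
    using assms(2) by (rule binomial_fact)
  ultimately show ?thesis
    by (simp add: laguerre_coeff_def)
qed

lemma laguerre_gaussian_moment:
  assumes \<alpha>: "\<alpha> > -1" and \<tau>: "\<tau> > 0" and p: "p > 0"
  shows "has_bochner_integral half_line
     (\<lambda>r. laguerre n \<alpha> (\<tau> * r\<^sup>2) * ((\<tau> * r\<^sup>2) ^ m * (r powr (2 * \<alpha> + 1) * exp (- p * r\<^sup>2))))
     (\<Sum>k\<le>n. laguerre_coeff \<alpha> n k * \<tau> ^ (k + m) * Gamma (\<alpha> + 1 + real (k + m)) / (2 * p powr (\<alpha> + 1 + real (k + m))))"
proof -
  have "has_bochner_integral half_line
      (\<lambda>r. \<Sum>k\<le>n. (laguerre_coeff \<alpha> n k * \<tau> ^ (k + m)) * (r powr (2 * (\<alpha> + 1 + real (k + m)) - 1) * exp (- p * r\<^sup>2)))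
      (\<Sum>k\<le>n. (laguerre_coeff \<alpha> n k * \<tau> ^ (k + m)) * (Gamma (\<alpha> + 1 + real (k + m)) / (2 * p powr (\<alpha> + 1 + real (k + m)))))"
    using \<alpha> p by (intro has_bochner_integral_sum has_bochner_integral_mult_right gaussian_moment) auto
  moreover have "(\<Sum>k\<le>n. (laguerre_coeff \<alpha> n k * \<tau> ^ (k + m)) * (r powr (2 * (\<alpha> + 1 + real (k + m)) - 1) * exp (- p * r\<^sup>2)))
     = laguerre n \<alpha> (\<tau> * r\<^sup>2) * ((\<tau> * r\<^sup>2) ^ m * (r powr (2 * \<alpha> + 1) * exp (- p * r\<^sup>2)))" if "r > 0" for r
  proof -
    have "r powr (2 * (\<alpha> + 1 + real (k + m)) - 1) = r powr (2 * \<alpha> + 1) * (r\<^sup>2) ^ (k + m)" for k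
    proof -
      have "2 * (\<alpha> + 1 + real (k + m)) - 1 = (2 * \<alpha> + 1) + real (2 * (k + m))" by simp
      then have "r powr (2 * (\<alpha> + 1 + real (k + m)) - 1) = r powr (2 * \<alpha> + 1) * r powr (real (2 * (k + m)))"
        by (simp only: powr_add)
      then show ?thesis using that by (simp only: powr_realpow power_mult)
    qed
    then show ?thesis
      unfolding laguerre_eq_sum sum_distrib_right
      by (intro sum.cong refl) (simp only: power_add power_mult_distrib mult_ac)
  qed
  ultimately show ?thesis
    by (subst has_bochner_integral_cong[OF refl _ refl]) auto
qed

text \<open>
  Relative to the weight, \<open>L_n\<close> is orthogonal to all polynomials of smaller degree: after
  cancellation of the Gamma factors the integral is an \<open>n\<close>-th finite difference of a
  polynomial of degree \<open>m\<close>.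
\<close>

lemma laguerre_orthogonal_powers:
  assumes \<alpha>: "\<alpha> > -1" and \<tau>: "\<tau> > 0" and "m \<le> n"
  shows "has_bochner_integral half_line
     (\<lambda>r. laguerre n \<alpha> (\<tau> * r\<^sup>2) * ((\<tau> * r\<^sup>2) ^ m * (r powr (2 * \<alpha> + 1) * exp (- \<tau> * r\<^sup>2))))
     (if m = n then (-1)^n * Gamma (real n + \<alpha> + 1) / (2 * \<tau> powr (\<alpha> + 1)) else 0)"
proof -
  let ?G = "Gamma (real n + \<alpha> + 1)"
  have "laguerre_coeff \<alpha> n k * \<tau> ^ (k + m) * Gamma (\<alpha> + 1 + real (k + m)) / (2 * \<tau> powr (\<alpha> + 1 + real (k + m)))
     = ?G / (2 * fact n * \<tau> powr (\<alpha> + 1)) * ((-1)^k * real (n choose k) * pochhammer (\<alpha> + 1 + real k) m)"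
    if "k \<le> n" for k
  proof -
    have "Gamma (\<alpha> + 1 + real k + real m) = pochhammer (\<alpha> + 1 + real k) m * Gamma (\<alpha> + 1 + real k)"
    proof -
      have "Gamma (\<alpha> + 1 + real k) > 0" using \<alpha> by (intro Gamma_real_pos) auto
      moreover have "\<alpha> + 1 + real k \<notin> \<int>\<^sub>\<le>\<^sub>0" using \<alpha> by (auto elim!: nonpos_Ints_cases)
      ultimately show ?thesis by (simp add: pochhammer_Gamma)
    qed
    moreover have "\<tau> powr (\<alpha> + 1 + real (k + m)) = \<tau> powr (\<alpha> + 1) * \<tau> ^ (k + m)"
      using \<tau> by (simp only: powr_add[of _ "\<alpha> + 1"] powr_realpow)
    ultimately have "laguerre_coeff \<alpha> n k * \<tau> ^ (k + m) * Gamma (\<alpha> + 1 + real (k + m)) / (2 * \<tau> powr (\<alpha> + 1 + real (k + m)))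
       = (laguerre_coeff \<alpha> n k * Gamma (\<alpha> + 1 + real k)) * pochhammer (\<alpha> + 1 + real k) m / (2 * \<tau> powr (\<alpha> + 1))"
      using \<tau> by (simp add: add_ac)
    then show ?thesis
      unfolding laguerre_coeff_Gamma[OF \<alpha> that] by (simp add: field_simps)
  qed
  then have "(\<Sum>k\<le>n. laguerre_coeff \<alpha> n k * \<tau> ^ (k + m) * Gamma (\<alpha> + 1 + real (k + m)) / (2 * \<tau> powr (\<alpha> + 1 + real (k + m))))
      = ?G / (2 * fact n * \<tau> powr (\<alpha> + 1)) * (\<Sum>k\<le>n. (-1)^k * real (n choose k) * pochhammer (\<alpha> + 1 + real k) m)"
    by (simp add: sum_distrib_left)
  also have "\<dots> = (if m = n then (-1)^n * ?G / (2 * \<tau> powr (\<alpha> + 1)) else 0)"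
    unfolding alternating_binomial_pochhammer[OF assms(3)] by simp
  finally show ?thesis
    using laguerre_gaussian_moment[OF \<alpha> \<tau> \<tau>, of n m] by simp
qed

lemma laguerre_orthogonal:
  assumes \<alpha>: "\<alpha> > -1" and \<tau>: "\<tau> > 0" and jn: "j \<le> n"
  shows "has_bochner_integral half_line
     (\<lambda>r. laguerre n \<alpha> (\<tau> * r\<^sup>2) * laguerre j \<alpha> (\<tau> * r\<^sup>2) * (r powr (2 * \<alpha> + 1) * exp (- \<tau> * r\<^sup>2)))
     (if j = n then Gamma (real n + \<alpha> + 1) / (2 * fact n * \<tau> powr (\<alpha> + 1)) else 0)"
proof -
  let ?w = "\<lambda>r. r powr (2 * \<alpha> + 1) * exp (- \<tau> * r\<^sup>2)"
  let ?G = "Gamma (real n + \<alpha> + 1)"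
  have "has_bochner_integral half_line
     (\<lambda>r. \<Sum>m\<le>j. laguerre_coeff \<alpha> j m * (laguerre n \<alpha> (\<tau> * r\<^sup>2) * ((\<tau> * r\<^sup>2) ^ m * ?w r)))
     (\<Sum>m\<le>j. laguerre_coeff \<alpha> j m * (if m = n then (-1)^n * ?G / (2 * \<tau> powr (\<alpha> + 1)) else 0))"
    using jn by (intro has_bochner_integral_sum has_bochner_integral_mult_right laguerre_orthogonal_powers \<alpha> \<tau>) auto
  moreover have "(\<lambda>r. \<Sum>m\<le>j. laguerre_coeff \<alpha> j m * (laguerre n \<alpha> (\<tau> * r\<^sup>2) * ((\<tau> * r\<^sup>2) ^ m * ?w r)))
     = (\<lambda>r. laguerre n \<alpha> (\<tau> * r\<^sup>2) * laguerre j \<alpha> (\<tau> * r\<^sup>2) * ?w r)"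
    by (simp add: laguerre_eq_sum[of j] sum_distrib_left sum_distrib_right mult_ac)
  moreover have "(\<Sum>m\<le>j. laguerre_coeff \<alpha> j m * (if m = n then (-1)^n * ?G / (2 * \<tau> powr (\<alpha> + 1)) else 0))
     = (if j = n then ?G / (2 * fact n * \<tau> powr (\<alpha> + 1)) else 0)"
  proof -
    have "(\<Sum>m\<le>j. laguerre_coeff \<alpha> j m * (if m = n then (-1)^n * ?G / (2 * \<tau> powr (\<alpha> + 1)) else 0))
       = (if n \<le> j then laguerre_coeff \<alpha> j n * ((-1)^n * ?G / (2 * \<tau> powr (\<alpha> + 1))) else 0)"
      by (simp add: if_distrib[of "\<lambda>x. _ * x"] sum.delta cong: if_cong)
    moreover have "laguerre_coeff \<alpha> n n * (-1)^n = 1 / fact n"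
      by (simp add: laguerre_coeff_def power_mult_distrib[symmetric])
    moreover have "laguerre_coeff \<alpha> n n * ((-1)^n * ?G / (2 * \<tau> powr (\<alpha> + 1)))
        = (laguerre_coeff \<alpha> n n * (-1)^n) * ?G / (2 * \<tau> powr (\<alpha> + 1))"
      by simp
    ultimately show ?thesis
      using jn by auto
  qed
  ultimately show ?thesis by simp
qed

lemma laguerre_measurable [measurable]: "laguerre n \<alpha> \<in> borel_measurable borel"
  unfolding laguerre_def[abs_def] by measurable

lemma laguerre_fun_scaled_measurable:
  "(\<lambda>z. laguerre_fun_scaled \<alpha> (fst z) n (snd z)) \<in> borel_measurable (borel \<Otimes>\<^sub>M borel)"
  unfolding laguerre_fun_scaled_def laguerre_fun_def by measurable

text \<open>The normalising constant of the Laguerre functions, without its dependence on the scale.\<close>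

definition laguerre_norm_factor :: "real \<Rightarrow> nat \<Rightarrow> real"
  where "laguerre_norm_factor \<alpha> n = (2 * fact n / Gamma (real n + \<alpha> + 1)) powr (1/2)"

lemma laguerre_norm_factor_square:
  assumes "\<alpha> > -1"
  shows "(laguerre_norm_factor \<alpha> n)\<^sup>2 = 2 * fact n / Gamma (real n + \<alpha> + 1)"
proof -
  have "Gamma (real n + \<alpha> + 1) > 0" using assms by (intro Gamma_real_pos) auto
  then show ?thesis by (simp add: laguerre_norm_factor_def powr_half_sqrt)
qed

lemma laguerre_fun_scaled_eq:
  assumes "\<tau> > 0" "r > 0"
  shows "laguerre_fun_scaled \<alpha> \<tau> n r = laguerre_norm_factor \<alpha> n * \<tau> powr ((\<alpha> + 1) / 2)
     * (laguerre n \<alpha> (\<tau> * r\<^sup>2) * (r powr (\<alpha> + 1/2) * exp (- \<tau> * r\<^sup>2 / 2)))"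
proof -
  have 1: "(sqrt \<tau> * r)\<^sup>2 = \<tau> * r\<^sup>2" using assms by (simp add: power_mult_distrib)
  have "(sqrt \<tau> * r) powr (\<alpha> + 1/2) = \<tau> powr ((\<alpha> + 1/2) / 2) * r powr (\<alpha> + 1/2)"
    using assms by (simp add: powr_mult powr_half_sqrt[symmetric] powr_powr)
  moreover have \<tau>: "\<tau> powr (1/4) * \<tau> powr ((\<alpha> + 1/2) / 2) = \<tau> powr ((\<alpha> + 1) / 2)"
  proof -
    have "1 / 4 + (\<alpha> + 1/2) / 2 = (\<alpha> + 1) / 2" by (simp add: field_simps)
    then show ?thesis by (simp only: powr_add[symmetric])
  qed
  moreover have "Gamma (real n + 1) = fact n"
    using Gamma_fact[of n, where ?'a = real] by (simp add: add.commute)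
  ultimately have "laguerre_fun_scaled \<alpha> \<tau> n r = \<tau> powr (1/4) * (laguerre_norm_factor \<alpha> n * laguerre n \<alpha> (\<tau> * r\<^sup>2)
      * exp (- \<tau> * r\<^sup>2 / 2) * (\<tau> powr ((\<alpha> + 1/2) / 2) * r powr (\<alpha> + 1/2)))"
    by (simp only: laguerre_fun_scaled_def laguerre_fun_def 1 laguerre_norm_factor_def mult_minus_left)
  also have "\<dots> = laguerre_norm_factor \<alpha> n * (\<tau> powr (1/4) * \<tau> powr ((\<alpha> + 1/2) / 2))
     * (laguerre n \<alpha> (\<tau> * r\<^sup>2) * (r powr (\<alpha> + 1/2) * exp (- \<tau> * r\<^sup>2 / 2)))"
    by (simp only: mult_ac)
  finally show ?thesis unfolding \<tau> .
qed

lemma powr_half_square: "(\<tau> powr (x / 2))\<^sup>2 = \<tau> powr x" if "\<tau> > 0" for \<tau> x :: real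
  using that by (simp add: power2_eq_square powr_add[symmetric])

lemma powr_double: "r powr (2 * \<alpha> + 1) = r powr (\<alpha> + 1/2) * r powr (\<alpha> + 1/2)" for r \<alpha> :: real
proof -
  have "2 * \<alpha> + 1 = (\<alpha> + 1/2) + (\<alpha> + 1/2)" by simp
  then show ?thesis by (simp only: powr_add[symmetric])
qed

lemma laguerre_fun_scaled_orthonormal:
  assumes \<alpha>: "\<alpha> > -1" and \<tau>: "\<tau> > 0"
  shows "has_bochner_integral half_line (\<lambda>r. laguerre_fun_scaled \<alpha> \<tau> m r * laguerre_fun_scaled \<alpha> \<tau> n r) (if m = n then 1 else 0)"
proof -
  have *: "has_bochner_integral half_line (\<lambda>r. laguerre_fun_scaled \<alpha> \<tau> n r * laguerre_fun_scaled \<alpha> \<tau> j r) (if j = n then 1 else 0)"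
    if "j \<le> n" for j n
  proof -
    let ?c = "laguerre_norm_factor \<alpha> n * laguerre_norm_factor \<alpha> j * \<tau> powr (\<alpha> + 1)"
    have G: "Gamma (real n + \<alpha> + 1) > 0" using \<alpha> by (intro Gamma_real_pos) auto
    have "has_bochner_integral half_line
       (\<lambda>r. ?c * (laguerre n \<alpha> (\<tau> * r\<^sup>2) * laguerre j \<alpha> (\<tau> * r\<^sup>2) * (r powr (2 * \<alpha> + 1) * exp (- \<tau> * r\<^sup>2))))
       (?c * (if j = n then Gamma (real n + \<alpha> + 1) / (2 * fact n * \<tau> powr (\<alpha> + 1)) else 0))"
      by (intro has_bochner_integral_mult_right laguerre_orthogonal \<alpha> \<tau> that)
    moreover have "?c * (if j = n then Gamma (real n + \<alpha> + 1) / (2 * fact n * \<tau> powr (\<alpha> + 1)) else 0) = (if j = n then 1 else 0)"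
      using laguerre_norm_factor_square[OF \<alpha>, of n] \<tau> G by (simp add: power2_eq_square)
    moreover have "?c * (laguerre n \<alpha> (\<tau> * r\<^sup>2) * laguerre j \<alpha> (\<tau> * r\<^sup>2) * (r powr (2 * \<alpha> + 1) * exp (- \<tau> * r\<^sup>2)))
        = laguerre_fun_scaled \<alpha> \<tau> n r * laguerre_fun_scaled \<alpha> \<tau> j r" if "r > 0" for r
    proof -
      have "r powr (2 * \<alpha> + 1) = r powr (\<alpha> + 1/2) * r powr (\<alpha> + 1/2)"
        by (rule powr_double)
      moreover have "exp (- \<tau> * r\<^sup>2) = exp (- \<tau> * r\<^sup>2 / 2) * exp (- \<tau> * r\<^sup>2 / 2)"
        by (simp add: exp_add[symmetric])
      moreover have "\<tau> powr (\<alpha> + 1) = \<tau> powr ((\<alpha> + 1)/2) * \<tau> powr ((\<alpha> + 1)/2)"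
        by (simp add: powr_add[symmetric])
      ultimately show ?thesis
        unfolding laguerre_fun_scaled_eq[OF \<tau> that] by (simp only: mult_ac)
    qed
    ultimately show ?thesis
      by (subst has_bochner_integral_cong[OF refl _ refl, symmetric]) auto
  qed
  show ?thesis
    using *[of m n] *[of n m] by (cases "m \<le> n") (auto simp: mult.commute)
qed

lemma laguerre_fun_scaled_measurable_section [measurable]:
  "laguerre_fun_scaled \<alpha> \<tau> n \<in> borel_measurable borel"
  unfolding laguerre_fun_scaled_def[abs_def] laguerre_fun_def by measurable

lemma orthonormal_laguerre:
  assumes \<alpha>: "\<alpha> > -1" and \<tau>: "\<tau> > 0"
  shows "orthonormal_system half_line (laguerre_fun_scaled \<alpha> \<tau>)"
proof
  fix m n
  show "(\<lambda>r. complex_of_real (laguerre_fun_scaled \<alpha> \<tau> n r)) \<in> L2 half_line"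
  proof (rule L2I)
    show "(\<lambda>r. complex_of_real (laguerre_fun_scaled \<alpha> \<tau> n r)) \<in> borel_measurable half_line"
      by (rule borel_measurable_half_line) measurable
    show "integrable half_line (\<lambda>r. (cmod (complex_of_real (laguerre_fun_scaled \<alpha> \<tau> n r)))\<^sup>2)"
      using laguerre_fun_scaled_orthonormal[OF \<alpha> \<tau>, of n n]
      by (simp add: power2_eq_square has_bochner_integral_iff)
  qed
  show "(LINT r|half_line. laguerre_fun_scaled \<alpha> \<tau> m r * laguerre_fun_scaled \<alpha> \<tau> n r) = (if m = n then 1 else 0)"
    using laguerre_fun_scaled_orthonormal[OF \<alpha> \<tau>, of m n] by (rule has_bochner_integral_integral_eq)
qed

text \<open>
  A one-parameter family on which both the Laguerre and the Hankel transform are explicit and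
  which is rich enough to determine a function on the half-line.
\<close>

definition gauss :: "real \<Rightarrow> real \<Rightarrow> real \<Rightarrow> real"
  where "gauss \<alpha> s r = r powr (\<alpha> + 1/2) * exp (- s * r\<^sup>2 / 2)"

lemma gauss_measurable [measurable]: "gauss \<alpha> s \<in> borel_measurable borel"
  unfolding gauss_def[abs_def] by measurable

lemma gauss_square_integral:
  assumes \<alpha>: "\<alpha> > -1" and s: "s > 0"
  shows "has_bochner_integral half_line (\<lambda>r. (gauss \<alpha> s r)\<^sup>2) (Gamma (\<alpha> + 1) / (2 * s powr (\<alpha> + 1)))"
proof -
  have "r powr (2 * (\<alpha> + 1) - 1) = r powr (\<alpha> + 1/2) * r powr (\<alpha> + 1/2)" for r
    using powr_double[of r \<alpha>] by (simp add: algebra_simps)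
  moreover have "exp (- s * r\<^sup>2) = exp (- s * r\<^sup>2 / 2) * exp (- s * r\<^sup>2 / 2)" for r
    by (simp add: exp_add[symmetric])
  ultimately have "(gauss \<alpha> s r)\<^sup>2 = r powr (2 * (\<alpha> + 1) - 1) * exp (- s * r\<^sup>2)" for r
    by (simp only: gauss_def power2_eq_square mult_ac)
  then show ?thesis using gaussian_moment[of "\<alpha> + 1" s] assms by simp
qed

lemma gauss_L2:
  assumes "\<alpha> > -1" "s > 0"
  shows "(\<lambda>r. complex_of_real (gauss \<alpha> s r)) \<in> L2 half_line"
proof (rule L2I)
  show "(\<lambda>r. complex_of_real (gauss \<alpha> s r)) \<in> borel_measurable half_line"
    by (rule borel_measurable_half_line) measurable
  show "integrable half_line (\<lambda>r. (cmod (complex_of_real (gauss \<alpha> s r)))\<^sup>2)"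
    using gauss_square_integral[OF assms] by (simp add: has_bochner_integral_iff)
qed

lemma gauss_norm:
  assumes "\<alpha> > -1" "s > 0"
  shows "(L2_norm half_line (\<lambda>r. complex_of_real (gauss \<alpha> s r)))\<^sup>2 = Gamma (\<alpha> + 1) / (2 * s powr (\<alpha> + 1))"
  unfolding L2_norm_square using gauss_square_integral[OF assms] by (simp add: has_bochner_integral_iff)

lemma gauss_pos: "r > 0 \<Longrightarrow> gauss \<alpha> s r > 0"
  by (simp add: gauss_def)

text \<open>
  The Laplace transform of a Laguerre polynomial with its weight; the sum over the coefficients
  is evaluated by the binomial theorem.
\<close>

lemma laguerre_gauss:
  assumes \<alpha>: "\<alpha> > -1" and \<tau>: "\<tau> > 0" and s: "s > 0"
  shows "(LINT r|half_line. gauss \<alpha> s r * laguerre_fun_scaled \<alpha> \<tau> n r)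
    = laguerre_norm_factor \<alpha> n * \<tau> powr ((\<alpha> + 1) / 2) * Gamma (real n + \<alpha> + 1) / (2 * fact n * ((s + \<tau>) / 2) powr (\<alpha> + 1))
       * ((s - \<tau>) / (s + \<tau>)) ^ n"
proof -
  define p where "p = (s + \<tau>) / 2"
  let ?G = "Gamma (real n + \<alpha> + 1)"
  let ?c = "laguerre_norm_factor \<alpha> n * \<tau> powr ((\<alpha> + 1) / 2)"
  have p: "p > 0" using \<tau> s by (simp add: p_def)
  have "(LINT r|half_line. gauss \<alpha> s r * laguerre_fun_scaled \<alpha> \<tau> n r) =
     (LINT r|half_line. ?c * (laguerre n \<alpha> (\<tau> * r\<^sup>2) * ((\<tau> * r\<^sup>2) ^ 0 * (r powr (2 * \<alpha> + 1) * exp (- p * r\<^sup>2)))))"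
  proof (intro Bochner_Integration.integral_cong refl)
    fix r :: real assume "r \<in> space half_line"
    then have "r > 0" by simp
    moreover have "r powr (2 * \<alpha> + 1) = r powr (\<alpha> + 1/2) * r powr (\<alpha> + 1/2)"
      by (rule powr_double)
    moreover have "exp (- p * r\<^sup>2) = exp (- \<tau> * r\<^sup>2 / 2) * exp (- s * r\<^sup>2 / 2)"
      by (simp add: exp_add[symmetric] p_def field_simps)
    ultimately show "gauss \<alpha> s r * laguerre_fun_scaled \<alpha> \<tau> n r =
        ?c * (laguerre n \<alpha> (\<tau> * r\<^sup>2) * ((\<tau> * r\<^sup>2) ^ 0 * (r powr (2 * \<alpha> + 1) * exp (- p * r\<^sup>2))))"
      unfolding gauss_def laguerre_fun_scaled_eq[OF \<tau> \<open>r > 0\<close>] by (simp only: mult_ac power_0 mult_1)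
  qed
  also have "\<dots> = ?c * (\<Sum>k\<le>n. laguerre_coeff \<alpha> n k * \<tau> ^ (k + 0) * Gamma (\<alpha> + 1 + real (k + 0)) / (2 * p powr (\<alpha> + 1 + real (k + 0))))"
    using has_bochner_integral_integral_eq[OF laguerre_gaussian_moment[OF \<alpha> \<tau> p, of n 0]]
    by (simp only: integral_mult_right_zero)
  also have "(\<Sum>k\<le>n. laguerre_coeff \<alpha> n k * \<tau> ^ (k + 0) * Gamma (\<alpha> + 1 + real (k + 0)) / (2 * p powr (\<alpha> + 1 + real (k + 0))))
     = (\<Sum>k\<le>n. ?G / (2 * fact n * p powr (\<alpha> + 1)) * (real (n choose k) * (- \<tau> / p) ^ k * 1 ^ (n - k)))"
  proof (intro sum.cong refl)
    fix k assume "k \<in> {..n}"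
    then have k: "k \<le> n" by simp
    have "p powr (\<alpha> + 1 + real k) = p powr (\<alpha> + 1) * p ^ k"
      using p by (simp only: powr_add[of _ "\<alpha> + 1"] powr_realpow)
    then have "laguerre_coeff \<alpha> n k * \<tau> ^ (k + 0) * Gamma (\<alpha> + 1 + real (k + 0)) / (2 * p powr (\<alpha> + 1 + real (k + 0)))
       = (laguerre_coeff \<alpha> n k * Gamma (\<alpha> + 1 + real k)) * (\<tau> / p) ^ k / (2 * p powr (\<alpha> + 1))"
      by (simp add: power_divide mult_ac)
    also have "\<dots> = ?G / (2 * fact n * p powr (\<alpha> + 1)) * (real (n choose k) * ((-1)^k * (\<tau> / p) ^ k))"
      unfolding laguerre_coeff_Gamma[OF \<alpha> k] by (simp add: mult_ac)
    also have "(-1)^k * (\<tau> / p) ^ k = (- \<tau> / p) ^ k"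
      by (simp add: power_mult_distrib[symmetric])
    finally show "laguerre_coeff \<alpha> n k * \<tau> ^ (k + 0) * Gamma (\<alpha> + 1 + real (k + 0)) / (2 * p powr (\<alpha> + 1 + real (k + 0)))
       = ?G / (2 * fact n * p powr (\<alpha> + 1)) * (real (n choose k) * (- \<tau> / p) ^ k * 1 ^ (n - k))" by simp
  qed
  also have "\<dots> = ?G / (2 * fact n * p powr (\<alpha> + 1)) * (- \<tau> / p + 1) ^ n"
    unfolding binomial_ring by (simp add: sum_distrib_left)
  also have "- \<tau> / p + 1 = (s - \<tau>) / (s + \<tau>)"
    using \<tau> s by (simp add: p_def field_simps)
  finally show ?thesis by (simp add: p_def)
qed

lemma Gamma_binomial_series:
  assumes \<alpha>: "\<alpha> > -1" and q: "0 \<le> q" "q < 1"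
  shows "(\<lambda>n. Gamma (real n + \<alpha> + 1) / fact n * q ^ n) sums (Gamma (\<alpha> + 1) * (1 - q) powr (- (\<alpha> + 1)))"
proof -
  have "Gamma (real n + \<alpha> + 1) / fact n * q ^ n = Gamma (\<alpha> + 1) * ((- (\<alpha> + 1) gchoose n) * (- q) ^ n)" for n
  proof -
    have "- (\<alpha> + 1) gchoose n = (-1)^n * ((\<alpha> + 1 + real n - 1) gchoose n)"
      by (rule gbinomial_minus)
    also have "(\<alpha> + 1 + real n - 1) gchoose n = Gamma (\<alpha> + 1 + real n - 1 + 1) / (fact n * Gamma (\<alpha> + 1 + real n - 1 - real n + 1))"
      using \<alpha> by (intro gbinomial_Gamma) (auto elim!: nonpos_Ints_cases)
    finally have "- (\<alpha> + 1) gchoose n = (-1)^n * (Gamma (real n + \<alpha> + 1) / (fact n * Gamma (\<alpha> + 1)))"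
      by (simp add: algebra_simps)
    moreover have "Gamma (\<alpha> + 1) > 0" using \<alpha> by (intro Gamma_real_pos) auto
    ultimately have "Gamma (\<alpha> + 1) * ((- (\<alpha> + 1) gchoose n) * (- q) ^ n) = Gamma (real n + \<alpha> + 1) / fact n * ((-1)^n * (- q) ^ n)"
      by simp
    also have "(-1)^n * (- q) ^ n = q ^ n" by (simp add: power_mult_distrib[symmetric])
    finally show ?thesis ..
  qed
  moreover have "(\<lambda>n. Gamma (\<alpha> + 1) * ((- (\<alpha> + 1) gchoose n) * (- q) ^ n)) sums (Gamma (\<alpha> + 1) * (1 + - q) powr (- (\<alpha> + 1)))"
    using q by (intro sums_mult gen_binomial_real) simp
  ultimately show ?thesis by simp
qed

context
  fixes \<alpha> \<tau> :: real
  assumes \<alpha>: "\<alpha> > -1" and \<tau>: "\<tau> > 0"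
begin

interpretation orthonormal_system half_line "laguerre_fun_scaled \<alpha> \<tau>"
  by (rule orthonormal_laguerre[OF \<alpha> \<tau>])

lemma coeff_gauss_laguerre:
  assumes "s > 0"
  shows "coeff (\<lambda>r. complex_of_real (gauss \<alpha> s r)) n = complex_of_real
    (laguerre_norm_factor \<alpha> n * \<tau> powr ((\<alpha> + 1) / 2) * Gamma (real n + \<alpha> + 1) / (2 * fact n * ((s + \<tau>) / 2) powr (\<alpha> + 1))
       * ((s - \<tau>) / (s + \<tau>)) ^ n)"
  unfolding coeff_def laguerre_gauss[OF \<alpha> \<tau> assms, symmetric] by (simp flip: of_real_mult)

text \<open>
  Equality in Bessel's inequality, so that the Gaussians lie in the closed span of the
  Laguerre functions.  The sum of squares is a binomial series.
\<close>

lemma gauss_coeff_Parseval: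
  assumes s: "s > 0"
  shows "(\<lambda>n. (cmod (coeff (\<lambda>r. complex_of_real (gauss \<alpha> s r)) n))\<^sup>2) sums (L2_norm half_line (\<lambda>r. complex_of_real (gauss \<alpha> s r)))\<^sup>2"
proof -
  define p where "p = (s + \<tau>) / 2"
  define q where "q = ((s - \<tau>) / (s + \<tau>))\<^sup>2"
  have p: "p > 0" using s \<tau> by (simp add: p_def)
  have q1: "1 - q = s * \<tau> / p\<^sup>2"
  proof -
    have "1 - q = ((s + \<tau>)\<^sup>2 - (s - \<tau>)\<^sup>2) / (s + \<tau>)\<^sup>2"
      using s \<tau> unfolding q_def power_divide by (simp add: diff_divide_distrib[of "(s + \<tau>)\<^sup>2"])
    also have "(s + \<tau>)\<^sup>2 - (s - \<tau>)\<^sup>2 = 4 * (s * \<tau>)" by (simp add: power2_sum power2_diff)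
    finally show ?thesis by (simp add: p_def power_divide)
  qed
  have q: "0 \<le> q" "q < 1"
    using q1 s \<tau> p by (simp_all add: q_def) (smt (verit) divide_pos_pos mult_pos_pos zero_less_power)
  have eq: "(cmod (coeff (\<lambda>r. complex_of_real (gauss \<alpha> s r)) n))\<^sup>2
     = \<tau> powr (\<alpha> + 1) / (2 * (p powr (\<alpha> + 1))\<^sup>2) * (Gamma (real n + \<alpha> + 1) / fact n * q ^ n)" for n
  proof -
    let ?G = "Gamma (real n + \<alpha> + 1)"
    have G: "?G > 0" using \<alpha> by (intro Gamma_real_pos) auto
    have "(cmod (coeff (\<lambda>r. complex_of_real (gauss \<alpha> s r)) n))\<^sup>2
      = (laguerre_norm_factor \<alpha> n)\<^sup>2 * (\<tau> powr ((\<alpha> + 1) / 2))\<^sup>2 * ?G\<^sup>2 / (4 * (fact n)\<^sup>2 * (p powr (\<alpha> + 1))\<^sup>2) * q ^ n"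
      unfolding coeff_gauss_laguerre[OF s] norm_of_real power2_abs
      by (simp only: p_def[symmetric] power_mult_distrib power_divide q_def power_mult[symmetric] mult.commute[of n 2]) (simp add: power_mult_distrib power_divide)
    also have "\<dots> = \<tau> powr (\<alpha> + 1) / (2 * (p powr (\<alpha> + 1))\<^sup>2) * (?G / fact n * q ^ n)"
      unfolding laguerre_norm_factor_square[OF \<alpha>] powr_half_square[OF \<tau>]
      using G by (simp add: power2_eq_square mult_ac)
    finally show ?thesis .
  qed
  have "(\<lambda>n. (cmod (coeff (\<lambda>r. complex_of_real (gauss \<alpha> s r)) n))\<^sup>2) sums
     (\<tau> powr (\<alpha> + 1) / (2 * (p powr (\<alpha> + 1))\<^sup>2) * (Gamma (\<alpha> + 1) * (1 - q) powr (- (\<alpha> + 1))))"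
    unfolding eq by (intro sums_mult Gamma_binomial_series \<alpha> q)
  also have "(1 - q) powr (- (\<alpha> + 1)) = (p powr (\<alpha> + 1))\<^sup>2 / (s powr (\<alpha> + 1) * \<tau> powr (\<alpha> + 1))"
    unfolding q1 powr_minus using s \<tau> p by (simp add: powr_divide powr_mult power2_eq_square)
  also have "\<tau> powr (\<alpha> + 1) / (2 * (p powr (\<alpha> + 1))\<^sup>2) * (Gamma (\<alpha> + 1) * ((p powr (\<alpha> + 1))\<^sup>2 / (s powr (\<alpha> + 1) * \<tau> powr (\<alpha> + 1))))
      = Gamma (\<alpha> + 1) / (2 * s powr (\<alpha> + 1))"
    using s \<tau> p by simp
  finally show ?thesis unfolding gauss_norm[OF \<alpha> s] .
qed

end

text \<open>
  For \<open>s = 1 + k\<close> the Gaussian is \<open>gauss \<alpha> 1\<close> times the \<open>k\<close>-th power of \<open>exp (- r\<^sup>2 / 2)\<close>.  Only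
  integrability against one Gaussian is assumed of \<open>w\<close>, since the lemma is applied to Hankel
  integrals, of which square integrability is not known beforehand.
\<close>

lemma zero_AE_if_gauss_integrals_zero:
  assumes w: "integrable half_line (\<lambda>r. w r * complex_of_real (gauss \<alpha> 1 r))"
    and zero: "\<And>s. s > 0 \<Longrightarrow> (LINT r|half_line. w r * complex_of_real (gauss \<alpha> s r)) = 0"
  shows "AE r in half_line. w r = 0"
proof -
  have "AE r in half_line. w r * complex_of_real (gauss \<alpha> 1 r) = 0"
  proof (rule zero_AE_if_gaussian_integrals_zero[OF w, of "1/2"])
    fix k
    have "gauss \<alpha> 1 r * exp (- (1/2) * r\<^sup>2) ^ k = gauss \<alpha> (1 + real k) r" for r
      by (simp add: gauss_def exp_of_nat_mult[symmetric] exp_add[symmetric] field_simps)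
    then have *: "w r * complex_of_real (gauss \<alpha> 1 r) * complex_of_real (exp (- (1/2) * r\<^sup>2) ^ k) = w r * complex_of_real (gauss \<alpha> (1 + real k) r)" for r
      by (metis mult.assoc of_real_mult)
    show "(LINT r|half_line. w r * complex_of_real (gauss \<alpha> 1 r) * complex_of_real (exp (- (1/2) * r\<^sup>2) ^ k)) = 0"
      unfolding * by (rule zero) simp
  qed simp
  moreover have "AE r in half_line. r > 0" by (rule AE_I2) simp
  ultimately show ?thesis
    by eventually_elim (use gauss_pos in \<open>force simp: less_le\<close>)
qed

text \<open>
  A function orthogonal to the Laguerre functions is orthogonal to their closed span, which
  contains the Gaussians.
\<close>

lemma laguerre_basis:
  assumes \<alpha>: "\<alpha> > -1" and \<tau>: "\<tau> > 0"
  shows "orthonormal_basis half_line (laguerre_fun_scaled \<alpha> \<tau>)"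
proof -
  interpret orthonormal_system half_line "laguerre_fun_scaled \<alpha> \<tau>"
    by (rule orthonormal_laguerre[OF \<alpha> \<tau>])
  show ?thesis
  proof
    fix h assume h: "h \<in> L2 half_line" and 0: "\<And>n. coeff h n = 0"
    show "AE r in half_line. h r = 0"
    proof (rule zero_AE_if_gauss_integrals_zero)
      show "integrable half_line (\<lambda>r. h r * complex_of_real (gauss \<alpha> 1 r))"
        by (intro L2_mult_integrable h gauss_L2 \<alpha>) simp
      fix s :: real assume s: "s > 0"
      let ?g = "\<lambda>r. complex_of_real (gauss \<alpha> s r)"
      have "L2_tendsto half_line (partial (coeff ?g)) ?g"
        by (rule L2_tendsto_partial_coeff[OF gauss_L2[OF \<alpha> s] gauss_coeff_Parseval[OF \<alpha> \<tau> s]])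
      from inner_L2_series[OF this h] have "(LINT r|half_line. ?g r * h r) = 0"
        by (simp add: 0 sums_iff)
      then show "(LINT r|half_line. h r * complex_of_real (gauss \<alpha> s r)) = 0"
        by (simp add: mult.commute)
    qed
  qed
qed

section \<open>The Hankel transform\<close>

subsection \<open>Gaussians under the Hankel kernel\<close>

definition hankel_kernel :: "real \<Rightarrow> real \<Rightarrow> real"
  where "hankel_kernel \<beta> x = x powr (1/2) * bessel_J \<beta> x"

text \<open>The Bessel series multiplied into the kernel.\<close>

definition hankel_term :: "real \<Rightarrow> nat \<Rightarrow> real \<Rightarrow> real"
  where "hankel_term \<beta> k x = x powr (1/2) * ((-1) ^ k / (fact k * Gamma (real k + \<beta> + 1)) * (x / 2) powr (2 * real k + \<beta>))"

lemma bessel_J_measurable [measurable]: "bessel_J \<beta> \<in> borel_measurable borel"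
  unfolding bessel_J_def[abs_def] by measurable

lemma hankel_kernel_measurable [measurable]: "hankel_kernel \<beta> \<in> borel_measurable borel"
  unfolding hankel_kernel_def[abs_def] by measurable

lemma hankel_term_measurable [measurable]: "hankel_term \<beta> k \<in> borel_measurable borel"
  unfolding hankel_term_def[abs_def] by measurable

text \<open>
  A moment of a Gaussian; the factor \<open>Gamma (k + \<beta> + 1)\<close> in the denominator of the Bessel series
  cancels, which leaves the terms of an exponential series.
\<close>

lemma gauss_hankel_term:
  assumes \<beta>: "\<beta> > -1" and s: "s > 0" and u: "u > 0"
  shows "has_bochner_integral half_line (\<lambda>\<tau>. gauss \<beta> s \<tau> * hankel_term \<beta> k (\<tau> * u))
     (s powr (- (\<beta> + 1)) * u powr (\<beta> + 1/2) * ((- (u\<^sup>2 / (2 * s))) ^ k / fact k))"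
proof -
  let ?a = "real k + \<beta> + 1"
  let ?A = "(-1) ^ k / (fact k * Gamma ?a)"
  have G: "Gamma ?a > 0" using \<beta> by (intro Gamma_real_pos) auto
  have "has_bochner_integral half_line
     (\<lambda>\<tau>. (?A * u powr (1/2) * (u / 2) powr (2 * real k + \<beta>)) * (\<tau> powr (2 * ?a - 1) * exp (- (s/2) * \<tau>\<^sup>2)))
     ((?A * u powr (1/2) * (u / 2) powr (2 * real k + \<beta>)) * (Gamma ?a / (2 * (s/2) powr ?a)))"
    using \<beta> s by (intro has_bochner_integral_mult_right gaussian_moment) auto
  moreover have "(?A * u powr (1/2) * (u / 2) powr (2 * real k + \<beta>)) * (\<tau> powr (2 * ?a - 1) * exp (- (s/2) * \<tau>\<^sup>2))
     = gauss \<beta> s \<tau> * hankel_term \<beta> k (\<tau> * u)" if "\<tau> > 0" for \<tau>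
  proof -
    have "2 * ?a - 1 = (\<beta> + 1/2) + (1/2 + (2 * real k + \<beta>))" by simp
    then have "\<tau> powr (2 * ?a - 1) = \<tau> powr (\<beta> + 1/2) * (\<tau> powr (1/2) * \<tau> powr (2 * real k + \<beta>))"
      by (simp only: powr_add)
    moreover have "(\<tau> * u / 2) powr (2 * real k + \<beta>) = \<tau> powr (2 * real k + \<beta>) * (u / 2) powr (2 * real k + \<beta>)"
      using that u by (simp add: powr_mult[symmetric])
    moreover have "(\<tau> * u) powr (1/2) = \<tau> powr (1/2) * u powr (1/2)"
      using that u by (simp add: powr_mult)
    ultimately show ?thesis
      by (simp add: gauss_def hankel_term_def)
  qed
  moreover have "(?A * u powr (1/2) * (u / 2) powr (2 * real k + \<beta>)) * (Gamma ?a / (2 * (s/2) powr ?a))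
      = s powr (- (\<beta> + 1)) * u powr (\<beta> + 1/2) * ((- (u\<^sup>2 / (2 * s))) ^ k / fact k)"
  proof -
    have 1: "u powr (1/2) * (u / 2) powr (2 * real k + \<beta>) = u powr (\<beta> + 1/2) * (2 powr (- \<beta>)) * (u\<^sup>2 / 4) ^ k"
    proof -
      have "(u / 2) powr (2 * real k + \<beta>) = (u / 2) powr (real (2 * k)) * (u / 2) powr \<beta>"
        by (simp add: powr_add)
      also have "(u / 2) powr (real (2 * k)) = ((u / 2)\<^sup>2) ^ k"
        using u by (subst powr_realpow) (auto simp: power_mult)
      also have "(u / 2) powr \<beta> = u powr \<beta> * 2 powr (- \<beta>)"
        using u by (simp add: powr_divide powr_minus_divide)
      finally show ?thesis
        by (simp add: powr_add power_divide)
    qed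
    moreover have 2: "2 * (s/2) powr ?a = s powr (\<beta> + 1) * 2 powr (- \<beta>) * (s / 2) ^ k"
    proof -
      have "(s/2) powr ?a = (s/2) powr (real k) * (s/2) powr (\<beta> + 1)"
        by (simp only: powr_add[symmetric] add.assoc)
      also have "(s/2) powr (real k) = (s/2) ^ k" using s by (simp add: powr_realpow)
      also have "(s/2) powr (\<beta> + 1) = s powr (\<beta> + 1) * 2 powr (- \<beta>) / 2"
        using s by (simp add: powr_divide powr_minus_divide powr_add)
      finally show ?thesis by (simp add: mult_ac)
    qed
    moreover have 3: "(-1) ^ k * (u\<^sup>2 / 4) ^ k / (s / 2) ^ k = (- (u\<^sup>2 / (2 * s))) ^ k"
      using s by (simp add: power_mult_distrib[symmetric] power_divide[symmetric])
    \<comment> \<open>the cancellation of \<open>Gamma ?a\<close> and of \<open>2 powr (- \<beta>)\<close>\<close>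
    moreover have "?A * X * (Gamma ?a / D) = ((-1) ^ k * Q / R) * U / (S * fact k)"
      if "X = U * T * Q" "D = S * T * R" "T > 0" for X D U T Q R S :: real
      using G that by (simp add: mult_ac)
    from this[OF 1 2] show ?thesis
      unfolding 3 powr_minus_divide using G by (simp add: mult_ac)
  qed
  ultimately show ?thesis
    by (subst has_bochner_integral_cong[OF refl _ refl]) auto
qed

lemma summable_AE_if_summable_integral_norm:
  fixes f :: "nat \<Rightarrow> 'a \<Rightarrow> real"
  assumes int: "\<And>k. integrable M (f k)" and sum: "summable (\<lambda>k. LINT x|M. norm (f k x))"
  shows "AE x in M. summable (\<lambda>k. norm (f k x))"
proof -
  have "(\<integral>\<^sup>+x. (\<Sum>k. ennreal (norm (f k x))) \<partial>M) = (\<Sum>k. \<integral>\<^sup>+x. ennreal (norm (f k x)) \<partial>M)"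
    using int by (intro nn_integral_suminf) auto
  also have "\<dots> = (\<Sum>k. ennreal (LINT x|M. norm (f k x)))"
    by (intro arg_cong[where f=suminf] ext nn_integral_eq_integral integrable_norm int) auto
  also have "\<dots> \<noteq> \<infinity>"
    unfolding infinity_ennreal_def by (rule ennreal_suminf_neq_top[OF sum]) simp
  finally have "AE x in M. (\<Sum>k. ennreal (norm (f k x))) \<noteq> \<infinity>"
    using int by (intro nn_integral_PInf_AE) auto
  then show ?thesis
    unfolding infinity_ennreal_def by eventually_elim (rule summable_suminf_not_top[OF norm_ge_zero])
qed

text \<open>
  Up to a factor the Hankel transform replaces the parameter \<open>s\<close> of a Gaussian by \<open>1/s\<close>:
  integrating the Bessel series term by term gives an exponential series.  With absolute
  values inside, the same computation gives the bound needed for Fubini's theorem.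
\<close>

lemma gauss_hankel_kernel:
  assumes \<beta>: "\<beta> > -1" and s: "s > 0" and u: "u > 0"
  shows "integrable half_line (\<lambda>\<tau>. gauss \<beta> s \<tau> * hankel_kernel \<beta> (\<tau> * u))"
    "(LINT \<tau>|half_line. gauss \<beta> s \<tau> * hankel_kernel \<beta> (\<tau> * u)) = s powr (- (\<beta> + 1)) * gauss \<beta> (1/s) u"
    "(LINT \<tau>|half_line. norm (gauss \<beta> s \<tau> * hankel_kernel \<beta> (\<tau> * u)))
      \<le> s powr (- (\<beta> + 1)) * u powr (\<beta> + 1/2) * exp (u\<^sup>2 / (2 * s))"
proof -
  let ?C = "s powr (- (\<beta> + 1)) * u powr (\<beta> + 1/2)"
  let ?f = "\<lambda>k \<tau>. gauss \<beta> s \<tau> * hankel_term \<beta> k (\<tau> * u)"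
  have int: "integrable half_line (?f k)" "(LINT \<tau>|half_line. ?f k \<tau>) = ?C * ((- (u\<^sup>2 / (2 * s))) ^ k / fact k)" for k
    using gauss_hankel_term[OF \<beta> s u, of k] by (auto simp: has_bochner_integral_iff)
  have norm: "(LINT \<tau>|half_line. norm (?f k \<tau>)) = ?C * ((u\<^sup>2 / (2 * s)) ^ k / fact k)" for k
  proof -
    have G: "Gamma (real k + \<beta> + 1) > 0" using \<beta> by (intro Gamma_real_pos) auto
    have "norm (?f k \<tau>) = (-1)^k * ?f k \<tau>" if "\<tau> > 0" for \<tau>
    proof -
      have "(-1)^k * hankel_term \<beta> k (\<tau> * u) \<ge> 0"
        using G by (simp add: hankel_term_def field_simps power_mult_distrib[symmetric])
      moreover have "\<bar>hankel_term \<beta> k (\<tau> * u)\<bar> = \<bar>(-1)^k * hankel_term \<beta> k (\<tau> * u)\<bar>"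
        by (simp add: abs_mult power_abs)
      ultimately have "\<bar>hankel_term \<beta> k (\<tau> * u)\<bar> = (-1)^k * hankel_term \<beta> k (\<tau> * u)"
        by linarith
      then show ?thesis
        using gauss_pos[OF that, of \<beta> s] by (simp add: abs_mult)
    qed
    then have "(LINT \<tau>|half_line. norm (?f k \<tau>)) = (LINT \<tau>|half_line. (-1)^k * ?f k \<tau>)"
      by (intro Bochner_Integration.integral_cong) auto
    also have "\<dots> = ?C * (((-1)^k * (- (u\<^sup>2 / (2 * s))) ^ k) / fact k)"
      unfolding integral_mult_right_zero int(2) by simp
    finally show ?thesis by (simp add: power_mult_distrib[symmetric])
  qed
  have exp_sums: "(\<lambda>k. x ^ k / fact k) sums exp x" for x :: real
    using exp_converges[of x] by (simp add: field_simps)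
  have sums_norm: "(\<lambda>k. LINT \<tau>|half_line. norm (?f k \<tau>)) sums (?C * exp (u\<^sup>2 / (2 * s)))"
    unfolding norm by (intro sums_mult exp_sums)
  then have summ: "summable (\<lambda>k. LINT \<tau>|half_line. norm (?f k \<tau>))" by (rule sums_summable)
  have AE_summ: "AE \<tau> in half_line. summable (\<lambda>k. norm (?f k \<tau>))"
    by (rule summable_AE_if_summable_integral_norm[OF int(1) summ])
  have eq: "AE \<tau> in half_line. gauss \<beta> s \<tau> * hankel_kernel \<beta> (\<tau> * u) = (\<Sum>k. ?f k \<tau>)"
  proof -
    have "AE \<tau> in half_line. \<tau> > 0" by (rule AE_I2) simp
    with AE_summ show ?thesis
    proof eventually_elim
      case (elim \<tau>)
      have "summable (\<lambda>k. ?f k \<tau>)" using elim(1) by (rule summable_norm_cancel)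
      then have "summable (\<lambda>k. hankel_term \<beta> k (\<tau> * u))"
        using gauss_pos[OF elim(2), of \<beta> s] by (simp add: summable_cmult_iff)
      then have "summable (\<lambda>k. (-1) ^ k / (fact k * Gamma (real k + \<beta> + 1)) * (\<tau> * u / 2) powr (2 * real k + \<beta>))"
        unfolding hankel_term_def using elim(2) u by (subst (asm) summable_cmult_iff) simp
      then have "hankel_kernel \<beta> (\<tau> * u) = (\<Sum>k. hankel_term \<beta> k (\<tau> * u))"
        unfolding hankel_kernel_def bessel_J_def hankel_term_def by (rule suminf_mult[symmetric])
      then show ?case
        using \<open>summable (\<lambda>k. hankel_term \<beta> k (\<tau> * u))\<close> by (simp add: suminf_mult)
    qed
  qed
  have kern_meas: "(\<lambda>\<tau>. gauss \<beta> s \<tau> * hankel_kernel \<beta> (\<tau> * u)) \<in> borel_measurable half_line"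
    by (rule borel_measurable_half_line) measurable
  have sum_int: "integrable half_line (\<lambda>\<tau>. \<Sum>k. ?f k \<tau>)"
    by (rule integrable_suminf[OF int(1) AE_summ summ])
  show "integrable half_line (\<lambda>\<tau>. gauss \<beta> s \<tau> * hankel_kernel \<beta> (\<tau> * u))"
    by (rule integrable_cong_AE_imp[OF sum_int kern_meas]) (use eq in auto)
  have "(LINT \<tau>|half_line. gauss \<beta> s \<tau> * hankel_kernel \<beta> (\<tau> * u)) = (LINT \<tau>|half_line. (\<Sum>k. ?f k \<tau>))"
    by (rule integral_cong_AE[OF kern_meas borel_measurable_integrable[OF sum_int] eq])
  also have "\<dots> = (\<Sum>k. ?C * ((- (u\<^sup>2 / (2 * s))) ^ k / fact k))"
    using integral_suminf[OF int(1) AE_summ summ] unfolding int(2) .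
  also have "\<dots> = ?C * exp (- (u\<^sup>2 / (2 * s)))"
    by (intro sums_unique[symmetric] sums_mult exp_sums)
  also have "\<dots> = s powr (- (\<beta> + 1)) * gauss \<beta> (1/s) u"
    by (simp add: gauss_def)
  finally show "(LINT \<tau>|half_line. gauss \<beta> s \<tau> * hankel_kernel \<beta> (\<tau> * u)) = s powr (- (\<beta> + 1)) * gauss \<beta> (1/s) u" .
  have norm_int: "integrable half_line (\<lambda>\<tau>. \<Sum>k. norm (?f k \<tau>))"
    by (rule integrable_suminf) (use int(1) AE_summ summ in auto)
  have "(LINT \<tau>|half_line. norm (gauss \<beta> s \<tau> * hankel_kernel \<beta> (\<tau> * u))) \<le> (LINT \<tau>|half_line. (\<Sum>k. norm (?f k \<tau>)))"
  proof (rule integral_mono_AE[OF _ norm_int])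
    show "integrable half_line (\<lambda>\<tau>. norm (gauss \<beta> s \<tau> * hankel_kernel \<beta> (\<tau> * u)))"
      by (rule integrable_norm) fact
    show "AE \<tau> in half_line. norm (gauss \<beta> s \<tau> * hankel_kernel \<beta> (\<tau> * u)) \<le> (\<Sum>k. norm (?f k \<tau>))"
      using eq AE_summ by eventually_elim (simp only: summable_norm)
  qed
  also have "\<dots> = (\<Sum>k. LINT \<tau>|half_line. norm (?f k \<tau>))"
    using integral_suminf[of half_line "\<lambda>k \<tau>. norm (?f k \<tau>)"] int(1) AE_summ summ by auto
  also have "\<dots> = ?C * exp (u\<^sup>2 / (2 * s))"
    using sums_norm by (rule sums_unique[symmetric])
  finally show "(LINT \<tau>|half_line. norm (gauss \<beta> s \<tau> * hankel_kernel \<beta> (\<tau> * u))) \<le> ?C * exp (u\<^sup>2 / (2 * s))" .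
qed

subsection \<open>The operator with eigenfunctions the Laguerre functions\<close>

text \<open>
  The Laguerre functions are the eigenfunctions of the Hankel transform, with eigenvalues
  \<open>(-1)^n\<close>.  Taken as a definition, this makes unitarity and involutivity immediate and leaves
  the agreement with the Bessel integral to be proved.
\<close>

definition hankel_op :: "real \<Rightarrow> (real \<Rightarrow> complex) \<Rightarrow> real \<Rightarrow> complex"
  where "hankel_op \<beta> g = (SOME h. L2_tendsto half_line
     (orthonormal_system.partial (laguerre_fun_scaled \<beta> 1)
       (\<lambda>n. (-1)^n * orthonormal_system.coeff half_line (laguerre_fun_scaled \<beta> 1) g n)) h)"

context
  fixes \<beta> :: real
  assumes \<beta>: "\<beta> > -1"
begin

interpretation orthonormal_basis half_line "laguerre_fun_scaled \<beta> 1"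
  by (rule laguerre_basis[OF \<beta>]) simp

lemma hankel_op_tendsto:
  assumes "g \<in> L2 half_line"
  shows "L2_tendsto half_line (partial (\<lambda>n. (-1)^n * coeff g n)) (hankel_op \<beta> g)"
  unfolding hankel_op_def
  by (rule someI_ex[OF ex_L2_series]) (use summable_coeff[OF assms] in \<open>simp add: norm_mult norm_power\<close>)

lemma hankel_op_L2: "g \<in> L2 half_line \<Longrightarrow> hankel_op \<beta> g \<in> L2 half_line"
  using hankel_op_tendsto by (simp add: L2_tendsto_def)

lemma coeff_hankel_op: "g \<in> L2 half_line \<Longrightarrow> coeff (hankel_op \<beta> g) n = (-1)^n * coeff g n"
  by (rule coeff_L2_series[OF hankel_op_tendsto])

lemma hankel_op_norm:
  assumes "g \<in> L2 half_line"
  shows "L2_norm half_line (hankel_op \<beta> g) = L2_norm half_line g"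
proof -
  have "(\<lambda>n. (cmod (coeff g n))\<^sup>2) sums (L2_norm half_line (hankel_op \<beta> g))\<^sup>2"
    using Parseval[OF hankel_op_L2[OF assms]] by (simp add: coeff_hankel_op[OF assms] norm_mult norm_power)
  from sums_unique2[OF this Parseval[OF assms]] show ?thesis by simp
qed

lemma hankel_op_involution:
  assumes "g \<in> L2 half_line"
  shows "AE x in half_line. hankel_op \<beta> (hankel_op \<beta> g) x = g x"
  by (intro eq_AE_if_coeff_eq hankel_op_L2 assms)
    (simp add: coeff_hankel_op hankel_op_L2 assms power_mult_distrib[symmetric] flip: mult.assoc)

lemma hankel_op_cong_AE:
  assumes "g \<in> L2 half_line" "h \<in> L2 half_line" "AE x in half_line. g x = h x"
  shows "AE x in half_line. hankel_op \<beta> g x = hankel_op \<beta> h x"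
  using coeff_cong_AE[OF assms]
  by (intro eq_AE_if_coeff_eq hankel_op_L2 assms) (simp add: coeff_hankel_op assms)

lemma coeff_linear:
  assumes "g \<in> L2 half_line" "h \<in> L2 half_line"
  shows "coeff (\<lambda>y. a * g y + b * h y) n = a * coeff g n + b * coeff h n"
  using coeff_add_scale[OF L2_scale[OF assms(1), of a] assms(2), of b n]
    coeff_add_scale[OF L2_zero assms(1), of a n] by (simp add: coeff_def[of "\<lambda>x. 0"])

lemma L2_unitary_hankel_op: "L2_unitary half_line (hankel_op \<beta>)"
  unfolding L2_unitary_def
proof (intro conjI ballI allI)
  fix g assume g: "g \<in> L2 half_line"
  show "hankel_op \<beta> g \<in> L2 half_line" "L2_norm half_line (hankel_op \<beta> g) = L2_norm half_line g"
    by (rule hankel_op_L2[OF g], rule hankel_op_norm[OF g])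
  fix h a b assume h: "h \<in> L2 half_line"
  show "AE x in half_line. hankel_op \<beta> (\<lambda>y. a * g y + b * h y) x = a * hankel_op \<beta> g x + b * hankel_op \<beta> h x"
    by (intro eq_AE_if_coeff_eq hankel_op_L2 L2_add L2_scale g h)
      (simp add: coeff_hankel_op coeff_linear hankel_op_L2 L2_add L2_scale g h algebra_simps)
next
  fix h assume h: "h \<in> L2 half_line"
  show "\<exists>g\<in>L2 half_line. AE x in half_line. hankel_op \<beta> g x = h x"
    using hankel_op_involution[OF h] hankel_op_L2[OF h] by blast
qed

text \<open>
  The \<open>n\<close>-th coefficient contains the factor \<open>((s - 1) / (s + 1)) ^ n\<close>, which changes by the
  sign \<open>(-1)^n\<close> when \<open>s\<close> is replaced by \<open>1/s\<close>.
\<close>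

lemma coeff_gauss_inverse:
  assumes s: "s > 0"
  shows "complex_of_real (s powr (- (\<beta> + 1))) * coeff (\<lambda>r. complex_of_real (gauss \<beta> (1/s) r)) n
    = (-1)^n * coeff (\<lambda>r. complex_of_real (gauss \<beta> s r)) n"
proof -
  have "((1/s + 1) / 2) powr (\<beta> + 1) = ((s + 1) / 2) powr (\<beta> + 1) * s powr (- (\<beta> + 1))"
  proof -
    have "(1/s + 1) / 2 = (s + 1) / 2 / s" using s by (simp add: field_simps)
    moreover have "((s + 1) / 2 / s) powr (\<beta> + 1) = ((s + 1) / 2) powr (\<beta> + 1) / s powr (\<beta> + 1)"
      by (rule powr_divide)
    ultimately show ?thesis by (simp only: powr_minus_divide) simp
  qed
  moreover have "(1/s - 1) / (1/s + 1) = (-1) * ((s - 1) / (s + 1))"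
  proof -
    have "1/s - 1 = - (s - 1) / s" "1/s + 1 = (s + 1) / s" using s by (simp_all add: field_simps)
    then show ?thesis using s by (simp only: divide_divide_eq_right divide_divide_eq_left) simp
  qed
  moreover have "S * (K / (2 * f * (Y * S)) * ((-1) * X) ^ n) = (-1)^n * (K / (2 * f * Y) * X ^ n)"
    if "S > 0" for S K f Y X :: real
    unfolding power_mult_distrib using that by (simp add: mult_ac)
  moreover have "s powr (- (\<beta> + 1)) > 0" using s by simp
  ultimately have "s powr (- (\<beta> + 1)) * (laguerre_norm_factor \<beta> n * 1 powr ((\<beta> + 1) / 2) * Gamma (real n + \<beta> + 1)
        / (2 * fact n * ((1/s + 1) / 2) powr (\<beta> + 1)) * ((1/s - 1) / (1/s + 1)) ^ n)
     = (-1)^n * (laguerre_norm_factor \<beta> n * 1 powr ((\<beta> + 1) / 2) * Gamma (real n + \<beta> + 1)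
        / (2 * fact n * ((s + 1) / 2) powr (\<beta> + 1)) * ((s - 1) / (s + 1)) ^ n)"
    by (simp only:)
  from arg_cong[OF this, of complex_of_real] s show ?thesis
    unfolding coeff_gauss_laguerre[OF \<beta> zero_less_one s] coeff_gauss_laguerre[OF \<beta> zero_less_one divide_pos_pos[OF zero_less_one s]]
    by (simp only: of_real_mult of_real_power of_real_minus of_real_1)
qed

text \<open>
  Against Gaussians, \<open>hankel_op\<close> acts exactly as the Hankel kernel does by \<open>gauss_hankel_kernel\<close>.
\<close>

lemma hankel_op_gauss:
  assumes g: "g \<in> L2 half_line" and s: "s > 0"
  shows "(LINT r|half_line. hankel_op \<beta> g r * complex_of_real (gauss \<beta> s r))
    = complex_of_real (s powr (- (\<beta> + 1))) * (LINT r|half_line. g r * complex_of_real (gauss \<beta> (1/s) r))"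
proof -
  have "(\<lambda>n. (-1)^n * coeff g n * coeff (\<lambda>r. complex_of_real (gauss \<beta> s r)) n) sums
     (LINT r|half_line. hankel_op \<beta> g r * complex_of_real (gauss \<beta> s r))"
    by (rule inner_L2_series[OF hankel_op_tendsto[OF g] gauss_L2[OF \<beta> s]])
  moreover have "(\<lambda>n. complex_of_real (s powr (- (\<beta> + 1))) * (coeff g n * coeff (\<lambda>r. complex_of_real (gauss \<beta> (1/s) r)) n)) sums
     (complex_of_real (s powr (- (\<beta> + 1))) * (LINT r|half_line. g r * complex_of_real (gauss \<beta> (1/s) r)))"
    using s by (intro sums_mult inner_L2_series expansion g gauss_L2 \<beta>) simp
  moreover have "complex_of_real (s powr (- (\<beta> + 1))) * (coeff g n * coeff (\<lambda>r. complex_of_real (gauss \<beta> (1/s) r)) n)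
     = (-1)^n * coeff g n * coeff (\<lambda>r. complex_of_real (gauss \<beta> s r)) n" for n
  proof -
    have "complex_of_real (s powr (- (\<beta> + 1))) * (coeff g n * coeff (\<lambda>r. complex_of_real (gauss \<beta> (1/s) r)) n)
       = coeff g n * (complex_of_real (s powr (- (\<beta> + 1))) * coeff (\<lambda>r. complex_of_real (gauss \<beta> (1/s) r)) n)"
      by (simp only: mult_ac)
    then show ?thesis unfolding coeff_gauss_inverse[OF s] by (simp only: mult_ac)
  qed
  ultimately show ?thesis by (simp only: sums_unique2)
qed

end

subsection \<open>The integral transform of test functions\<close>

lemma sigma_finite_half_line: "sigma_finite_measure half_line"
proof (rule sigma_finite_measure_restrict_space)
  show "sigma_finite_measure (lebesgue :: real measure)"
  proof
    obtain A :: "nat \<Rightarrow> real set" where A: "range A \<subseteq> sets lborel" "(\<Union>i. A i) = space lborel" "\<And>i. emeasure lborel (A i) \<noteq> \<infinity>"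
      using lborel.sigma_finite by blast
    then show "\<exists>A. countable A \<and> A \<subseteq> sets lebesgue \<and> \<Union> A = space (lebesgue :: real measure) \<and> (\<forall>a\<in>A. emeasure lebesgue a \<noteq> \<infinity>)"
      by (intro exI[of _ "range A"]) auto
  qed
qed simp

interpretation half_line: sigma_finite_measure half_line
  by (rule sigma_finite_half_line)

interpretation half_line_pair: pair_sigma_finite half_line half_line ..

lemma fst_half_line_measurable [measurable]: "fst \<in> borel_measurable (half_line \<Otimes>\<^sub>M M)"
  by (rule measurable_compose[OF measurable_fst]) (rule borel_measurable_half_line, simp)

lemma snd_half_line_measurable [measurable]: "snd \<in> borel_measurable (M \<Otimes>\<^sub>M half_line)"
  by (rule measurable_compose[OF measurable_snd]) (rule borel_measurable_half_line, simp)

text \<open>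
  Fubini's theorem lets the kernel act on the Gaussian instead of \<open>\<phi>\<close>.  The assumed
  integrability of \<open>\<phi>\<close> against \<open>exp (u\<^sup>2 / (2 s))\<close> matches the bound with absolute values in
  \<open>gauss_hankel_kernel\<close>.
\<close>

lemma hankel_integral_gauss:
  assumes \<beta>: "\<beta> > -1" and s: "s > 0"
    and \<phi>: "\<phi> \<in> borel_measurable borel"
    and int: "integrable half_line (\<lambda>u. \<phi> u * complex_of_real (u powr (\<beta> + 1/2) * exp (u\<^sup>2 / (2 * s))))"
  shows "integrable half_line (\<lambda>\<tau>. hankel_integral \<beta> \<phi> \<tau> * complex_of_real (gauss \<beta> s \<tau>))"
    "(LINT \<tau>|half_line. hankel_integral \<beta> \<phi> \<tau> * complex_of_real (gauss \<beta> s \<tau>))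
      = complex_of_real (s powr (- (\<beta> + 1))) * (LINT u|half_line. \<phi> u * complex_of_real (gauss \<beta> (1/s) u))"
proof -
  let ?k = "\<lambda>\<tau> u. gauss \<beta> s \<tau> * hankel_kernel \<beta> (\<tau> * u)"
  let ?F = "\<lambda>u \<tau>. \<phi> u * complex_of_real (?k \<tau> u)"
  have F_meas [measurable]: "case_prod ?F \<in> borel_measurable (half_line \<Otimes>\<^sub>M half_line)"
    using \<phi> by measurable
  have norm_F: "(LINT \<tau>|half_line. norm (?F u \<tau>)) = norm (\<phi> u) * (LINT \<tau>|half_line. norm (?k \<tau> u))" for u
    by (simp add: norm_mult abs_mult)
  have prod_int: "integrable (half_line \<Otimes>\<^sub>M half_line) (case_prod ?F)"
  proof (rule half_line_pair.Fubini_integrable[OF F_meas])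
    show "AE u in half_line. integrable half_line (\<lambda>\<tau>. case_prod ?F (u, \<tau>))"
    proof (rule AE_I2)
      fix u :: real assume "u \<in> space half_line"
      then have "integrable half_line (\<lambda>\<tau>. ?k \<tau> u)"
        using gauss_hankel_kernel(1)[OF \<beta> s, of u] by simp
      then show "integrable half_line (\<lambda>\<tau>. case_prod ?F (u, \<tau>))"
        unfolding case_prod_conv by (intro integrable_mult_right integrable_of_real)
    qed
    show "integrable half_line (\<lambda>u. LINT \<tau>|half_line. norm (case_prod ?F (u, \<tau>)))"
      unfolding case_prod_conv
    proof (rule Bochner_Integration.integrable_bound[OF integrable_mult_right[OF integrable_norm[OF int], of "s powr (- (\<beta> + 1))"]])
      show "(\<lambda>u. LINT \<tau>|half_line. norm (?F u \<tau>)) \<in> borel_measurable half_line"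
        by (rule half_line.borel_measurable_lebesgue_integral) measurable
      show "AE u in half_line. norm (LINT \<tau>|half_line. norm (?F u \<tau>))
         \<le> norm (s powr (- (\<beta> + 1)) * norm (\<phi> u * complex_of_real (u powr (\<beta> + 1/2) * exp (u\<^sup>2 / (2 * s)))))"
      proof (rule AE_I2)
        fix u :: real assume "u \<in> space half_line"
        then have u: "u > 0" by simp
        have "norm (\<phi> u) * (LINT \<tau>|half_line. norm (?k \<tau> u))
            \<le> norm (\<phi> u) * (s powr (- (\<beta> + 1)) * u powr (\<beta> + 1/2) * exp (u\<^sup>2 / (2 * s)))"
          by (intro mult_left_mono gauss_hankel_kernel(3) \<beta> s u) simp
        then show "norm (LINT \<tau>|half_line. norm (?F u \<tau>))
           \<le> norm (s powr (- (\<beta> + 1)) * norm (\<phi> u * complex_of_real (u powr (\<beta> + 1/2) * exp (u\<^sup>2 / (2 * s)))))"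
          unfolding norm_F by (simp add: norm_mult abs_mult mult_ac)
      qed
    qed
  qed
  have inner: "(LINT u|half_line. ?F u \<tau>) = hankel_integral \<beta> \<phi> \<tau> * complex_of_real (gauss \<beta> s \<tau>)" for \<tau>
  proof -
    have "(LINT u|half_line. ?F u \<tau>) = (LINT u|half_line. \<phi> u * complex_of_real (hankel_kernel \<beta> (\<tau> * u)) * complex_of_real (gauss \<beta> s \<tau>))"
      by (simp add: mult_ac)
    also have "\<dots> = hankel_integral \<beta> \<phi> \<tau> * complex_of_real (gauss \<beta> s \<tau>)"
      unfolding integral_mult_left_zero hankel_integral_def hankel_kernel_def ..
    finally show ?thesis .
  qed
  show "integrable half_line (\<lambda>\<tau>. hankel_integral \<beta> \<phi> \<tau> * complex_of_real (gauss \<beta> s \<tau>))"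
    using half_line_pair.integrable_snd[OF prod_int] unfolding inner .
  have "(LINT \<tau>|half_line. hankel_integral \<beta> \<phi> \<tau> * complex_of_real (gauss \<beta> s \<tau>)) = (LINT u|half_line. LINT \<tau>|half_line. ?F u \<tau>)"
    using half_line_pair.Fubini_integral[OF prod_int] unfolding inner .
  also have "\<dots> = (LINT u|half_line. complex_of_real (s powr (- (\<beta> + 1))) * (\<phi> u * complex_of_real (gauss \<beta> (1/s) u)))"
  proof (intro Bochner_Integration.integral_cong refl)
    fix u :: real assume "u \<in> space half_line"
    then have u: "u > 0" by simp
    have "(LINT \<tau>|half_line. ?F u \<tau>) = \<phi> u * complex_of_real (LINT \<tau>|half_line. ?k \<tau> u)"
      unfolding integral_mult_right_zero integral_complex_of_real ..
    also have "\<dots> = complex_of_real (s powr (- (\<beta> + 1))) * (\<phi> u * complex_of_real (gauss \<beta> (1/s) u))"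
      unfolding gauss_hankel_kernel(2)[OF \<beta> s u] by (simp add: mult_ac)
    finally show "(LINT \<tau>|half_line. ?F u \<tau>) = complex_of_real (s powr (- (\<beta> + 1))) * (\<phi> u * complex_of_real (gauss \<beta> (1/s) u))" .
  qed
  also have "\<dots> = complex_of_real (s powr (- (\<beta> + 1))) * (LINT u|half_line. \<phi> u * complex_of_real (gauss \<beta> (1/s) u))"
    by (rule integral_mult_right_zero)
  finally show "(LINT \<tau>|half_line. hankel_integral \<beta> \<phi> \<tau> * complex_of_real (gauss \<beta> s \<tau>))
      = complex_of_real (s powr (- (\<beta> + 1))) * (LINT u|half_line. \<phi> u * complex_of_real (gauss \<beta> (1/s) u))" .
qed

text \<open>
  The difference of the two sides has vanishing integrals against all Gaussians.  Integrability
  against Gaussians takes the place of asymptotics of Bessel functions.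
\<close>

lemma hankel_op_eq_hankel_integral:
  assumes \<beta>: "\<beta> > -1" and \<phi>: "\<phi> \<in> borel_measurable borel" "\<phi> \<in> L2 half_line"
    and int: "\<And>s. s > 0 \<Longrightarrow> integrable half_line (\<lambda>u. \<phi> u * complex_of_real (u powr (\<beta> + 1/2) * exp (u\<^sup>2 / (2 * s))))"
  shows "AE \<tau> in half_line. hankel_op \<beta> \<phi> \<tau> = hankel_integral \<beta> \<phi> \<tau>"
proof -
  have 1: "integrable half_line (\<lambda>\<tau>. hankel_op \<beta> \<phi> \<tau> * complex_of_real (gauss \<beta> s \<tau>))" if "s > 0" for s
    by (intro L2_mult_integrable hankel_op_L2 gauss_L2 \<beta> \<phi> that)
  have 2: "integrable half_line (\<lambda>\<tau>. hankel_integral \<beta> \<phi> \<tau> * complex_of_real (gauss \<beta> s \<tau>))" if "s > 0" for s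
    by (rule hankel_integral_gauss[OF \<beta> that \<phi>(1) int[OF that]])
  have "AE \<tau> in half_line. hankel_op \<beta> \<phi> \<tau> - hankel_integral \<beta> \<phi> \<tau> = 0"
  proof (rule zero_AE_if_gauss_integrals_zero)
    show "integrable half_line (\<lambda>\<tau>. (hankel_op \<beta> \<phi> \<tau> - hankel_integral \<beta> \<phi> \<tau>) * complex_of_real (gauss \<beta> 1 \<tau>))"
      unfolding left_diff_distrib by (intro Bochner_Integration.integrable_diff 1 2) auto
    fix s :: real assume s: "s > 0"
    show "(LINT \<tau>|half_line. (hankel_op \<beta> \<phi> \<tau> - hankel_integral \<beta> \<phi> \<tau>) * complex_of_real (gauss \<beta> s \<tau>)) = 0"
      unfolding left_diff_distrib Bochner_Integration.integral_diff[OF 1[OF s] 2[OF s]]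
      by (simp add: hankel_op_gauss[OF \<beta> \<phi>(2) s] hankel_integral_gauss(2)[OF \<beta> s \<phi>(1) int[OF s]])
  qed
  then show ?thesis by simp
qed

lemma test_function_times_continuous_integrable:
  fixes g :: "real \<Rightarrow> complex"
  assumes K: "compact K" "K \<subseteq> {0<..}" and \<phi>: "continuous_on UNIV \<phi>" "\<And>x. x \<notin> K \<Longrightarrow> \<phi> x = 0"
    and g: "continuous_on {0<..} g"
  shows "integrable half_line (\<lambda>x. \<phi> x * g x)"
proof -
  have "continuous_on K (\<lambda>x. \<phi> x * g x)"
    using K(2) \<phi>(1) g by (intro continuous_on_mult) (auto intro: continuous_on_subset)
  from borel_integrable_compact[OF K(1) this]
  have "integrable lborel (\<lambda>x. indicator K x *\<^sub>R (\<phi> x * g x))" .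
  also have "(\<lambda>x. indicator K x *\<^sub>R (\<phi> x * g x)) = (\<lambda>x. \<phi> x * g x)"
    using \<phi>(2) by (auto simp: indicator_def fun_eq_iff)
  finally have "integrable lebesgue (\<lambda>x. \<phi> x * g x)"
    by (subst integrable_completion) auto
  then show ?thesis
    unfolding half_line_set_integrable set_integrable_def by (intro integrable_mult_indicator) auto
qed

lemma
  assumes "test_function \<phi>"
  shows test_function_continuous: "continuous_on UNIV \<phi>"
    and test_function_L2: "\<phi> \<in> L2 half_line"
proof -
  obtain D K where D: "D 0 = \<phi>" "\<And>k x. (D k has_vector_derivative D (Suc k) x) (at x)"
    and K: "compact K" "K \<subseteq> {0<..}" "\<And>x. x \<notin> K \<Longrightarrow> \<phi> x = 0"
    using assms unfolding test_function_def by blast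
  show cont: "continuous_on UNIV \<phi>"
    using has_vector_derivative_continuous[OF D(2)[of 0]] D(1)
    by (auto intro!: continuous_at_imp_continuous_on)
  have "integrable half_line (\<lambda>x. \<phi> x * cnj (\<phi> x))"
    by (rule test_function_times_continuous_integrable[OF K(1,2) cont K(3)])
      (auto intro!: continuous_intros continuous_on_subset[OF cont])
  then have "integrable half_line (\<lambda>x. Re (\<phi> x * cnj (\<phi> x)))" by (rule integrable_Re)
  moreover have "Re (\<phi> x * cnj (\<phi> x)) = (cmod (\<phi> x))\<^sup>2" for x
    by (simp add: complex_norm_square[symmetric] del: of_real_power times_complex.sel)
  ultimately show "\<phi> \<in> L2 half_line"
    by (intro L2I borel_measurable_half_line borel_measurable_continuous_onI cont) simp
qed

lemma hankel_op_test_function: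
  assumes \<beta>: "\<beta> > -1" and \<phi>: "test_function \<phi>"
  shows "AE \<tau> in half_line. hankel_op \<beta> \<phi> \<tau> = hankel_integral \<beta> \<phi> \<tau>"
proof (rule hankel_op_eq_hankel_integral[OF \<beta> _ test_function_L2[OF \<phi>]])
  show "\<phi> \<in> borel_measurable borel"
    by (rule borel_measurable_continuous_onI[OF test_function_continuous[OF \<phi>]])
  obtain K where K: "compact K" "K \<subseteq> {0<..}" "\<And>x. x \<notin> K \<Longrightarrow> \<phi> x = 0"
    using \<phi> unfolding test_function_def by blast
  show "integrable half_line (\<lambda>u. \<phi> u * complex_of_real (u powr (\<beta> + 1/2) * exp (u\<^sup>2 / (2 * s))))" if "s > 0" for s
    by (rule test_function_times_continuous_integrable[OF K(1,2) test_function_continuous[OF \<phi>] K(3)])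
      (use that in \<open>auto intro!: continuous_intros\<close>)
qed

subsection \<open>Bump functions and uniqueness of the Hankel transform\<close>

text \<open>
  The derivatives of \<open>exp (-c / ((x - a) * (b - x)))\<close> are this function times polynomials in
  \<open>x\<close> and powers of \<open>1 / ((x - a) * (b - x))\<close>, a class closed under differentiation.
\<close>

definition bump :: "real \<Rightarrow> real \<Rightarrow> real \<Rightarrow> real poly \<Rightarrow> nat \<Rightarrow> real \<Rightarrow> real"
  where "bump a b c P m x = (if a < x \<and> x < b then
     poly P x * inverse ((x - a) * (b - x)) ^ m * exp (- c * inverse ((x - a) * (b - x))) else 0)"

lemma power_le_fact_exp:
  fixes x :: real assumes "x \<ge> 0" shows "x ^ n \<le> fact n * exp x"
proof -
  have s: "(\<lambda>k. x ^ k / fact k) sums exp x"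
    using exp_converges[of x] by (simp add: field_simps)
  have "sum (\<lambda>k. x ^ k / fact k) {n} \<le> (\<Sum>k. x ^ k / fact k)"
    using assms by (intro sum_le_suminf sums_summable[OF s]) auto
  then show ?thesis using sums_unique[OF s] by (simp add: field_simps)
qed

text \<open>
  The exponential decay beats every power of \<open>1 / ((x - a) * (b - x))\<close>.  A bound of second order
  at the end points is what is needed for a vanishing derivative there.
\<close>

lemma bump_quadratic_bound:
  assumes c: "c > 0" and ab: "a < b"
  shows "\<exists>C. \<forall>x. \<bar>bump a b c P m x\<bar> \<le> C * (x - a)\<^sup>2 \<and> \<bar>bump a b c P m x\<bar> \<le> C * (x - b)\<^sup>2"
proof -
  have "compact (poly P ` {a..b})"
    by (intro compact_continuous_image continuous_intros) auto
  then obtain B where "\<forall>y\<in>poly P ` {a..b}. norm y \<le> B"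
    using compact_imp_bounded bounded_iff by blast
  then have B: "\<And>x. x \<in> {a..b} \<Longrightarrow> \<bar>poly P x\<bar> \<le> B" by simp
  have "B \<ge> 0" using B[of a] ab by auto
  define E where "E = B * (fact (m + 2) / c ^ (m + 2))"
  have "E \<ge> 0" using \<open>B \<ge> 0\<close> c by (simp add: E_def)
  have key: "\<bar>bump a b c P m x\<bar> \<le> E * ((x - a) * (b - x))\<^sup>2" if x: "a < x" "x < b" for x
  proof -
    define y where "y = inverse ((x - a) * (b - x))"
    have y: "y > 0" using x by (simp add: y_def)
    have "(c * y) ^ (m + 2) \<le> fact (m + 2) * exp (c * y)"
      using c y by (intro power_le_fact_exp) simp
    then have k1: "y ^ m * exp (- c * y) \<le> fact (m + 2) / c ^ (m + 2) * (inverse y)\<^sup>2"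
      using c y by (simp add: exp_minus field_simps power_mult_distrib power_add power2_eq_square)
    have "\<bar>poly P x\<bar> * (y ^ m * exp (- c * y)) \<le> B * (fact (m + 2) / c ^ (m + 2) * (inverse y)\<^sup>2)"
      by (rule mult_mono[OF B k1 \<open>B \<ge> 0\<close>]) (use x y in auto)
    then show ?thesis
      using x y by (simp add: bump_def y_def[symmetric] E_def abs_mult) (simp add: y_def)
  qed
  show ?thesis
  proof (intro exI allI conjI)
    fix x
    have le: "((x - a) * (b - x))\<^sup>2 \<le> (b - a)\<^sup>2 * (x - a)\<^sup>2" "((x - a) * (b - x))\<^sup>2 \<le> (b - a)\<^sup>2 * (x - b)\<^sup>2" if "a < x" "x < b"
    proof -
      have "(b - x)\<^sup>2 \<le> (b - a)\<^sup>2" "(x - a)\<^sup>2 \<le> (b - a)\<^sup>2" using that by (auto intro!: power_mono)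
      then have "(b - x)\<^sup>2 * (x - a)\<^sup>2 \<le> (b - a)\<^sup>2 * (x - a)\<^sup>2" "(x - a)\<^sup>2 * (x - b)\<^sup>2 \<le> (b - a)\<^sup>2 * (x - b)\<^sup>2"
        by (auto intro!: mult_right_mono)
      then show "((x - a) * (b - x))\<^sup>2 \<le> (b - a)\<^sup>2 * (x - a)\<^sup>2" "((x - a) * (b - x))\<^sup>2 \<le> (b - a)\<^sup>2 * (x - b)\<^sup>2"
        by (simp_all add: power_mult_distrib power2_commute[of b x] mult.commute)
    qed
    show "\<bar>bump a b c P m x\<bar> \<le> (E * (b - a)\<^sup>2) * (x - a)\<^sup>2"
    proof (cases "a < x \<and> x < b")
      case True
      then show ?thesis
        using order_trans[OF key mult_left_mono[OF le(1) \<open>E \<ge> 0\<close>]] by (simp add: mult.assoc)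
    qed (use \<open>E \<ge> 0\<close> in \<open>auto simp: bump_def\<close>)
    show "\<bar>bump a b c P m x\<bar> \<le> (E * (b - a)\<^sup>2) * (x - b)\<^sup>2"
    proof (cases "a < x \<and> x < b")
      case True
      then show ?thesis
        using order_trans[OF key mult_left_mono[OF le(2) \<open>E \<ge> 0\<close>]] by (simp add: mult.assoc)
    qed (use \<open>E \<ge> 0\<close> in \<open>auto simp: bump_def\<close>)
  qed
qed

lemma has_derivative_zero_if_quadratic_bound:
  fixes f :: "real \<Rightarrow> real"
  assumes "\<And>x. \<bar>f x\<bar> \<le> C * (x - a)\<^sup>2"
  shows "(f has_field_derivative 0) (at a)"
proof -
  have fa: "f a = 0" using assms[of a] by simp
  have "(\<lambda>y. (f y - f a) / (y - a)) \<midarrow>a\<rightarrow> 0"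
  proof (rule Lim_null_comparison)
    show "\<forall>\<^sub>F y in at a. norm ((f y - f a) / (y - a)) \<le> C * \<bar>y - a\<bar>"
      using eventually_neq_at_within[of a]
    proof eventually_elim
      case (elim y)
      have "\<bar>f y\<bar> \<le> (C * \<bar>y - a\<bar>) * \<bar>y - a\<bar>"
        using assms[of y] by (simp add: power2_eq_square mult.assoc flip: abs_mult)
      then show ?case using elim by (simp add: fa pos_divide_le_eq)
    qed
    have "(\<lambda>y. C * \<bar>y - a\<bar>) \<midarrow>a\<rightarrow> C * \<bar>a - a\<bar>" by (intro tendsto_intros)
    then show "(\<lambda>y. C * \<bar>y - a\<bar>) \<midarrow>a\<rightarrow> 0" by simp
  qed
  then show ?thesis by (simp add: has_field_derivative_iff)
qed

text \<open>
  With \<open>q = (x - a) * (b - x)\<close>, the derivative of \<open>P / q^m * exp (- c / q)\<close> is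
  \<open>(P' q\<^sup>2 - m P q' q + c P q') / q^(m + 2) * exp (- c / q)\<close>.
\<close>

definition bump_deriv_poly :: "real \<Rightarrow> real \<Rightarrow> real \<Rightarrow> nat \<Rightarrow> real poly \<Rightarrow> real poly"
  where "bump_deriv_poly a b c m P = (let q = [:-a, 1:] * [:b, -1:] in
     pderiv P * q\<^sup>2 - of_nat m * P * pderiv q * q + [:c:] * P * pderiv q)"

lemma bump_has_derivative:
  assumes c: "c > 0" and ab: "a < b"
  shows "(bump a b c P m has_field_derivative bump a b c (bump_deriv_poly a b c m P) (m + 2) x) (at x)"
proof -
  obtain C where C: "\<And>x. \<bar>bump a b c P m x\<bar> \<le> C * (x - a)\<^sup>2" "\<And>x. \<bar>bump a b c P m x\<bar> \<le> C * (x - b)\<^sup>2"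
    using bump_quadratic_bound[OF c ab, of P m] by blast
  consider "x = a \<or> x = b" | "a < x" "x < b" | "x < a" | "x > b" by linarith
  then show ?thesis
  proof cases
    case 1
    then show ?thesis
      using has_derivative_zero_if_quadratic_bound[OF C(1)] has_derivative_zero_if_quadratic_bound[OF C(2)]
      by (auto simp: bump_def[of _ _ _ "bump_deriv_poly _ _ _ _ _"])
  next
    case 2
    define q where "q = [:-a, 1:] * [:b, -1:]"
    have q: "poly q z = (z - a) * (b - z)" for z by (simp add: q_def algebra_simps)
    have q0: "poly q x > 0" using 2 by (simp add: q)
    define y where "y = inverse (poly q x)"
    have y1: "poly q x * y = 1" using q0 by (simp add: y_def)
    have "((\<lambda>z. poly P z * inverse (poly q z) ^ m * exp (- c * inverse (poly q z))) has_field_derivative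
       poly (pderiv P) x * y ^ m * exp (- c * y) + poly P x * (real m * y ^ (m - 1) * (- (poly (pderiv q) x) * y\<^sup>2)) * exp (- c * y)
         + poly P x * y ^ m * (exp (- c * y) * (c * poly (pderiv q) x * y\<^sup>2))) (at x)"
      using q0 by (auto intro!: derivative_eq_intros simp: y_def power2_eq_square algebra_simps)
    moreover have "poly (pderiv P) x * y ^ m * exp (- c * y) + poly P x * (real m * y ^ (m - 1) * (- (poly (pderiv q) x) * y\<^sup>2)) * exp (- c * y)
         + poly P x * y ^ m * (exp (- c * y) * (c * poly (pderiv q) x * y\<^sup>2)) =
         poly (bump_deriv_poly a b c m P) x * y ^ (m + 2) * exp (- c * y)"
    proof -
      have "poly (bump_deriv_poly a b c m P) x * y ^ (m + 2) =
         poly (pderiv P) x * y ^ m * (poly q x * y)\<^sup>2 - real m * poly P x * poly (pderiv q) x * y ^ (m + 1) * (poly q x * y)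
           + c * poly P x * poly (pderiv q) x * y ^ (m + 2)"
        unfolding bump_deriv_poly_def Let_def q_def[symmetric]
        by (simp add: algebra_simps power_mult_distrib power_add power2_eq_square of_nat_poly)
      moreover have "real m * y ^ (m - 1) * y\<^sup>2 = real m * y ^ (m + 1)"
        by (cases m) (simp_all add: power2_eq_square)
      moreover have "poly P x * (real m * y ^ (m - 1) * (- (poly (pderiv q) x) * y\<^sup>2)) = - (poly P x * poly (pderiv q) x * (real m * y ^ (m - 1) * y\<^sup>2))"
        by (simp add: mult_ac)
      ultimately show ?thesis
        unfolding y1 by (simp only:) (simp add: algebra_simps power2_eq_square)
    qed
    ultimately have "((\<lambda>z. poly P z * inverse (poly q z) ^ m * exp (- c * inverse (poly q z))) has_field_derivative
         poly (bump_deriv_poly a b c m P) x * y ^ (m + 2) * exp (- c * y)) (at x)"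
      by simp
    then have "(bump a b c P m has_field_derivative poly (bump_deriv_poly a b c m P) x * y ^ (m + 2) * exp (- c * y)) (at x)"
      by (rule has_field_derivative_transform_within_open[of _ _ _ "{a<..<b}"]) (use 2 in \<open>auto simp: bump_def q\<close>)
    then show ?thesis using 2 by (simp add: bump_def[of _ _ _ "bump_deriv_poly _ _ _ _ _"] y_def q)
  next
    case 3
    have "(bump a b c P m has_field_derivative 0) (at x)"
      by (rule has_field_derivative_transform_within_open[of "\<lambda>_. 0" _ _ "{..<a}"]) (use 3 in \<open>auto simp: bump_def\<close>)
    then show ?thesis using 3 by (simp add: bump_def[of _ _ _ "bump_deriv_poly _ _ _ _ _"])
  next
    case 4
    have "(bump a b c P m has_field_derivative 0) (at x)"
      by (rule has_field_derivative_transform_within_open[of "\<lambda>_. 0" _ _ "{b<..}"]) (use 4 in \<open>auto simp: bump_def\<close>)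
    then show ?thesis using 4 by (simp add: bump_def[of _ _ _ "bump_deriv_poly _ _ _ _ _"])
  qed
qed

lemma test_function_bump:
  assumes c: "c > 0" and ab: "0 < a" "a < b"
  shows "test_function (\<lambda>x. complex_of_real (bump a b c P m x))"
proof -
  define Q where "Q = rec_nat P (\<lambda>k R. bump_deriv_poly a b c (m + 2 * k) R)"
  have Q: "Q 0 = P" "Q (Suc k) = bump_deriv_poly a b c (m + 2 * k) (Q k)" for k
    by (simp_all add: Q_def)
  define D where "D k x = complex_of_real (bump a b c (Q k) (m + 2 * k) x)" for k x
  have "(D k has_vector_derivative D (Suc k) x) (at x)" for k x
  proof -
    have "(bump a b c (Q k) (m + 2 * k) has_field_derivative bump a b c (Q (Suc k)) (m + 2 * Suc k) x) (at x)"
      using bump_has_derivative[OF c ab(2), of "Q k" "m + 2 * k" x] by (simp add: Q)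
    then show ?thesis
      unfolding D_def[abs_def] by (simp add: has_vector_derivative_complex_iff)
  qed
  moreover have "D 0 = (\<lambda>x. complex_of_real (bump a b c P m x))"
    by (simp add: D_def[abs_def] Q)
  ultimately show ?thesis
    unfolding test_function_def using ab
    by (intro conjI exI[of _ D] exI[of _ "{a..b}"]) (auto simp: bump_def)
qed

text \<open>
  As \<open>c\<close> decreases to zero, the bump functions \<open>exp (- c / ((x - a) * (b - x)))\<close> increase to the
  indicator function of the interval from \<open>a\<close> to \<open>b\<close>.
\<close>

lemma zero_AE_if_orthogonal_to_test_functions:
  assumes h: "h \<in> L2 half_line" and orth: "\<And>\<phi>. test_function \<phi> \<Longrightarrow> L2_inner half_line h \<phi> = 0"
  shows "AE x in half_line. h x = 0"
proof (rule zero_AE_if_bump_integrals_zero[where \<phi> = "\<lambda>a b j. bump a b (1 / real (Suc j)) 1 0"])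
  show "set_integrable lebesgue {0<..b} h" for b by (rule L2_half_line_imp_local[OF h])
  show "bump a b (1 / real (Suc j)) 1 0 \<in> borel_measurable borel" for a b j
  proof -
    have "(\<lambda>x. if a < x \<and> x < b then exp (- (1 / real (Suc j)) * inverse ((x - a) * (b - x))) else 0) \<in> borel_measurable borel"
      by measurable
    then show ?thesis by (simp add: bump_def[abs_def] cong: if_cong)
  qed
  show "\<bar>bump a b (1 / real (Suc j)) 1 0 x\<bar> \<le> 1" for a b j x
    by (auto simp: bump_def)
  show "bump a b (1 / real (Suc j)) 1 0 x = 0" if "x \<notin> {a<..<b}" for a b j x
    using that by (auto simp: bump_def)
  show "(\<lambda>j. bump a b (1 / real (Suc j)) 1 0 x) \<longlonglongrightarrow> 1" if "x \<in> {a<..<b}" for a b x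
  proof -
    let ?y = "inverse ((x - a) * (b - x))"
    have "(\<lambda>j. exp (- (1 / real (Suc j)) * ?y)) \<longlonglongrightarrow> exp (- 0 * ?y)"
      by (intro tendsto_intros LIMSEQ_Suc[OF lim_1_over_n])
    then show ?thesis using that by (simp add: bump_def)
  qed
  show "(LINT x|half_line. h x * complex_of_real (bump a b (1 / real (Suc j)) 1 0 x)) = 0" if "0 < a" "a < b" for a b j
    using orth[OF test_function_bump[OF _ that, of "1 / real (Suc j)" 1 0]] by (simp add: L2_inner_def)
qed

text \<open>
  Polarisation; the real and the imaginary part come from adding \<open>h\<close> and \<open>\<i> h\<close>.
\<close>

lemma L2_unitary_inner:
  assumes U: "L2_unitary M U" and g: "g \<in> L2 M" and h: "h \<in> L2 M"
  shows "L2_inner M (U g) (U h) = L2_inner M g h"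
proof -
  have U': "U f \<in> L2 M" "L2_norm M (U f) = L2_norm M f" if "f \<in> L2 M" for f
    using U that by (auto simp: L2_unitary_def)
  have "Re (cnj a * L2_inner M (U g) (U h)) = Re (cnj a * L2_inner M g h)" for a
  proof -
    have f: "(\<lambda>y. 1 * g y + a * h y) \<in> L2 M" by (intro L2_add L2_scale g h)
    have "AE x in M. U (\<lambda>y. 1 * g y + a * h y) x = 1 * U g x + a * U h x"
      using U g h unfolding L2_unitary_def by blast
    then have "L2_norm M (U (\<lambda>y. 1 * g y + a * h y)) = L2_norm M (\<lambda>x. 1 * U g x + a * U h x)"
      by (intro L2_norm_cong_AE L2_measurable U' f L2_add L2_scale g h)
    then have "(L2_norm M (\<lambda>x. g x + a * h x))\<^sup>2 = (L2_norm M (\<lambda>x. U g x + a * U h x))\<^sup>2"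
      using U'(2)[OF f] by simp
    then show ?thesis
      unfolding L2_norm_add_scale[OF g h] L2_norm_add_scale[OF U'(1)[OF g] U'(1)[OF h]]
      by (simp add: U'(2) g h)
  qed
  from this[of 1] this[of \<i>] show ?thesis by (simp add: complex_eq_iff)
qed

text \<open>
  A unitary operator agreeing with the involution \<open>hankel_op\<close> on the test functions agrees with
  it everywhere: \<open>\<langle>hankel_op (U g), \<phi>\<rangle> = \<langle>U g, hankel_op \<phi>\<rangle> = \<langle>U g, U \<phi>\<rangle> = \<langle>g, \<phi>\<rangle>\<close>.
\<close>

lemma hankel_op_unique:
  assumes \<beta>: "\<beta> > -1" and U: "L2_unitary half_line U"
    and eq: "\<And>\<phi>. test_function \<phi> \<Longrightarrow> AE \<tau> in half_line. U \<phi> \<tau> = hankel_integral \<beta> \<phi> \<tau>"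
    and g: "g \<in> L2 half_line"
  shows "AE x in half_line. U g x = hankel_op \<beta> g x"
proof -
  let ?T = "hankel_op \<beta>"
  have U': "U f \<in> L2 half_line" if "f \<in> L2 half_line" for f
    using U that by (auto simp: L2_unitary_def)
  note T = hankel_op_L2[OF \<beta>]
  have "AE x in half_line. ?T (U g) x - g x = 0"
  proof (rule zero_AE_if_orthogonal_to_test_functions)
    show "(\<lambda>x. ?T (U g) x - g x) \<in> L2 half_line" by (intro L2_diff T U' g)
    fix \<phi> assume \<phi>: "test_function \<phi>"
    note \<phi>2 = test_function_L2[OF \<phi>]
    have "L2_inner half_line (?T (U g)) \<phi> = L2_inner half_line (?T (U g)) (?T (?T \<phi>))"
      using hankel_op_involution[OF \<beta> \<phi>2] by (intro L2_inner_cong_AE T U' g \<phi>2) auto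
    also have "\<dots> = L2_inner half_line (U g) (?T \<phi>)"
      by (intro L2_unitary_inner L2_unitary_hankel_op T U' g \<phi>2 \<beta>)
    also have "\<dots> = L2_inner half_line (U g) (U \<phi>)"
    proof (intro L2_inner_cong_AE T U' g \<phi>2)
      show "AE x in half_line. ?T \<phi> x = U \<phi> x"
        using hankel_op_test_function[OF \<beta> \<phi>] eq[OF \<phi>] by eventually_elim simp
    qed simp
    also have "\<dots> = L2_inner half_line g \<phi>" by (rule L2_unitary_inner[OF U g \<phi>2])
    finally show "L2_inner half_line (\<lambda>x. ?T (U g) x - g x) \<phi> = 0"
      unfolding L2_inner_def left_diff_distrib
      by (subst Bochner_Integration.integral_diff) (intro L2_mult_integrable L2_cnj T U' g \<phi>2, intro L2_mult_integrable L2_cnj g \<phi>2, simp)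
  qed
  then have "AE x in half_line. ?T (?T (U g)) x = ?T g x"
    by (intro hankel_op_cong_AE \<beta> T U' g) simp
  with hankel_op_involution[OF \<beta> U'[OF g]] show ?thesis
    by eventually_elim simp
qed

text \<open>
  The operator selected in the definition of \<open>hankel\<close> exists, as \<open>hankel_op\<close> is one, and agrees
  with it up to null sets, which limiting averages do not see.
\<close>

lemma hankel_eq_point_value:
  assumes \<beta>: "\<beta> > -1" and g: "g \<in> L2 half_line" and x: "x > 0"
  shows "hankel \<beta> g x = point_value (hankel_op \<beta> g) x"
proof -
  define U where "U = (SOME U. L2_unitary half_line U \<and>
        (\<forall>\<phi>. test_function \<phi> \<longrightarrow> (AE \<tau> in half_line. U \<phi> \<tau> = hankel_integral \<beta> \<phi> \<tau>)))"
  have U: "L2_unitary half_line U \<and> (\<forall>\<phi>. test_function \<phi> \<longrightarrow> (AE \<tau> in half_line. U \<phi> \<tau> = hankel_integral \<beta> \<phi> \<tau>))"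
    unfolding U_def
    by (rule someI[of _ "hankel_op \<beta>"]) (use L2_unitary_hankel_op[OF \<beta>] hankel_op_test_function[OF \<beta>] in blast)
  then have "AE x in half_line. U g x = hankel_op \<beta> g x"
    by (intro hankel_op_unique[OF \<beta> _ _ g]) auto
  moreover have "U g \<in> L2 half_line" using U g by (auto simp: L2_unitary_def)
  ultimately show ?thesis
    unfolding hankel_def U_def[symmetric]
    by (intro point_value_cong_AE x L2_measurable hankel_op_L2[OF \<beta> g])
qed

lemma hankel_cong_AE:
  assumes \<beta>: "\<beta> > -1" and "g \<in> L2 half_line" "h \<in> L2 half_line" "AE x in half_line. g x = h x" and x: "x > 0"
  shows "hankel \<beta> g x = hankel \<beta> h x"
  unfolding hankel_eq_point_value[OF \<beta> assms(2) x] hankel_eq_point_value[OF \<beta> assms(3) x]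
  by (intro point_value_cong_AE x L2_measurable hankel_op_L2 hankel_op_cong_AE assms)

section \<open>Functions on the quadrant and on \<open>\<nat> \<times> (0,\<infinity>)\<close>\<close>

text \<open>
  In a complete measure space, changing a function on a null set preserves measurability.
\<close>

lemma borel_measurable_completion_cong_AE:
  assumes g: "g \<in> borel_measurable (completion M)" and eq: "AE x in completion M. f x = g x"
  shows "f \<in> borel_measurable (completion M)"
proof (rule measurableI)
  fix A :: "'b set" assume A: "A \<in> sets borel"
  have "AE x in completion M. x \<in> g -` A \<inter> space (completion M) \<longleftrightarrow> x \<in> f -` A \<inter> space (completion M)"
    using eq by eventually_elim auto
  then show "f -` A \<inter> space (completion M) \<in> sets (completion M)"
    by (rule completion.in_sets_AE) (use measurable_sets[OF g A] in auto)
qed simp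

lemma borel_measurable_lebesgue_on_cong_AE:
  fixes f g :: "'a::euclidean_space \<Rightarrow> complex"
  assumes S: "S \<in> sets lebesgue" and g: "g \<in> borel_measurable (lebesgue_on S)"
    and eq: "AE x in lebesgue_on S. f x = g x"
  shows "f \<in> borel_measurable (lebesgue_on S)"
proof -
  have "(\<lambda>x. indicator S x *\<^sub>R g x) \<in> borel_measurable lebesgue"
    using g S by (simp add: borel_measurable_restrict_space_iff)
  moreover have "AE x in lebesgue. indicator S x *\<^sub>R f x = indicator S x *\<^sub>R g x"
    using eq S by (auto simp: AE_restrict_space_iff indicator_def elim!: eventually_mono)
  ultimately have "(\<lambda>x. indicator S x *\<^sub>R f x) \<in> borel_measurable lebesgue"
    by (rule borel_measurable_completion_cong_AE)
  then show ?thesis using S by (simp add: borel_measurable_restrict_space_iff)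
qed

lemma lebesgue_on_borel_version:
  fixes f :: "'a::euclidean_space \<Rightarrow> complex"
  assumes S: "S \<in> sets lebesgue" and f: "f \<in> borel_measurable (lebesgue_on S)"
  obtains g where "g \<in> borel_measurable borel" "AE x in lebesgue_on S. f x = g x"
proof -
  define h where "h x = indicator S x *\<^sub>R f x" for x
  have h: "h \<in> borel_measurable lebesgue"
    using f S unfolding h_def by (simp add: borel_measurable_restrict_space_iff)
  then have "(\<lambda>x. Re (h x)) \<in> borel_measurable lebesgue" "(\<lambda>x. Im (h x)) \<in> borel_measurable lebesgue"
    by measurable
  then obtain u v where u: "u \<in> borel_measurable lborel" "AE x in lborel. Re (h x) = u x"
    and v: "v \<in> borel_measurable lborel" "AE x in lborel. Im (h x) = v x"
    using completion_ex_borel_measurable_real[of "\<lambda>x. Re (h x)" lborel]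
      completion_ex_borel_measurable_real[of "\<lambda>x. Im (h x)" lborel] by blast
  have uv: "u \<in> borel_measurable borel" "v \<in> borel_measurable borel" using u v by simp_all
  show ?thesis
  proof (rule that)
    show "(\<lambda>x. complex_of_real (u x) + \<i> * complex_of_real (v x)) \<in> borel_measurable borel"
      using uv by measurable
    have "AE x in lborel. h x = complex_of_real (u x) + \<i> * complex_of_real (v x)"
      using u(2) v(2) by eventually_elim (simp add: complex_eq_iff)
    then have "AE x in lebesgue. h x = complex_of_real (u x) + \<i> * complex_of_real (v x)"
      by (rule AE_completion)
    then show "AE x in lebesgue_on S. f x = complex_of_real (u x) + \<i> * complex_of_real (v x)"
      using S by (subst AE_restrict_space_iff) (auto simp: h_def indicator_def elim!: eventually_mono)
  qed
qed

lemma L2_eq_nn_integral: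
  assumes f: "f \<in> L2 M" and g: "g \<in> borel_measurable N"
    and eq: "(\<integral>\<^sup>+x. ennreal ((cmod (f x))\<^sup>2) \<partial>M) = (\<integral>\<^sup>+x. ennreal ((cmod (g x))\<^sup>2) \<partial>N)"
  shows "g \<in> L2 N" "L2_norm N g = L2_norm M f"
proof -
  show *: "g \<in> L2 N"
    by (rule L2I_nn_integral[OF g]) (simp add: eq[symmetric] nn_integral_L2_norm[OF f])
  have "ennreal ((L2_norm N g)\<^sup>2) = ennreal ((L2_norm M f)\<^sup>2)"
    using eq by (simp add: nn_integral_L2_norm * f)
  then show "L2_norm N g = L2_norm M f" by simp
qed

lemma open_quadrant_measurable:
  fixes S :: "(real \<times> real) set"
  defines "S \<equiv> {0<..} \<times> {0<..}"
  shows "S \<in> sets borel" "S \<in> sets lebesgue" "S \<in> sets lborel"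
proof -
  have "open S" unfolding S_def by (intro open_Times) auto
  then show "S \<in> sets borel" by (rule borel_open)
  then show "S \<in> sets lebesgue" "S \<in> sets lborel" by (simp_all add: sets_completionI_sets)
qed

lemma sets_lborel_pair: "sets (lborel \<Otimes>\<^sub>M lborel :: (real \<times> real) measure) = sets borel"
  unfolding lborel_prod by simp

lemma AE_quadrant_iff: "(AE x in quadrant. P x) \<longleftrightarrow> (AE x in lborel \<Otimes>\<^sub>M lborel. x \<in> ({0<..} \<times> {0<..}) \<longrightarrow> P x)"
  unfolding lborel_prod AE_restrict_space_iff[of "{0<..} \<times> {0<..}" lebesgue, simplified, OF open_quadrant_measurable(2)] AE_completion_iff ..

lemma AE_half_line_lborel: "(AE x in half_line. P x) \<longleftrightarrow> (AE x in lborel. 0 < x \<longrightarrow> P x)"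
  unfolding AE_half_line_iff AE_completion_iff ..

lemma AE_quadrant_sections:
  assumes "AE x in quadrant. P x"
  shows "AE r in half_line. AE s in half_line. P (r, s)"
proof -
  have "AE r in lborel. AE s in lborel. (r, s) \<in> ({0<..} \<times> {0<..}) \<longrightarrow> P (r, s)"
    using assms unfolding AE_quadrant_iff by (rule lborel_pair.AE_pair)
  then show ?thesis
    unfolding AE_half_line_lborel by (auto elim!: eventually_mono)
qed

lemma AE_quadrantI:
  assumes meas: "{x. P x} \<in> sets borel" and ae: "AE r in half_line. AE s in half_line. P (r, s)"
  shows "AE x in quadrant. P x"
  unfolding AE_quadrant_iff
proof (rule lborel_pair.AE_pair_measure)
  have "{x. x \<in> ({0<..} \<times> {0<..}) \<longrightarrow> P x} = - ({0<..} \<times> {0<..}) \<union> {x. P x}" by auto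
  then have "{x. x \<in> ({0<..} \<times> {0<..}) \<longrightarrow> P x} \<in> sets borel"
    using meas open_quadrant_measurable(1) by (metis sets.Un borel_comp)
  then show "{x \<in> space (lborel \<Otimes>\<^sub>M lborel). x \<in> ({0<..} \<times> {0<..}) \<longrightarrow> P x} \<in> sets (lborel \<Otimes>\<^sub>M lborel)"
    unfolding sets_lborel_pair by (simp add: space_pair_measure)
  show "AE r in lborel. AE s in lborel. (r, s) \<in> ({0<..} \<times> {0<..}) \<longrightarrow> P (r, s)"
    using ae unfolding AE_half_line_lborel by (auto elim!: eventually_mono)
qed

text \<open>
  The exceptional set is contained in a product of a null set with the line, which
  is null.  In this form the lemma applies to \<open>G_inverse\<close>, whose measurability is a consequence.
\<close>

lemma AE_quadrant_first:
  assumes "AE r in half_line. \<forall>s>0. P (r, s)"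
  shows "AE x in quadrant. P x"
proof -
  from assms have "AE r in lborel. r > 0 \<longrightarrow> (\<forall>s>0. P (r, s))" unfolding AE_half_line_lborel .
  then obtain N where N: "{r. \<not> (r > 0 \<longrightarrow> (\<forall>s>0. P (r, s)))} \<subseteq> N" "N \<in> null_sets lborel"
    by (auto elim!: AE_E simp: null_sets_def)
  have "AE x in quadrant. fst x \<notin> N"
  proof (rule AE_quadrantI)
    have "(UNIV - N) \<times> (UNIV :: real set) \<in> sets (borel \<Otimes>\<^sub>M borel)"
      using N(2) by (intro pair_measureI sets.Diff) (auto simp: null_sets_def)
    moreover have "{x :: real \<times> real. fst x \<notin> N} = (UNIV - N) \<times> UNIV" by auto
    ultimately show "{x :: real \<times> real. fst x \<notin> N} \<in> sets borel"
      by (simp only: borel_prod)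
    have "AE r in lborel. r \<notin> N" using N(2) by (rule AE_not_in)
    then show "AE r in half_line. AE s in half_line. fst (r, s) \<notin> N"
      unfolding AE_half_line_lborel by eventually_elim simp
  qed
  moreover have "AE x in quadrant. x \<in> ({0<..} \<times> {0<..})" by (rule AE_I2) simp
  ultimately show ?thesis
  proof eventually_elim
    case (elim x)
    then show ?case using N(1) by (cases x) auto
  qed
qed

lemma AE_sections_commute:
  assumes "{x. P x} \<in> sets borel" and "AE r in half_line. AE s in half_line. P (r, s)"
  shows "AE s in half_line. AE r in half_line. P (r, s)"
proof -
  have "{x \<in> space (lborel \<Otimes>\<^sub>M lborel). fst x > 0 \<longrightarrow> snd x > 0 \<longrightarrow> P (fst x, snd x)} \<in> sets (lborel \<Otimes>\<^sub>M lborel)"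
  proof -
    have "{x. fst x > 0 \<longrightarrow> snd x > 0 \<longrightarrow> P (fst x, snd x)} = - ({0<..} \<times> {0<..}) \<union> {x. P x}" by auto
    then show ?thesis
      using assms(1) open_quadrant_measurable(1) unfolding sets_lborel_pair
      by (simp add: space_pair_measure)
  qed
  from lborel_pair.AE_commute[OF this]
  have *: "(AE r in lborel. AE s in lborel. r > 0 \<longrightarrow> s > 0 \<longrightarrow> P (r, s)) \<longleftrightarrow> (AE s in lborel. AE r in lborel. r > 0 \<longrightarrow> s > 0 \<longrightarrow> P (r, s))"
    by simp
  have "AE r in lborel. AE s in lborel. r > 0 \<longrightarrow> s > 0 \<longrightarrow> P (r, s)"
    using assms(2) unfolding AE_half_line_lborel by (auto elim!: eventually_mono)
  then have "AE s in lborel. AE r in lborel. r > 0 \<longrightarrow> s > 0 \<longrightarrow> P (r, s)"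
    unfolding * .
  then show ?thesis
    unfolding AE_half_line_lborel by (auto elim!: eventually_mono)
qed

lemma AE_sections_swap:
  assumes "{x. P x} \<in> sets borel" and "AE s in half_line. AE r in half_line. P (r, s)"
  shows "AE r in half_line. AE s in half_line. P (r, s)"
proof -
  have "prod.swap \<in> borel \<rightarrow>\<^sub>M (borel :: (real \<times> real) measure)"
    by (intro borel_measurable_continuous_onI continuous_on_swap)
  from measurable_sets[OF this assms(1)] have "{z. P (prod.swap z)} \<in> sets borel"
    by (simp add: vimage_def)
  then show ?thesis using AE_sections_commute[of "\<lambda>z. P (prod.swap z)"] assms(2) by simp
qed

lemma eq_set_measurable:
  fixes f g :: "'a \<Rightarrow> complex"
  assumes "f \<in> borel_measurable M" "g \<in> borel_measurable M"
  shows "{x \<in> space M. f x = g x} \<in> sets M"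
proof -
  have "(\<lambda>x. f x - g x) -` {0} \<inter> space M \<in> sets M"
    by (rule measurable_sets[OF borel_measurable_diff[OF assms]]) simp
  also have "(\<lambda>x. f x - g x) -` {0} \<inter> space M = {x \<in> space M. f x = g x}" by auto
  finally show ?thesis .
qed

lemma nn_integral_half_line:
  assumes "f \<in> borel_measurable borel"
  shows "(\<integral>\<^sup>+x. f x \<partial>half_line) = (\<integral>\<^sup>+x. f x * indicator {0<..} x \<partial>lborel)"
  by (subst nn_integral_restrict_space) (simp_all add: nn_integral_completion)

lemma section_measurable:
  fixes f :: "real \<times> real \<Rightarrow> 'b::topological_space"
  assumes "f \<in> borel_measurable borel"
  shows "(\<lambda>s. f (r, s)) \<in> borel_measurable borel" "(\<lambda>r. f (r, s)) \<in> borel_measurable borel"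
proof -
  have f: "f \<in> borel_measurable (borel \<Otimes>\<^sub>M borel)" using assms by (simp add: borel_prod)
  show "(\<lambda>s. f (r, s)) \<in> borel_measurable borel" by (rule measurable_compose[OF measurable_Pair1' f]) simp
  show "(\<lambda>r. f (r, s)) \<in> borel_measurable borel" by (rule measurable_compose[OF measurable_Pair2' f]) simp
qed

lemma nn_integral_quadrant:
  assumes f: "f \<in> borel_measurable borel"
  shows "(\<integral>\<^sup>+x. f x \<partial>quadrant) = (\<integral>\<^sup>+r. \<integral>\<^sup>+s. f (r, s) \<partial>half_line \<partial>half_line)"
    and "(\<integral>\<^sup>+x. f x \<partial>quadrant) = (\<integral>\<^sup>+s. \<integral>\<^sup>+r. f (r, s) \<partial>half_line \<partial>half_line)"
proof -
  have [measurable]: "f \<in> borel_measurable (borel \<Otimes>\<^sub>M borel)" using f by (simp add: borel_prod)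
  have "(\<integral>\<^sup>+x. f x \<partial>quadrant) = (\<integral>\<^sup>+x. f x * indicator ({0<..} \<times> {0<..}) x \<partial>(lborel \<Otimes>\<^sub>M lborel))"
    using open_quadrant_measurable(2) unfolding lborel_prod
    by (subst nn_integral_restrict_space) (simp_all add: nn_integral_completion)
  also have "\<dots> = (\<integral>\<^sup>+x. f (fst x, snd x) * indicator {0<..} (snd x) * indicator {0<..} (fst x) \<partial>(lborel \<Otimes>\<^sub>M lborel))"
    by (intro nn_integral_cong) (auto simp: indicator_def)
  finally have 1: "(\<integral>\<^sup>+x. f x \<partial>quadrant) = (\<integral>\<^sup>+x. f (fst x, snd x) * indicator {0<..} (snd x) * indicator {0<..} (fst x) \<partial>(lborel \<Otimes>\<^sub>M lborel))" .
  have m: "(\<lambda>x. f (fst x, snd x) * indicator {0<..} (snd x) * indicator {0<..} (fst x)) \<in> borel_measurable (lborel \<Otimes>\<^sub>M lborel)"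
    by measurable
  note m1 = section_measurable(1)[OF f] and m2 = section_measurable(2)[OF f]
  have "(\<integral>\<^sup>+x. f x \<partial>quadrant) = (\<integral>\<^sup>+r. \<integral>\<^sup>+s. f (r, s) * indicator {0<..} s * indicator {0<..} r \<partial>lborel \<partial>lborel)"
    unfolding 1 using lborel.nn_integral_fst[OF m] by simp
  also have "\<dots> = (\<integral>\<^sup>+r. (\<integral>\<^sup>+s. f (r, s) * indicator {0<..} s \<partial>lborel) * indicator {0<..} r \<partial>lborel)"
    using m1 by (intro nn_integral_cong nn_integral_multc) simp
  also have "\<dots> = (\<integral>\<^sup>+r. \<integral>\<^sup>+s. f (r, s) \<partial>half_line \<partial>half_line)"
    by (subst (2) nn_integral_half_line) (simp_all add: nn_integral_half_line m1)
  finally show "(\<integral>\<^sup>+x. f x \<partial>quadrant) = (\<integral>\<^sup>+r. \<integral>\<^sup>+s. f (r, s) \<partial>half_line \<partial>half_line)" .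
  have "(\<integral>\<^sup>+x. f x \<partial>quadrant) = (\<integral>\<^sup>+s. \<integral>\<^sup>+r. f (r, s) * indicator {0<..} s * indicator {0<..} r \<partial>lborel \<partial>lborel)"
    unfolding 1 using lborel_pair.nn_integral_snd[OF m] by simp
  also have "\<dots> = (\<integral>\<^sup>+s. \<integral>\<^sup>+r. f (r, s) * indicator {0<..} r * indicator {0<..} s \<partial>lborel \<partial>lborel)"
    by (simp add: mult_ac)
  also have "\<dots> = (\<integral>\<^sup>+s. (\<integral>\<^sup>+r. f (r, s) * indicator {0<..} r \<partial>lborel) * indicator {0<..} s \<partial>lborel)"
    using m2 by (intro nn_integral_cong nn_integral_multc) simp
  also have "\<dots> = (\<integral>\<^sup>+s. \<integral>\<^sup>+r. f (r, s) \<partial>half_line \<partial>half_line)"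
    by (subst (2) nn_integral_half_line) (simp_all add: nn_integral_half_line m2)
  finally show "(\<integral>\<^sup>+x. f x \<partial>quadrant) = (\<integral>\<^sup>+s. \<integral>\<^sup>+r. f (r, s) \<partial>half_line \<partial>half_line)" .
qed

lemma L2_quadrant_sections:
  assumes f: "f \<in> borel_measurable borel" "f \<in> L2 quadrant"
  shows "AE r in half_line. (\<lambda>s. f (r, s)) \<in> L2 half_line"
    and "AE s in half_line. (\<lambda>r. f (r, s)) \<in> L2 half_line"
proof -
  have fm: "(\<lambda>x. ennreal ((cmod (f x))\<^sup>2)) \<in> borel_measurable borel" using f(1) by measurable
  then have fm': "(\<lambda>x. ennreal ((cmod (f x))\<^sup>2)) \<in> borel_measurable (half_line \<Otimes>\<^sub>M half_line)"
  proof -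
    have [measurable]: "f \<in> borel_measurable (borel \<Otimes>\<^sub>M borel)" using f(1) by (simp add: borel_prod)
    have "(\<lambda>x. ennreal ((cmod (f (fst x, snd x)))\<^sup>2)) \<in> borel_measurable (half_line \<Otimes>\<^sub>M half_line)" by measurable
    then show ?thesis by simp
  qed
  have fin: "(\<integral>\<^sup>+x. ennreal ((cmod (f x))\<^sup>2) \<partial>quadrant) \<noteq> \<infinity>"
    by (simp add: nn_integral_L2_norm[OF f(2)])
  have "AE r in half_line. (\<integral>\<^sup>+s. ennreal ((cmod (f (r, s)))\<^sup>2) \<partial>half_line) \<noteq> \<infinity>"
    using fin unfolding nn_integral_quadrant(1)[OF fm]
    by (intro nn_integral_PInf_AE half_line.borel_measurable_nn_integral_fst fm')
  then show "AE r in half_line. (\<lambda>s. f (r, s)) \<in> L2 half_line"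
    by eventually_elim (intro L2I_nn_integral borel_measurable_half_line section_measurable f, simp add: less_top)
  have "(\<lambda>x. ennreal ((cmod (f (prod.swap x)))\<^sup>2)) \<in> borel_measurable (half_line \<Otimes>\<^sub>M half_line)"
    by (rule measurable_compose[OF _ fm']) (simp add: prod.swap_def)
  then have "AE s in half_line. (\<integral>\<^sup>+r. ennreal ((cmod (f (r, s)))\<^sup>2) \<partial>half_line) \<noteq> \<infinity>"
    using fin half_line.borel_measurable_nn_integral_fst[of "\<lambda>x. ennreal ((cmod (f (prod.swap x)))\<^sup>2)" half_line]
    unfolding nn_integral_quadrant(2)[OF fm]
    by (intro nn_integral_PInf_AE) simp_all
  then show "AE s in half_line. (\<lambda>r. f (r, s)) \<in> L2 half_line"
    by eventually_elim (intro L2I_nn_integral borel_measurable_half_line section_measurable f, simp add: less_top)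
qed

lemma nn_integral_Gamma_space:
  assumes "\<And>n. (\<lambda>\<tau>. f (n, \<tau>)) \<in> borel_measurable half_line"
  shows "(\<integral>\<^sup>+x. f x \<partial>Gamma_space) = (\<Sum>n. \<integral>\<^sup>+\<tau>. f (n, \<tau>) \<partial>half_line)"
proof -
  have "f \<in> borel_measurable Gamma_space"
    by (rule measurable_pair_measure_countable1) (use assms in auto)
  then have "(\<integral>\<^sup>+x. f x \<partial>Gamma_space) = (\<integral>\<^sup>+n. \<integral>\<^sup>+\<tau>. f (n, \<tau>) \<partial>half_line \<partial>count_space UNIV)"
    by (rule half_line.nn_integral_fst[symmetric])
  then show ?thesis by (simp add: nn_integral_count_space_nat)
qed

lemma AE_Gamma_space:
  assumes f: "f \<in> borel_measurable Gamma_space" and g: "g \<in> borel_measurable Gamma_space"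
    and eq: "\<And>n. AE \<tau> in half_line. f (n, \<tau>) = (g (n, \<tau>) :: complex)"
  shows "AE x in Gamma_space. f x = g x"
proof -
  interpret N: sigma_finite_measure "count_space (UNIV :: nat set)"
    by (rule sigma_finite_measure_count_space_countable) simp
  interpret G: pair_sigma_finite "count_space (UNIV :: nat set)" half_line ..
  show ?thesis
  proof (rule G.AE_pair_measure)
    show "{x \<in> space Gamma_space. f x = g x} \<in> sets Gamma_space"
      by (rule eq_set_measurable[OF f g])
    show "AE n in count_space UNIV. AE \<tau> in half_line. f (n, \<tau>) = g (n, \<tau>)"
      using eq by (simp add: AE_count_space)
  qed
qed

section \<open>Measurable point values of orthonormal series\<close>

text \<open>
  The limiting averages at \<open>x\<close> of the series \<open>\<Sum>n. a n y * e n y\<close>, where \<open>y\<close> is the parameter of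
  the fibre, computed from the coefficients alone.
\<close>

definition series_value :: "(nat \<Rightarrow> real \<Rightarrow> real \<Rightarrow> real) \<Rightarrow> (nat \<Rightarrow> real \<Rightarrow> complex) \<Rightarrow> real \<Rightarrow> real \<Rightarrow> complex"
  where "series_value e a y x = lim (\<lambda>k. real (Suc k) *\<^sub>R
     (\<Sum>n. a n y * (LINT z|half_line. complex_of_real (indicator {x..x + 1 / real (Suc k)} z) * complex_of_real (e n y z))))"

text \<open>
  The averages of an orthonormal series are given by the coefficients of the series and of
  indicator functions, hence depend measurably on all parameters.
\<close>

lemma series_value_measurable:
  assumes e: "\<And>n. (\<lambda>z. e n (fst z) (snd z)) \<in> borel_measurable (borel \<Otimes>\<^sub>M borel)"
    and a: "\<And>n. a n \<in> borel_measurable borel"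
  shows "(\<lambda>z. series_value e a (fst z) (snd z)) \<in> borel_measurable (borel \<Otimes>\<^sub>M borel)"
proof -
  note [measurable] = a
  have [measurable]: "(\<lambda>z. LINT t|half_line. complex_of_real (indicator {snd z..snd z + 1 / real (Suc k)} t) * complex_of_real (e n (fst z) t))
     \<in> borel_measurable (borel \<Otimes>\<^sub>M borel)" for n k
  proof (rule half_line.borel_measurable_lebesgue_integral)
    have "(\<lambda>p. (fst (fst p), snd p)) \<in> (borel \<Otimes>\<^sub>M borel) \<Otimes>\<^sub>M half_line \<rightarrow>\<^sub>M borel \<Otimes>\<^sub>M (borel :: real measure)"
      by measurable
    from measurable_compose[OF this e[of n]]
    have [measurable]: "(\<lambda>p. e n (fst (fst p)) (snd p)) \<in> borel_measurable ((borel \<Otimes>\<^sub>M borel) \<Otimes>\<^sub>M half_line)" by simp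
    have *: "(\<lambda>p. indicator {snd (fst p)..snd (fst p) + 1 / real (Suc k)} (snd p) :: real) =
        (\<lambda>p. if snd (fst p) \<le> snd p \<and> snd p \<le> snd (fst p) + 1 / real (Suc k) then 1 else 0)"
      by (auto simp: indicator_def fun_eq_iff)
    have "(\<lambda>p. if snd (fst p) \<le> snd p \<and> snd p \<le> snd (fst p) + 1 / real (Suc k) then 1 else 0 :: real)
       \<in> borel_measurable ((borel \<Otimes>\<^sub>M borel) \<Otimes>\<^sub>M half_line)"
      by measurable
    then have [measurable]: "(\<lambda>p. indicator {snd (fst p)..snd (fst p) + 1 / real (Suc k)} (snd p) :: real) \<in> borel_measurable ((borel \<Otimes>\<^sub>M borel) \<Otimes>\<^sub>M half_line)"
      unfolding * .
    show "(\<lambda>(z, t). complex_of_real (indicator {snd z..snd z + 1 / real (Suc k)} t) * complex_of_real (e n (fst z) t))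
       \<in> borel_measurable ((borel \<Otimes>\<^sub>M borel) \<Otimes>\<^sub>M half_line)"
      unfolding split_beta by measurable
  qed
  show ?thesis unfolding series_value_def by measurable
qed

lemma point_value_series:
  assumes e: "orthonormal_system half_line (\<lambda>n. e n y)"
    and h: "L2_tendsto half_line (orthonormal_system.partial (\<lambda>n. e n y) (\<lambda>n. a n y)) h" and x: "x > 0"
  shows "point_value h x = series_value e a y x"
proof -
  interpret orthonormal_system half_line "\<lambda>n. e n y" by (rule e)
  have "average h x k = real (Suc k) *\<^sub>R
     (\<Sum>n. a n y * (LINT z|half_line. complex_of_real (indicator {x..x + 1 / real (Suc k)} z) * complex_of_real (e n y z)))" for k
    using sums_unique[OF inner_L2_series[OF h indicator_L2_half_line[of x "x + 1 / real (Suc k)"]]]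
    unfolding average_def set_integral_eq_half_line[OF x] coeff_def by simp
  then show ?thesis unfolding point_value_eq series_value_def by presburger
qed

section \<open>The mixed transform\<close>

text \<open>
  The partial transforms in one variable, as relations rather than operations: the same relation
  describes a transform and its inverse, and almost everywhere equality of the components can be
  used freely.  Borel functions are required so that the order of the two variables can be
  exchanged in statements that hold almost everywhere.
\<close>

definition hankel_pair :: "real \<Rightarrow> (real \<times> real \<Rightarrow> complex) \<Rightarrow> (real \<times> real \<Rightarrow> complex) \<Rightarrow> bool"
  where "hankel_pair \<beta> f p \<longleftrightarrow> f \<in> borel_measurable borel \<and> p \<in> borel_measurable borel \<and>
    (AE r in half_line. (\<lambda>s. f (r, s)) \<in> L2 half_line \<and> (\<lambda>s. p (r, s)) \<in> L2 half_line \<and>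
       (AE \<tau> in half_line. p (r, \<tau>) = hankel_op \<beta> (\<lambda>s. f (r, s)) \<tau>))"

definition laguerre_pair :: "real \<Rightarrow> (real \<times> real \<Rightarrow> complex) \<Rightarrow> (nat \<Rightarrow> real \<Rightarrow> complex) \<Rightarrow> bool"
  where "laguerre_pair \<alpha> p c \<longleftrightarrow> p \<in> borel_measurable borel \<and> (\<forall>n. c n \<in> borel_measurable borel) \<and>
    (AE \<tau> in half_line. L2_tendsto half_line
       (orthonormal_system.partial (laguerre_fun_scaled \<alpha> \<tau>) (\<lambda>n. c n \<tau>)) (\<lambda>r. p (r, \<tau>)))"

lemma hankel_pair_sym:
  assumes \<beta>: "\<beta> > -1" and "hankel_pair \<beta> f p"
  shows "hankel_pair \<beta> p f"
proof -
  have "AE r in half_line. (\<lambda>s. p (r, s)) \<in> L2 half_line \<and> (\<lambda>s. f (r, s)) \<in> L2 half_line \<and>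
       (AE \<tau> in half_line. f (r, \<tau>) = hankel_op \<beta> (\<lambda>s. p (r, s)) \<tau>)"
    using assms(2)[unfolded hankel_pair_def, THEN conjunct2, THEN conjunct2]
  proof eventually_elim
    case (elim r)
    then have "AE \<tau> in half_line. hankel_op \<beta> (\<lambda>s. p (r, s)) \<tau> = hankel_op \<beta> (hankel_op \<beta> (\<lambda>s. f (r, s))) \<tau>"
      by (intro hankel_op_cong_AE hankel_op_L2 \<beta>) auto
    moreover have "AE \<tau> in half_line. hankel_op \<beta> (hankel_op \<beta> (\<lambda>s. f (r, s))) \<tau> = f (r, \<tau>)"
      using elim by (intro hankel_op_involution \<beta>) auto
    ultimately have "AE \<tau> in half_line. f (r, \<tau>) = hankel_op \<beta> (\<lambda>s. p (r, s)) \<tau>"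
      by eventually_elim simp
    then show ?case using elim by blast
  qed
  then show ?thesis using assms(2) by (simp add: hankel_pair_def)
qed

text \<open>
  The norm is preserved on almost every section; Tonelli's theorem does the rest.
\<close>

lemma hankel_pair_norm:
  assumes \<beta>: "\<beta> > -1" and pair: "hankel_pair \<beta> f p" and f: "f \<in> L2 quadrant"
  shows "p \<in> L2 quadrant" "L2_norm quadrant p = L2_norm quadrant f"
proof -
  have m: "f \<in> borel_measurable borel" "p \<in> borel_measurable borel"
    using pair by (simp_all add: hankel_pair_def)
  then have m2: "(\<lambda>x. ennreal ((cmod (f x))\<^sup>2)) \<in> borel_measurable borel"
    "(\<lambda>x. ennreal ((cmod (p x))\<^sup>2)) \<in> borel_measurable borel" by measurable
  have "AE r in half_line. (\<integral>\<^sup>+s. ennreal ((cmod (f (r, s)))\<^sup>2) \<partial>half_line) = (\<integral>\<^sup>+s. ennreal ((cmod (p (r, s)))\<^sup>2) \<partial>half_line)"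
    using pair[unfolded hankel_pair_def, THEN conjunct2, THEN conjunct2]
  proof eventually_elim
    case (elim r)
    then have "L2_norm half_line (\<lambda>s. p (r, s)) = L2_norm half_line (hankel_op \<beta> (\<lambda>s. f (r, s)))"
      by (intro L2_norm_cong_AE L2_measurable hankel_op_L2 \<beta>) auto
    then show ?case
      using elim by (simp add: nn_integral_L2_norm hankel_op_norm[OF \<beta>])
  qed
  then have eq: "(\<integral>\<^sup>+x. ennreal ((cmod (f x))\<^sup>2) \<partial>quadrant) = (\<integral>\<^sup>+x. ennreal ((cmod (p x))\<^sup>2) \<partial>quadrant)"
    unfolding nn_integral_quadrant(1)[OF m2(1)] nn_integral_quadrant(1)[OF m2(2)] by (rule nn_integral_cong_AE)
  have "p \<in> borel_measurable quadrant"
    using m(2) by (intro measurable_restrict_space1 measurable_completion) simp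
  from L2_eq_nn_integral[OF f this eq] show "p \<in> L2 quadrant" "L2_norm quadrant p = L2_norm quadrant f" .
qed

lemma hankel_pair_unique:
  assumes "hankel_pair \<beta> f p" "hankel_pair \<beta> f q"
  shows "AE r in half_line. AE s in half_line. p (r, s) = q (r, s)"
  using assms[unfolded hankel_pair_def, THEN conjunct2, THEN conjunct2]
proof eventually_elim
  case (elim r)
  then have "AE \<tau> in half_line. p (r, \<tau>) = hankel_op \<beta> (\<lambda>s. f (r, s)) \<tau>"
    "AE \<tau> in half_line. q (r, \<tau>) = hankel_op \<beta> (\<lambda>s. f (r, s)) \<tau>" by blast+
  then show ?case by eventually_elim simp
qed

lemma hankel_pair_cong:
  assumes \<beta>: "\<beta> > -1" and pair: "hankel_pair \<beta> f p" and g: "g \<in> borel_measurable borel"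
    and eq: "AE r in half_line. AE s in half_line. f (r, s) = g (r, s)"
  shows "hankel_pair \<beta> g p"
proof -
  have "AE r in half_line. (\<lambda>s. g (r, s)) \<in> L2 half_line \<and> (\<lambda>s. p (r, s)) \<in> L2 half_line \<and>
       (AE \<tau> in half_line. p (r, \<tau>) = hankel_op \<beta> (\<lambda>s. g (r, s)) \<tau>)"
    using pair[unfolded hankel_pair_def, THEN conjunct2, THEN conjunct2] eq
  proof eventually_elim
    case (elim r)
    have f2: "(\<lambda>s. f (r, s)) \<in> L2 half_line" and p: "AE \<tau> in half_line. p (r, \<tau>) = hankel_op \<beta> (\<lambda>s. f (r, s)) \<tau>"
      using elim(1) by blast+
    have g2: "(\<lambda>s. g (r, s)) \<in> L2 half_line"
      by (rule L2_cong_AE[OF f2 borel_measurable_half_line[OF section_measurable(1)[OF g]] elim(2)])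
    have "AE \<tau> in half_line. p (r, \<tau>) = hankel_op \<beta> (\<lambda>s. g (r, s)) \<tau>"
      using p hankel_op_cong_AE[OF \<beta> f2 g2 elim(2)] by eventually_elim simp
    then show ?case using elim(1) g2 by blast
  qed
  then show ?thesis using pair g by (simp add: hankel_pair_def)
qed

text \<open>
  The series with coefficients \<open>(-1)^n * coeff (\<lambda>s. f (r, s)) n\<close> has jointly measurable limiting
  averages.  They are the values of \<open>hankel\<close> at every \<open>\<tau> > 0\<close>, not merely at almost every one, and
  this remains true for a representative \<open>g\<close> of the class of \<open>f\<close> with arbitrary values on null
  sets.
\<close>

lemma ex_hankel_pair:
  assumes \<beta>: "\<beta> > -1" and f: "f \<in> borel_measurable borel" "f \<in> L2 quadrant"
  obtains p where "hankel_pair \<beta> f p"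
    "\<And>g. AE r in half_line. AE s in half_line. g (r, s) = f (r, s) \<Longrightarrow>
       AE r in half_line. \<forall>\<tau>>0. hankel \<beta> (\<lambda>s. g (r, s)) \<tau> = p (r, \<tau>)"
proof -
  interpret B: orthonormal_basis half_line "laguerre_fun_scaled \<beta> 1"
    by (rule laguerre_basis[OF \<beta>]) simp
  define e :: "nat \<Rightarrow> real \<Rightarrow> real \<Rightarrow> real" where "e n r = laguerre_fun_scaled \<beta> 1 n" for n r
  define a where "a n r = (-1)^n * B.coeff (\<lambda>s. f (r, s)) n" for n r
  define p where "p z = series_value e a (fst z) (snd z)" for z
  have f_pair [measurable]: "f \<in> borel_measurable (borel \<Otimes>\<^sub>M borel)" using f(1) by (simp add: borel_prod)
  have "a n \<in> borel_measurable borel" for n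
  proof -
    have "(\<lambda>z. f (fst z, snd z) * complex_of_real (laguerre_fun_scaled \<beta> 1 n (snd z))) \<in> borel_measurable (borel \<Otimes>\<^sub>M half_line)"
      by measurable
    then have "(\<lambda>r. LINT s|half_line. f (r, s) * complex_of_real (laguerre_fun_scaled \<beta> 1 n s)) \<in> borel_measurable borel"
      by (intro half_line.borel_measurable_lebesgue_integral) (simp add: split_beta)
    then show ?thesis unfolding a_def[abs_def] B.coeff_def by measurable
  qed
  moreover have "(\<lambda>z. e n (fst z) (snd z)) \<in> borel_measurable (borel \<Otimes>\<^sub>M borel)" for n
    unfolding e_def by measurable
  ultimately have p_meas: "p \<in> borel_measurable borel"
    unfolding p_def[abs_def] borel_prod[symmetric] by (intro series_value_measurable)
  have value_eq: "point_value (hankel_op \<beta> (\<lambda>s. f (r, s))) \<tau> = p (r, \<tau>)" if "(\<lambda>s. f (r, s)) \<in> L2 half_line" "\<tau> > 0" for r \<tau>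
    unfolding p_def fst_conv snd_conv
    by (rule point_value_series)
      (use hankel_op_tendsto[OF \<beta> that(1)] that(2) in \<open>simp_all add: e_def a_def B.orthonormal_system_axioms\<close>)
  have sect: "AE r in half_line. (\<lambda>s. f (r, s)) \<in> L2 half_line"
    by (rule L2_quadrant_sections(1)[OF f])
  show ?thesis
  proof (rule that)
    have "AE r in half_line. (\<lambda>s. f (r, s)) \<in> L2 half_line \<and> (\<lambda>s. p (r, s)) \<in> L2 half_line \<and>
       (AE \<tau> in half_line. p (r, \<tau>) = hankel_op \<beta> (\<lambda>s. f (r, s)) \<tau>)"
      using sect
    proof eventually_elim
      case (elim r)
      note T = hankel_op_L2[OF \<beta> elim]
      have "AE \<tau> in half_line. \<tau> > 0" by (rule AE_I2) simp
      moreover have "AE \<tau> in half_line. point_value (hankel_op \<beta> (\<lambda>s. f (r, s))) \<tau> = hankel_op \<beta> (\<lambda>s. f (r, s)) \<tau>"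
        by (rule point_value_AE[OF L2_half_line_imp_local[OF T]])
      ultimately have eq: "AE \<tau> in half_line. hankel_op \<beta> (\<lambda>s. f (r, s)) \<tau> = p (r, \<tau>)"
        by eventually_elim (simp add: value_eq[OF elim])
      then have "(\<lambda>s. p (r, s)) \<in> L2 half_line"
        by (rule L2_cong_AE[OF T borel_measurable_half_line[OF section_measurable(1)[OF p_meas]]])
      then show ?case using elim eq by (auto elim!: eventually_mono)
    qed
    then show "hankel_pair \<beta> f p" using f(1) p_meas by (simp add: hankel_pair_def)
    fix g assume "AE r in half_line. AE s in half_line. g (r, s) = f (r, s)"
    then show "AE r in half_line. \<forall>\<tau>>0. hankel \<beta> (\<lambda>s. g (r, s)) \<tau> = p (r, \<tau>)"
      using sect
    proof eventually_elim
      case (elim r)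
      have "(\<lambda>s. g (r, s)) \<in> borel_measurable half_line"
        by (rule borel_measurable_lebesgue_on_cong_AE[OF _ L2_measurable[OF elim(2)] elim(1)]) simp
      then have "(\<lambda>s. g (r, s)) \<in> L2 half_line"
        by (rule L2_cong_AE[OF elim(2)]) (use elim(1) in \<open>auto elim!: eventually_mono\<close>)
      then have "hankel \<beta> (\<lambda>s. g (r, s)) \<tau> = p (r, \<tau>)" if "\<tau> > 0" for \<tau>
        using hankel_cong_AE[OF \<beta> _ elim(2,1) that] hankel_eq_point_value[OF \<beta> elim(2) that] value_eq[OF elim(2) that]
        by simp
      then show ?case by blast
    qed
  qed
qed

text \<open>
  Parseval's identity in the first variable for almost every \<open>\<tau>\<close>, integrated over \<open>\<tau>\<close>.
\<close>

lemma laguerre_pair_norm: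
  assumes \<alpha>: "\<alpha> > -1" and pair: "laguerre_pair \<alpha> p c"
  shows "(\<integral>\<^sup>+x. ennreal ((cmod (p x))\<^sup>2) \<partial>quadrant) = (\<integral>\<^sup>+x. ennreal ((cmod (c (fst x) (snd x)))\<^sup>2) \<partial>Gamma_space)"
proof -
  have m: "p \<in> borel_measurable borel" and [measurable]: "\<And>n. c n \<in> borel_measurable borel"
    using pair by (simp_all add: laguerre_pair_def)
  have m2: "(\<lambda>x. ennreal ((cmod (p x))\<^sup>2)) \<in> borel_measurable borel" using m by measurable
  have c2: "(\<lambda>\<tau>. ennreal ((cmod (c n \<tau>))\<^sup>2)) \<in> borel_measurable half_line" for n
    by (rule borel_measurable_half_line) measurable
  have "(\<integral>\<^sup>+x. ennreal ((cmod (p x))\<^sup>2) \<partial>quadrant) = (\<integral>\<^sup>+\<tau>. \<integral>\<^sup>+r. ennreal ((cmod (p (r, \<tau>)))\<^sup>2) \<partial>half_line \<partial>half_line)"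
    by (rule nn_integral_quadrant(2)[OF m2])
  also have "\<dots> = (\<integral>\<^sup>+\<tau>. (\<Sum>n. ennreal ((cmod (c n \<tau>))\<^sup>2)) \<partial>half_line)"
  proof (rule nn_integral_cong_AE)
    have "AE \<tau> in half_line. \<tau> > 0" by (rule AE_I2) simp
    then show "AE \<tau> in half_line. (\<integral>\<^sup>+r. ennreal ((cmod (p (r, \<tau>)))\<^sup>2) \<partial>half_line) = (\<Sum>n. ennreal ((cmod (c n \<tau>))\<^sup>2))"
      using pair[unfolded laguerre_pair_def, THEN conjunct2, THEN conjunct2]
    proof eventually_elim
      case (elim \<tau>)
      interpret orthonormal_system half_line "laguerre_fun_scaled \<alpha> \<tau>"
        by (rule orthonormal_laguerre[OF \<alpha> elim(1)])
      have s: "(\<lambda>n. (cmod (c n \<tau>))\<^sup>2) sums (L2_norm half_line (\<lambda>r. p (r, \<tau>)))\<^sup>2"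
        by (rule norm_L2_series[OF elim(2)])
      have "(\<lambda>r. p (r, \<tau>)) \<in> L2 half_line" using elim(2) by (simp add: L2_tendsto_def)
      then have "(\<integral>\<^sup>+r. ennreal ((cmod (p (r, \<tau>)))\<^sup>2) \<partial>half_line) = ennreal (\<Sum>n. (cmod (c n \<tau>))\<^sup>2)"
        unfolding sums_unique[OF s, symmetric] by (rule nn_integral_L2_norm)
      also have "\<dots> = (\<Sum>n. ennreal ((cmod (c n \<tau>))\<^sup>2))"
        by (rule suminf_ennreal2[OF zero_le_power2 sums_summable[OF s], symmetric])
      finally show ?case .
    qed
  qed
  also have "\<dots> = (\<Sum>n. \<integral>\<^sup>+\<tau>. ennreal ((cmod (c n \<tau>))\<^sup>2) \<partial>half_line)"
    by (rule nn_integral_suminf[OF c2])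
  also have "\<dots> = (\<integral>\<^sup>+x. ennreal ((cmod (c (fst x) (snd x)))\<^sup>2) \<partial>Gamma_space)"
    by (subst nn_integral_Gamma_space) (simp_all add: c2)
  finally show ?thesis .
qed

lemma laguerre_pair_coeff:
  assumes \<alpha>: "\<alpha> > -1" and pair: "laguerre_pair \<alpha> p c"
  shows "AE \<tau> in half_line. \<forall>n. laguerre_transform \<alpha> \<tau> (\<lambda>r. p (r, \<tau>)) n = c n \<tau>"
proof -
  have "AE \<tau> in half_line. \<tau> > 0" by (rule AE_I2) simp
  then show ?thesis
    using pair[unfolded laguerre_pair_def, THEN conjunct2, THEN conjunct2]
  proof eventually_elim
    case (elim \<tau>)
    interpret orthonormal_system half_line "laguerre_fun_scaled \<alpha> \<tau>"
      by (rule orthonormal_laguerre[OF \<alpha> elim(1)])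
    show ?case
      using coeff_L2_series[OF elim(2)] by (simp add: laguerre_transform_def coeff_def)
  qed
qed

lemma laguerre_pair_unique:
  assumes "laguerre_pair \<alpha> p c" "laguerre_pair \<alpha> q c"
  shows "AE r in half_line. AE \<tau> in half_line. p (r, \<tau>) = q (r, \<tau>)"
proof (rule AE_sections_swap)
  show "{x. p x = q x} \<in> sets borel"
    using assms eq_set_measurable[of p borel q] by (simp add: laguerre_pair_def)
  show "AE \<tau> in half_line. AE r in half_line. p (r, \<tau>) = q (r, \<tau>)"
    using assms[unfolded laguerre_pair_def, THEN conjunct2, THEN conjunct2]
    by eventually_elim (rule L2_tendsto_unique)
qed

lemma laguerre_transform_measurable:
  assumes p: "p \<in> borel_measurable borel"
  shows "(\<lambda>\<tau>. laguerre_transform \<alpha> \<tau> (\<lambda>r. p (r, \<tau>)) n) \<in> borel_measurable borel"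
proof -
  have [measurable]: "p \<in> borel_measurable (borel \<Otimes>\<^sub>M borel)" using p by (simp add: borel_prod)
  have "(\<lambda>z. (fst z, snd z)) \<in> borel \<Otimes>\<^sub>M half_line \<rightarrow>\<^sub>M borel \<Otimes>\<^sub>M (borel :: real measure)"
    by measurable
  from measurable_compose[OF this laguerre_fun_scaled_measurable[of \<alpha> n]]
  have [measurable]: "(\<lambda>z. laguerre_fun_scaled \<alpha> (fst z) n (snd z)) \<in> borel_measurable (borel \<Otimes>\<^sub>M half_line)" by simp
  have "(\<lambda>z. p (snd z, fst z) * complex_of_real (laguerre_fun_scaled \<alpha> (fst z) n (snd z))) \<in> borel_measurable (borel \<Otimes>\<^sub>M half_line)"
    by measurable
  then show ?thesis
    unfolding laguerre_transform_def
    by (intro half_line.borel_measurable_lebesgue_integral) (simp add: split_beta)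
qed

lemma laguerre_transform_cong_AE:
  assumes g: "g \<in> borel_measurable half_line" and eq: "AE r in half_line. f r = g r"
  shows "laguerre_transform \<alpha> \<tau> f n = laguerre_transform \<alpha> \<tau> g n"
proof -
  have f: "f \<in> borel_measurable half_line"
    by (rule borel_measurable_lebesgue_on_cong_AE[OF _ g eq]) simp
  have [measurable]: "laguerre_fun_scaled \<alpha> \<tau> n \<in> borel_measurable half_line"
    by (rule borel_measurable_half_line) measurable
  show ?thesis
    unfolding laguerre_transform_def
    by (rule integral_cong_AE) (use f g eq in \<open>measurable, auto elim!: eventually_mono\<close>)
qed

lemma laguerre_pair_transform:
  assumes \<alpha>: "\<alpha> > -1" and p: "p \<in> borel_measurable borel" "p \<in> L2 quadrant"
  shows "laguerre_pair \<alpha> p (\<lambda>n \<tau>. laguerre_transform \<alpha> \<tau> (\<lambda>r. p (r, \<tau>)) n)"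
proof -
  have "AE \<tau> in half_line. \<tau> > 0" by (rule AE_I2) simp
  then have "AE \<tau> in half_line. L2_tendsto half_line
       (orthonormal_system.partial (laguerre_fun_scaled \<alpha> \<tau>) (\<lambda>n. laguerre_transform \<alpha> \<tau> (\<lambda>r. p (r, \<tau>)) n)) (\<lambda>r. p (r, \<tau>))"
    using L2_quadrant_sections(2)[OF p]
  proof eventually_elim
    case (elim \<tau>)
    interpret orthonormal_basis half_line "laguerre_fun_scaled \<alpha> \<tau>"
      by (rule laguerre_basis[OF \<alpha> elim(1)])
    have "(\<lambda>n. laguerre_transform \<alpha> \<tau> (\<lambda>r. p (r, \<tau>)) n) = coeff (\<lambda>r. p (r, \<tau>))"
      by (simp add: laguerre_transform_def coeff_def fun_eq_iff)
    then show ?case using expansion[OF elim(2)] by simp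
  qed
  then show ?thesis
    using p(1) laguerre_transform_measurable[OF p(1)] by (simp add: laguerre_pair_def)
qed

text \<open>
  The counterpart of \<open>ex_hankel_pair\<close>, with \<open>\<tau>\<close> as the parameter of the fibre and \<open>r\<close> as the point
  at which the averages are taken.
\<close>

lemma ex_laguerre_pair:
  assumes \<alpha>: "\<alpha> > -1" and c: "\<And>n. c n \<in> borel_measurable borel"
    and sq: "AE \<tau> in half_line. summable (\<lambda>n. (cmod (c n \<tau>))\<^sup>2)"
  obtains p where "laguerre_pair \<alpha> p c"
    "\<And>d. AE \<tau> in half_line. \<forall>n. d n \<tau> = c n \<tau> \<Longrightarrow>
       AE \<tau> in half_line. \<forall>r>0. laguerre_inverse \<alpha> \<tau> (\<lambda>n. d n \<tau>) r = p (r, \<tau>)"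
proof -
  define e where "e n \<tau> = laguerre_fun_scaled \<alpha> \<tau> n" for n \<tau>
  define p where "p z = series_value e c (snd z) (fst z)" for z
  have "(\<lambda>z. e n (fst z) (snd z)) \<in> borel_measurable (borel \<Otimes>\<^sub>M borel)" for n
    unfolding e_def by (rule laguerre_fun_scaled_measurable)
  then have "(\<lambda>z. series_value e c (fst z) (snd z)) \<in> borel_measurable (borel \<Otimes>\<^sub>M borel)"
    by (intro series_value_measurable c)
  from measurable_compose[OF measurable_pair_swap'[of borel borel] this]
  have p_meas: "p \<in> borel_measurable borel"
    unfolding p_def[abs_def] borel_prod[symmetric] by (simp add: split_beta)
  have pos: "AE \<tau> in half_line. \<tau> > (0::real)" by (rule AE_I2) simp
  have main: "AE \<tau> in half_line. (\<forall>r>0. laguerre_inverse \<alpha> \<tau> (\<lambda>n. c n \<tau>) r = p (r, \<tau>)) \<and>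
     L2_tendsto half_line (orthonormal_system.partial (laguerre_fun_scaled \<alpha> \<tau>) (\<lambda>n. c n \<tau>)) (\<lambda>r. p (r, \<tau>))"
    using sq pos
  proof eventually_elim
    case (elim \<tau>)
    interpret orthonormal_system half_line "laguerre_fun_scaled \<alpha> \<tau>"
      by (rule orthonormal_laguerre[OF \<alpha> elim(2)])
    define h where "h = (SOME h. L2_tendsto half_line
       (\<lambda>N r. \<Sum>n<N. c n \<tau> * complex_of_real (laguerre_fun_scaled \<alpha> \<tau> n r)) h)"
    have "partial (\<lambda>n. c n \<tau>) = (\<lambda>N r. \<Sum>n<N. c n \<tau> * complex_of_real (laguerre_fun_scaled \<alpha> \<tau> n r))"
      by (simp add: partial_def fun_eq_iff)
    then have h: "L2_tendsto half_line (partial (\<lambda>n. c n \<tau>)) h"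
      unfolding h_def using someI_ex[OF ex_L2_series[OF elim(1)]] by simp
    have val: "laguerre_inverse \<alpha> \<tau> (\<lambda>n. c n \<tau>) r = p (r, \<tau>)" "point_value h r = p (r, \<tau>)" if "r > 0" for r
    proof -
      show "point_value h r = p (r, \<tau>)"
        unfolding p_def fst_conv snd_conv
        by (rule point_value_series) (use h that in \<open>simp_all add: e_def orthonormal_system_axioms\<close>)
      then show "laguerre_inverse \<alpha> \<tau> (\<lambda>n. c n \<tau>) r = p (r, \<tau>)"
        unfolding laguerre_inverse_def h_def[symmetric] .
    qed
    have h2: "h \<in> L2 half_line" using h by (simp add: L2_tendsto_def)
    have "AE r in half_line. r > (0::real)" by (rule AE_I2) simp
    with point_value_AE[OF L2_half_line_imp_local[OF h2]]
    have eq: "AE r in half_line. h r = p (r, \<tau>)"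
      by eventually_elim (simp add: val)
    have p2: "(\<lambda>r. p (r, \<tau>)) \<in> L2 half_line"
      by (rule L2_cong_AE[OF h2 borel_measurable_half_line[OF section_measurable(2)[OF p_meas]] eq])
    have "L2_norm half_line (\<lambda>r. partial (\<lambda>n. c n \<tau>) N r - h r) = L2_norm half_line (\<lambda>r. partial (\<lambda>n. c n \<tau>) N r - p (r, \<tau>))" for N
      by (intro L2_norm_cong_AE L2_measurable L2_diff partial_L2 h2 p2) (use eq in \<open>auto elim!: eventually_mono\<close>)
    then have "L2_tendsto half_line (partial (\<lambda>n. c n \<tau>)) (\<lambda>r. p (r, \<tau>))"
      using h p2 by (simp add: L2_tendsto_def)
    then show ?case using val(1) by blast
  qed
  show ?thesis
  proof (rule that)
    show "laguerre_pair \<alpha> p c"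
      using main p_meas c by (auto simp: laguerre_pair_def elim!: eventually_mono)
    fix d assume "AE \<tau> in half_line. \<forall>n. d n \<tau> = c n \<tau>"
    with main show "AE \<tau> in half_line. \<forall>r>0. laguerre_inverse \<alpha> \<tau> (\<lambda>n. d n \<tau>) r = p (r, \<tau>)"
      by eventually_elim simp
  qed
qed

lemma G_transform_eq:
  assumes "p \<in> borel_measurable borel"
    and "AE r in half_line. \<forall>\<tau>>0. hankel \<beta> (\<lambda>s. f (r, s)) \<tau> = p (r, \<tau>)" and "\<tau> > 0"
  shows "G_transform \<alpha> \<beta> f (n, \<tau>) = laguerre_transform \<alpha> \<tau> (\<lambda>r. p (r, \<tau>)) n"
  unfolding G_transform_def case_prod_conv
  by (rule laguerre_transform_cong_AE)
    (use assms in \<open>auto intro!: borel_measurable_half_line section_measurable elim!: eventually_mono\<close>)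

lemma L2_Gamma_spaceI:
  assumes \<alpha>: "\<alpha> > -1" and pair: "laguerre_pair \<alpha> p c" and p: "p \<in> L2 quadrant"
    and eq: "\<And>n \<tau>. \<tau> > 0 \<Longrightarrow> F (n, \<tau>) = c n \<tau>"
  shows "F \<in> L2 Gamma_space" "L2_norm Gamma_space F = L2_norm quadrant p"
proof -
  have c: "c n \<in> borel_measurable half_line" for n
    using pair by (intro borel_measurable_half_line) (simp add: laguerre_pair_def)
  have "F \<in> borel_measurable Gamma_space"
  proof (rule measurable_pair_measure_countable1)
    fix n
    show "(\<lambda>\<tau>. F (n, \<tau>)) \<in> borel_measurable half_line"
      by (rule measurable_cong[THEN iffD2, OF _ c[of n]]) (simp add: eq)
  qed simp
  moreover have "(\<integral>\<^sup>+x. ennreal ((cmod (p x))\<^sup>2) \<partial>quadrant) = (\<integral>\<^sup>+x. ennreal ((cmod (F x))\<^sup>2) \<partial>Gamma_space)"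
    unfolding laguerre_pair_norm[OF \<alpha> pair]
    by (intro nn_integral_cong) (auto simp: space_pair_measure eq)
  ultimately show "F \<in> L2 Gamma_space" "L2_norm Gamma_space F = L2_norm quadrant p"
    using L2_eq_nn_integral[OF p] by blast+
qed

text \<open>
  Each section of \<open>F\<close> is replaced by a Borel function; countably many null sets arise.
\<close>

lemma Gamma_space_borel_version:
  assumes F: "F \<in> L2 Gamma_space"
  obtains c where "\<And>n. c n \<in> borel_measurable borel" "AE \<tau> in half_line. \<forall>n. F (n, \<tau>) = c n \<tau>"
    "AE \<tau> in half_line. summable (\<lambda>n. (cmod (c n \<tau>))\<^sup>2)"
    "(\<integral>\<^sup>+x. ennreal ((cmod (F x))\<^sup>2) \<partial>Gamma_space) = (\<integral>\<^sup>+x. ennreal ((cmod (c (fst x) (snd x)))\<^sup>2) \<partial>Gamma_space)"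
proof -
  have Fn: "(\<lambda>\<tau>. F (n, \<tau>)) \<in> borel_measurable half_line" for n
    by (rule measurable_compose[OF measurable_Pair1' L2_measurable[OF F]]) simp
  have "\<exists>g. g \<in> borel_measurable borel \<and> (AE \<tau> in half_line. F (n, \<tau>) = g \<tau>)" for n
    by (rule lebesgue_on_borel_version[OF _ Fn[of n]]) auto
  then obtain c where c: "\<And>n. c n \<in> borel_measurable borel" "\<And>n. AE \<tau> in half_line. F (n, \<tau>) = c n \<tau>"
    by metis
  have F2: "(\<lambda>\<tau>. ennreal ((cmod (F (n, \<tau>)))\<^sup>2)) \<in> borel_measurable half_line" for n
    using Fn[of n] by measurable
  have c2: "(\<lambda>\<tau>. ennreal ((cmod (c n \<tau>))\<^sup>2)) \<in> borel_measurable half_line" for n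
    using c(1)[of n] by (intro borel_measurable_half_line) measurable
  have eq: "(\<integral>\<^sup>+x. ennreal ((cmod (F x))\<^sup>2) \<partial>Gamma_space) = (\<Sum>n. \<integral>\<^sup>+\<tau>. ennreal ((cmod (c n \<tau>))\<^sup>2) \<partial>half_line)"
  proof -
    have "(\<integral>\<^sup>+\<tau>. ennreal ((cmod (F (n, \<tau>)))\<^sup>2) \<partial>half_line) = (\<integral>\<^sup>+\<tau>. ennreal ((cmod (c n \<tau>))\<^sup>2) \<partial>half_line)" for n
      using c(2)[of n] by (intro nn_integral_cong_AE) (auto elim!: eventually_mono)
    then show ?thesis using nn_integral_Gamma_space[OF F2] by simp
  qed
  have "(\<Sum>n. \<integral>\<^sup>+\<tau>. ennreal ((cmod (c n \<tau>))\<^sup>2) \<partial>half_line) = (\<integral>\<^sup>+\<tau>. (\<Sum>n. ennreal ((cmod (c n \<tau>))\<^sup>2)) \<partial>half_line)"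
    by (rule nn_integral_suminf[OF c2, symmetric])
  then have "(\<integral>\<^sup>+\<tau>. (\<Sum>n. ennreal ((cmod (c n \<tau>))\<^sup>2)) \<partial>half_line) \<noteq> \<infinity>"
    using eq nn_integral_L2_norm[OF F] by (metis ennreal_neq_top infinity_ennreal_def)
  then have "AE \<tau> in half_line. (\<Sum>n. ennreal ((cmod (c n \<tau>))\<^sup>2)) \<noteq> \<infinity>"
    by (intro nn_integral_PInf_AE borel_measurable_suminf_order c2)
  then have sq: "AE \<tau> in half_line. summable (\<lambda>n. (cmod (c n \<tau>))\<^sup>2)"
    unfolding infinity_ennreal_def by eventually_elim (rule summable_suminf_not_top[OF zero_le_power2])
  show ?thesis
  proof (rule that[OF c(1) _ sq])
    show "AE \<tau> in half_line. \<forall>n. F (n, \<tau>) = c n \<tau>" using c(2) by (simp add: AE_all_countable)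
    show "(\<integral>\<^sup>+x. ennreal ((cmod (F x))\<^sup>2) \<partial>Gamma_space) = (\<integral>\<^sup>+x. ennreal ((cmod (c (fst x) (snd x)))\<^sup>2) \<partial>Gamma_space)"
      unfolding eq by (subst nn_integral_Gamma_space) (simp_all add: c2)
  qed
qed

text \<open>
  A Borel version \<open>f'\<close> of \<open>f\<close> has a partial Hankel transform \<open>p\<close>, whose Laguerre coefficients are
  the values of the mixed transform, for every \<open>\<tau> > 0\<close>.
\<close>

lemma G_transform_L2:
  assumes \<alpha>: "\<alpha> > -1" and \<beta>: "\<beta> > -1" and f: "f \<in> L2 quadrant"
  obtains f' p where "f' \<in> borel_measurable borel" "AE x in quadrant. f x = f' x" "hankel_pair \<beta> f' p"
    "laguerre_pair \<alpha> p (\<lambda>n \<tau>. laguerre_transform \<alpha> \<tau> (\<lambda>r. p (r, \<tau>)) n)"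
    "\<And>n \<tau>. \<tau> > 0 \<Longrightarrow> G_transform \<alpha> \<beta> f (n, \<tau>) = laguerre_transform \<alpha> \<tau> (\<lambda>r. p (r, \<tau>)) n"
    "G_transform \<alpha> \<beta> f \<in> L2 Gamma_space" "L2_norm Gamma_space (G_transform \<alpha> \<beta> f) = L2_norm quadrant f"
    "p \<in> L2 quadrant"
proof -
  obtain f' where f': "f' \<in> borel_measurable borel" "AE x in quadrant. f x = f' x"
    by (rule lebesgue_on_borel_version[OF open_quadrant_measurable(2) L2_measurable[OF f]])
  have f'q: "f' \<in> borel_measurable quadrant"
    using f'(1) by (intro measurable_restrict_space1 measurable_completion) simp
  have f'2: "f' \<in> L2 quadrant" "L2_norm quadrant f' = L2_norm quadrant f"
    using L2_cong_AE[OF f f'q f'(2)] L2_norm_cong_AE[OF L2_measurable[OF f] f'q f'(2)] by simp_all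
  obtain p where p: "hankel_pair \<beta> f' p"
    "\<And>g. AE r in half_line. AE s in half_line. g (r, s) = f' (r, s) \<Longrightarrow>
       AE r in half_line. \<forall>\<tau>>0. hankel \<beta> (\<lambda>s. g (r, s)) \<tau> = p (r, \<tau>)"
    by (rule ex_hankel_pair[OF \<beta> f'(1) f'2(1)]) (rule that, assumption, blast)
  have pm: "p \<in> borel_measurable borel" using p(1) by (simp add: hankel_pair_def)
  note p2 = hankel_pair_norm[OF \<beta> p(1) f'2(1)]
  have lp: "laguerre_pair \<alpha> p (\<lambda>n \<tau>. laguerre_transform \<alpha> \<tau> (\<lambda>r. p (r, \<tau>)) n)"
    by (rule laguerre_pair_transform[OF \<alpha> pm p2(1)])
  note eq = G_transform_eq[OF pm p(2)[OF AE_quadrant_sections[OF f'(2)]]]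
  show ?thesis
    by (rule that[OF f' p(1) lp eq]) (use L2_Gamma_spaceI[OF \<alpha> lp p2(1) eq] p2 f'2 in auto)
qed

theorem theorem3p1:
  fixes \<alpha> \<beta> :: real
  assumes "\<alpha> > -1" and "\<beta> > -1"
  shows "(\<forall>f\<in>L2 quadrant.
            G_transform \<alpha> \<beta> f \<in> L2 Gamma_space \<and>
            L2_norm Gamma_space (G_transform \<alpha> \<beta> f) = L2_norm quadrant f \<and>
            (AE x in quadrant. f x = G_inverse \<alpha> \<beta> (G_transform \<alpha> \<beta> f) x)) \<and>
         (\<forall>F\<in>L2 Gamma_space.
            G_inverse \<alpha> \<beta> F \<in> L2 quadrant \<and>
            L2_norm quadrant (G_inverse \<alpha> \<beta> F) = L2_norm Gamma_space F \<and>
            (AE y in Gamma_space. F y = G_transform \<alpha> \<beta> (G_inverse \<alpha> \<beta> F) y))"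
proof (intro conjI ballI)
  note \<alpha> = assms(1) and \<beta> = assms(2)
  have pos: "AE \<tau> in half_line. \<tau> > (0::real)" by (rule AE_I2) simp
  \<comment> \<open>Laguerre synthesis \<open>q\<close> followed by the Hankel transform \<open>t\<close>, starting from a Borel version \<open>c\<close> of \<open>F\<close>\<close>
  have inverse: "\<exists>q t. laguerre_pair \<alpha> q c \<and> hankel_pair \<beta> q t \<and> q \<in> L2 quadrant \<and> L2_norm quadrant q = L2_norm Gamma_space F \<and>
      (AE x in quadrant. G_inverse \<alpha> \<beta> F x = t x)"
    if F: "F \<in> L2 Gamma_space" and c: "\<And>n. c n \<in> borel_measurable borel" "AE \<tau> in half_line. \<forall>n. F (n, \<tau>) = c n \<tau>"
     "AE \<tau> in half_line. summable (\<lambda>n. (cmod (c n \<tau>))\<^sup>2)"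
     "(\<integral>\<^sup>+x. ennreal ((cmod (F x))\<^sup>2) \<partial>Gamma_space) = (\<integral>\<^sup>+x. ennreal ((cmod (c (fst x) (snd x)))\<^sup>2) \<partial>Gamma_space)"
    for F c
  proof -
    obtain q where q: "laguerre_pair \<alpha> q c"
      "\<And>d. AE \<tau> in half_line. \<forall>n. d n \<tau> = c n \<tau> \<Longrightarrow>
         AE \<tau> in half_line. \<forall>r>0. laguerre_inverse \<alpha> \<tau> (\<lambda>n. d n \<tau>) r = q (r, \<tau>)"
      by (rule ex_laguerre_pair[OF \<alpha> c(1,3)]) (rule that, assumption, blast)
    have qm: "q \<in> borel_measurable borel" using q(1) by (simp add: laguerre_pair_def)
    then have "q \<in> borel_measurable quadrant"
      by (intro measurable_restrict_space1 measurable_completion) simp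
    from L2_eq_nn_integral[OF F this]
    have q2: "q \<in> L2 quadrant" "L2_norm quadrant q = L2_norm Gamma_space F"
      using c(4) laguerre_pair_norm[OF \<alpha> q(1)] by simp_all
    obtain t where t: "hankel_pair \<beta> q t"
      "\<And>g. AE r in half_line. AE s in half_line. g (r, s) = q (r, s) \<Longrightarrow>
         AE r in half_line. \<forall>\<tau>>0. hankel \<beta> (\<lambda>s. g (r, s)) \<tau> = t (r, \<tau>)"
      by (rule ex_hankel_pair[OF \<beta> qm q2(1)]) (rule that, assumption, blast)
    have "AE r in half_line. AE \<tau> in half_line. (\<lambda>(r, \<tau>). laguerre_inverse \<alpha> \<tau> (\<lambda>n. F (n, \<tau>)) r) (r, \<tau>) = q (r, \<tau>)"
      by (rule AE_I2) (use q(2)[of "\<lambda>n \<tau>. F (n, \<tau>)", OF c(2)] in \<open>auto elim!: eventually_mono\<close>)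
    from t(2)[OF this]
    have "AE r in half_line. \<forall>s>0. hankel \<beta> (\<lambda>\<tau>. laguerre_inverse \<alpha> \<tau> (\<lambda>n. F (n, \<tau>)) r) s = t (r, s)"
      by simp
    then have "AE x in quadrant. G_inverse \<alpha> \<beta> F x = t x"
      by (intro AE_quadrant_first) (simp add: G_inverse_def)
    then show ?thesis using q q2 t by blast
  qed
  {
    fix f assume f: "f \<in> L2 quadrant"
    show "G_transform \<alpha> \<beta> f \<in> L2 Gamma_space" "L2_norm Gamma_space (G_transform \<alpha> \<beta> f) = L2_norm quadrant f"
      by (rule G_transform_L2[OF \<alpha> \<beta> f], assumption)+
    obtain f' p where f': "f' \<in> borel_measurable borel" "AE x in quadrant. f x = f' x" and hp: "hankel_pair \<beta> f' p"
      and lp: "laguerre_pair \<alpha> p (\<lambda>n \<tau>. laguerre_transform \<alpha> \<tau> (\<lambda>r. p (r, \<tau>)) n)"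
      and eq: "\<And>n \<tau>. \<tau> > 0 \<Longrightarrow> G_transform \<alpha> \<beta> f (n, \<tau>) = laguerre_transform \<alpha> \<tau> (\<lambda>r. p (r, \<tau>)) n"
      and G: "G_transform \<alpha> \<beta> f \<in> L2 Gamma_space"
      by (rule G_transform_L2[OF \<alpha> \<beta> f]) (rule that, (assumption | blast)+)
    let ?c = "\<lambda>n \<tau>. laguerre_transform \<alpha> \<tau> (\<lambda>r. p (r, \<tau>)) n"
    have sq: "AE \<tau> in half_line. summable (\<lambda>n. (cmod (?c n \<tau>))\<^sup>2)"
      using pos lp[unfolded laguerre_pair_def, THEN conjunct2, THEN conjunct2]
    proof eventually_elim
      case (elim \<tau>)
      interpret orthonormal_system half_line "laguerre_fun_scaled \<alpha> \<tau>"
        by (rule orthonormal_laguerre[OF \<alpha> elim(1)])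
      show ?case by (rule sums_summable[OF norm_L2_series[OF elim(2)]])
    qed
    have cint: "(\<integral>\<^sup>+x. ennreal ((cmod (G_transform \<alpha> \<beta> f x))\<^sup>2) \<partial>Gamma_space) = (\<integral>\<^sup>+x. ennreal ((cmod (?c (fst x) (snd x)))\<^sup>2) \<partial>Gamma_space)"
      by (intro nn_integral_cong) (auto simp: space_pair_measure eq)
    have ceq: "AE \<tau> in half_line. \<forall>n. G_transform \<alpha> \<beta> f (n, \<tau>) = ?c n \<tau>"
      by (rule AE_I2) (simp add: eq)
    have "?c n \<in> borel_measurable borel" for n
      using lp by (simp add: laguerre_pair_def)
    from inverse[OF G this ceq sq cint] obtain q t where q: "laguerre_pair \<alpha> q ?c" "hankel_pair \<beta> q t"
      and t: "AE x in quadrant. G_inverse \<alpha> \<beta> (G_transform \<alpha> \<beta> f) x = t x"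
      by blast
    \<comment> \<open>\<open>p\<close> and \<open>q\<close> have the same Laguerre coefficients, and \<open>f'\<close> is the Hankel transform of \<open>p\<close>\<close>
    have "hankel_pair \<beta> q f'"
      by (rule hankel_pair_cong[OF \<beta> hankel_pair_sym[OF \<beta> hp] _ laguerre_pair_unique[OF lp q(1)]])
        (use q(1) in \<open>simp add: laguerre_pair_def\<close>)
    then have "AE r in half_line. AE s in half_line. t (r, s) = f' (r, s)"
      by (rule hankel_pair_unique[OF q(2)])
    then have "AE x in quadrant. t x = f' x"
      using q(2) f'(1) eq_set_measurable[of t borel f'] by (intro AE_quadrantI) (simp_all add: hankel_pair_def)
    with f'(2) t show "AE x in quadrant. f x = G_inverse \<alpha> \<beta> (G_transform \<alpha> \<beta> f) x"
      by eventually_elim simp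
  }
  fix F assume F: "F \<in> L2 Gamma_space"
  obtain c where c: "\<And>n. c n \<in> borel_measurable borel" "AE \<tau> in half_line. \<forall>n. F (n, \<tau>) = c n \<tau>"
    "AE \<tau> in half_line. summable (\<lambda>n. (cmod (c n \<tau>))\<^sup>2)"
    "(\<integral>\<^sup>+x. ennreal ((cmod (F x))\<^sup>2) \<partial>Gamma_space) = (\<integral>\<^sup>+x. ennreal ((cmod (c (fst x) (snd x)))\<^sup>2) \<partial>Gamma_space)"
    by (rule Gamma_space_borel_version[OF F]) (rule that, (assumption | blast)+)
  obtain q t where q: "laguerre_pair \<alpha> q c" "hankel_pair \<beta> q t" "q \<in> L2 quadrant" "L2_norm quadrant q = L2_norm Gamma_space F"
    and t: "AE x in quadrant. G_inverse \<alpha> \<beta> F x = t x"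
    using inverse[OF F c] by blast
  note t2 = hankel_pair_norm[OF \<beta> q(2,3)]
  have Gm: "G_inverse \<alpha> \<beta> F \<in> borel_measurable quadrant"
    by (rule borel_measurable_lebesgue_on_cong_AE[OF open_quadrant_measurable(2) L2_measurable[OF t2(1)] t])
  have t': "AE x in quadrant. t x = G_inverse \<alpha> \<beta> F x" using t by eventually_elim simp
  show G2: "G_inverse \<alpha> \<beta> F \<in> L2 quadrant" by (rule L2_cong_AE[OF t2(1) Gm t'])
  show "L2_norm quadrant (G_inverse \<alpha> \<beta> F) = L2_norm Gamma_space F"
    using L2_norm_cong_AE[OF L2_measurable[OF t2(1)] Gm t'] t2(2) q(4) by simp
  let ?g = "G_inverse \<alpha> \<beta> F"
  obtain f' p where f': "f' \<in> borel_measurable borel" "AE x in quadrant. ?g x = f' x" and hp: "hankel_pair \<beta> f' p"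
    and eq: "\<And>n \<tau>. \<tau> > 0 \<Longrightarrow> G_transform \<alpha> \<beta> ?g (n, \<tau>) = laguerre_transform \<alpha> \<tau> (\<lambda>r. p (r, \<tau>)) n"
    and G: "G_transform \<alpha> \<beta> ?g \<in> L2 Gamma_space"
    by (rule G_transform_L2[OF \<alpha> \<beta> G2]) (rule that, (assumption | blast)+)
  have m: "p \<in> borel_measurable borel" "q \<in> borel_measurable borel"
    using hp q(2) by (simp_all add: hankel_pair_def)
  have "AE x in quadrant. t x = f' x" using t f'(2) by eventually_elim simp
  \<comment> \<open>both \<open>p\<close> and \<open>q\<close> are Hankel transforms of a version of \<open>G_inverse \<alpha> \<beta> F\<close>\<close>
  then have "hankel_pair \<beta> f' q"
    by (rule hankel_pair_cong[OF \<beta> hankel_pair_sym[OF \<beta> q(2)] f'(1) AE_quadrant_sections])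
  then have "AE r in half_line. AE \<tau> in half_line. p (r, \<tau>) = q (r, \<tau>)"
    by (rule hankel_pair_unique[OF hp])
  then have pq: "AE \<tau> in half_line. AE r in half_line. p (r, \<tau>) = q (r, \<tau>)"
    using eq_set_measurable[OF m] by (intro AE_sections_commute) simp_all
  have "AE \<tau> in half_line. \<forall>n. F (n, \<tau>) = G_transform \<alpha> \<beta> ?g (n, \<tau>)"
    using pq c(2) laguerre_pair_coeff[OF \<alpha> q(1)] pos
  proof eventually_elim
    case (elim \<tau>)
    have "laguerre_transform \<alpha> \<tau> (\<lambda>r. p (r, \<tau>)) n = laguerre_transform \<alpha> \<tau> (\<lambda>r. q (r, \<tau>)) n" for n
      by (rule laguerre_transform_cong_AE[OF borel_measurable_half_line[OF section_measurable(2)[OF m(2)]] elim(1)])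
    then show ?case using elim eq by simp
  qed
  then show "AE y in Gamma_space. F y = G_transform \<alpha> \<beta> ?g y"
    by (intro AE_Gamma_space L2_measurable F G) (simp add: AE_all_countable)
qed

end
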